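(* Let $Q\neq 0$ be real, $a>1$, and let $V(z)$ belong to the class $\mathfrak M^{-1,Q}_{\kappa_0}$ with $a=\frac{1+\kappa_0}{1-\kappa_0}$, i.e. $$V(z)=Q+\int_{\mathbb R}\left(\frac{1}{\lambda-z}-\frac{\lambda}{1+\lambda^2}\right)d\mu(\lambda),\qquad \int_{\mathbb R}\frac{d\mu(\lambda)}{1+\lambda^2}=a,$$ where $\mu$ is an infinite Borel measure on $\mathbb R$. Then $V(z)$ can be realized as the impedance function $V_\Theta(z)$ of a minimal L-system $\Theta$ (with one-dimensional input-output space $\mathbb C$ and $J=1$) whose main operator $T$ has von Neumann parameter $$\kappa=\frac{a\left(b+\sqrt{b^2+4Q^2}\right)^2-\left(b-2Q^2+\sqrt{b^2+4Q^2}\right)^2-4Q^2a(a-1)}{\left(b-2Q^2+\sqrt{b^2+4Q^2}\right)^2+a\left(b+\sqrt{b^2+4Q^2}\right)^2+4Q^2a(a+1)},\qquad b=Q^2+a^2-1.$$ Moreover, the quasi-kernel $\hat A$ of $\mathrm{Re}\,\mathbb A$ of the realizing L-system $\Theta$ has the unimodular von Neumann parameter $$U=\frac{(a+Qi)(1-\kappa^2)-1-\kappa^2}{2\kappa}$$ with this value of $\kappa$.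
   Context: Rigged space: for a closed densely defined symmetric operator $\dot A$ with deficiency indices $(1,1)$ in a complex Hilbert space $\mathcal H$, let $\mathcal H_+=\mathrm{Dom}(\dot A^* )$ with $(f,g)_+=(f,g)+(\dot A^*f,\dot A^*g)$, and let $\mathcal H_+\subset\mathcal H\subset\mathcal H_-$ be the associated rigged Hilbert space ($\mathcal H_-$ is the dual of $\mathcal H_+$ with respect to the pairing extending the inner product of $\mathcal H$). $[X,Y]$ denotes bounded linear operators $X\to Y$. If $\mathbb A\in[\mathcal H_+,\mathcal H_-]$ then $\mathbb A^*\in[\mathcal H_+,\mathcal H_-]$; $\mathrm{Re}\,\mathbb A=(\mathbb A+\mathbb A^* )/2$, $\mathrm{Im}\,\mathbb A=(\mathbb A-\mathbb A^* )/2i$. The quasi-kernel $\hat A$ of $\mathrm{Re}\,\mathbb A$ is its restriction to $\{f\in\mathcal H_+:\mathrm{Re}\,\mathbb A f\in\mathcal H\}$. L-system: let $T$ be a non-symmetric operator with $\dot A\subset T\subset\dot A^*$, $\rho(T)\ne\emptyset$, $\mathrm{Dom}(\dot A)=\mathrm{Dom}(T)\cap\mathrm{Dom}(T^* )$. A $( * )$-extension of $T$ is $\mathbb A\in[\mathcal H_+,\mathcal H_-]$ with $\dot A\subset T\subset\mathbb A$, $\dot A\subset T^*\subset\mathbb A^*$ such that the quasi-kernel $\hat A$ of $\mathrm{Re}\,\mathbb A$ is self-adjoint in $\mathcal H$. An L-system with one-dimensional input-output is $\Theta=\begin{pmatrix}\mathbb A&K&1\\ \mathcal H_+\subset\mathcal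 H\subset\mathcal H_-&&\mathbb C\end{pmatrix}$ where $\mathbb A$ (state-space operator) is a $( * )$-extension of such a $T$ (main operator), $K\in[\mathbb C,\mathcal H_-]$, $\mathrm{Im}\,\mathbb A=KK^*$, $\mathrm{Ran}(K)=\mathrm{Ran}(\mathrm{Im}\,\mathbb A)$. It is minimal if $\dot A$ is prime (no nontrivial reducing subspace on which $\dot A$ induces a self-adjoint operator). Its impedance function is $V_\Theta(z)=K^*(\mathrm{Re}\,\mathbb A-zI)^{-1}K$, $z\in\rho(\hat A)$. Parameters: for normalized $g_\pm\in\mathrm{Ker}(\dot A^*\mp iI)$, the von Neumann parameter $\kappa$ of $T$ is defined by $g_+-\kappa g_-\in\mathrm{Dom}(T)$, $|\kappa|<1$; the vectors $g_\pm$ are chosen (changing the phase of $g_-$) so that $0\le\kappa<1$. The parameter $U$ ($|U|=1$) of $\hat A$ is defined, with respect to the same pair $g_\pm$, by $g_++Ug_-\in\mathrm{Dom}(\hat A)$, i.e. $\mathrm{Dom}(\hat A)=\mathrm{Dom}(\dot A)\dot+\mathrm{span}\{g_++Ug_-\}$. "Realized" means $V=V_\Theta$ on $\mathbb C_\pm$ ($V$ extended by $V(\bar z)=\overline{V(z)}$), for a suitable choice of rigged space and deficiency vectors. *)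

theory Defs
  imports "HOL-Analysis.Analysis" "HOL-Algebra.Module"
begin

section \<open>Complex Hilbert spaces with an explicit carrier\<close>

text \<open>Realization theorems assert the existence of a Hilbert space, so Hilbert spaces are records
  rather than types: vector spaces are modules of HOL-Algebra over the field of complex numbers,
  together with an inner product that is linear in the first argument.  The ring multiplication and
  unit that the module record inherits play no role.\<close>

definition complex_ring :: "complex ring" where
  "complex_ring = \<lparr>carrier = UNIV, mult = (*), one = 1, zero = 0, add = (+)\<rparr>"

lemma complex_ring_simps [simp]:
  "carrier complex_ring = UNIV" "x \<otimes>\<^bsub>complex_ring\<^esub> y = x * y" "\<one>\<^bsub>complex_ring\<^esub> = 1"
  "\<zero>\<^bsub>complex_ring\<^esub> = 0" "x \<oplus>\<^bsub>complex_ring\<^esub> y = x + y"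
  by (simp_all add: complex_ring_def)

lemma cring_complex_ring: "cring complex_ring"
proof (rule cringI)
  show "abelian_group complex_ring"
    by (rule abelian_groupI) (auto intro: exI [of _ "- x" for x])
  show "comm_monoid complex_ring"
    by (rule comm_monoidI) auto
qed (simp add: distrib_right)

record 'a inner_space = "(complex, 'a) module" +
  ip :: "'a \<Rightarrow> 'a \<Rightarrow> complex"

definition hnorm :: "('a, 'm) inner_space_scheme \<Rightarrow> 'a \<Rightarrow> real" where
  "hnorm H x = sqrt (Re (ip H x x))"

text \<open>The guard is needed because \<^locale>\<open>Metric_space\<close> asks for nonnegativity and symmetry also
  outside the carrier.\<close>

definition hdist :: "('a, 'm) inner_space_scheme \<Rightarrow> 'a \<Rightarrow> 'a \<Rightarrow> real" where
  "hdist H x y = (if x \<in> carrier H \<and> y \<in> carrier H then hnorm H (x \<ominus>\<^bsub>H\<^esub> y) else 0)"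

definition htopology :: "('a, 'm) inner_space_scheme \<Rightarrow> 'a topology" where
  "htopology H = Metric_space.mtopology (carrier H) (hdist H)"

locale complex_inner_space = module complex_ring H for H :: "('a, 'm) inner_space_scheme" (structure) +
  assumes ip_add_left: "\<lbrakk>x \<in> carrier H; y \<in> carrier H; z \<in> carrier H\<rbrakk>
      \<Longrightarrow> ip H (x \<oplus> y) z = ip H x z + ip H y z"
    and ip_smult_left: "\<lbrakk>x \<in> carrier H; y \<in> carrier H\<rbrakk> \<Longrightarrow> ip H (c \<odot> x) y = c * ip H x y"
    and ip_cnj: "\<lbrakk>x \<in> carrier H; y \<in> carrier H\<rbrakk> \<Longrightarrow> ip H y x = cnj (ip H x y)"
    and ip_nonneg: "x \<in> carrier H \<Longrightarrow> 0 \<le> Re (ip H x x)"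
    and ip_definite: "\<lbrakk>x \<in> carrier H; ip H x x = 0\<rbrakk> \<Longrightarrow> x = \<zero>"

locale complex_hilbert_space = complex_inner_space H for H :: "('a, 'm) inner_space_scheme" (structure) +
  assumes complete: "Metric_space.mcomplete (carrier H) (hdist H)"

context complex_inner_space
begin

lemma smult_mem: "x \<in> carrier H \<Longrightarrow> c \<odot> x \<in> carrier H"
  using smult_closed [of c x] by simp

lemma ip_add_right: "\<lbrakk>x \<in> carrier H; y \<in> carrier H; z \<in> carrier H\<rbrakk>
    \<Longrightarrow> ip H z (x \<oplus> y) = ip H z x + ip H z y"
  by (metis M.add.m_closed complex_cnj_add ip_add_left ip_cnj)

lemma ip_smult_right: "\<lbrakk>x \<in> carrier H; y \<in> carrier H\<rbrakk> \<Longrightarrow> ip H y (c \<odot> x) = cnj c * ip H y x"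
  by (metis smult_mem complex_cnj_mult ip_smult_left ip_cnj)

lemma ip_self: "x \<in> carrier H \<Longrightarrow> ip H x x = of_real (Re (ip H x x))"
  using ip_cnj [of x x] by (simp add: complex_eq_iff)

lemma minus_one: "x \<in> carrier H \<Longrightarrow> \<ominus> x = (-1) \<odot> x"
proof -
  assume x: "x \<in> carrier H"
  have "(-1) \<odot> x \<oplus> x = (-1) \<odot> x \<oplus> 1 \<odot> x"
    using x smult_one [of x] by simp
  also have "\<dots> = (-1 + 1) \<odot> x"
    using smult_l_distr [of "-1" 1 x] x by simp
  also have "\<dots> = \<zero>"
    using smult_l_null [of x] x by simp
  finally show ?thesis
    using x smult_mem by (simp add: M.minus_equality)
qed

lemma Re_ip_add_smult:
  fixes t :: real
  assumes "x \<in> carrier H" "y \<in> carrier H"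
  shows "Re (ip H (x \<oplus> of_real t \<odot> y) (x \<oplus> of_real t \<odot> y))
    = Re (ip H x x) + 2 * t * Re (ip H x y) + t^2 * Re (ip H y y)"
  using assms ip_cnj [of x y]
  by (simp add: ip_add_left ip_add_right ip_smult_left ip_smult_right smult_mem
      power2_eq_square algebra_simps)

lemma Re_ip_le:
  assumes "x \<in> carrier H" "y \<in> carrier H"
  shows "Re (ip H x y) \<le> hnorm H x * hnorm H y"
proof (cases "Re (ip H y y) = 0")
  case True
  then have "y = \<zero>"
    using ip_definite [of y] ip_self [of y] assms by simp
  then have "y = 0 \<odot> y"
    using smult_l_null [of y] assms by simp
  then have "ip H x y = 0"
    using ip_smult_right [of y x 0] assms by simp
  then show ?thesis
    using ip_nonneg assms by (simp add: hnorm_def)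
next
  case False
  define a b c where "a = Re (ip H x x)" and "b = Re (ip H x y)" and "c = Re (ip H y y)"
  have pos: "c > 0" "a \<ge> 0"
    using False ip_nonneg assms by (auto simp: a_def c_def less_le)
  have "0 \<le> a + 2 * (- b / c) * b + (- b / c)^2 * c"
    using Re_ip_add_smult [of x y "- b / c"] ip_nonneg assms smult_mem
    unfolding a_def b_def c_def by (metis M.add.m_closed)
  also have "\<dots> = a - b^2 / c"
    using pos by (simp add: field_simps power2_eq_square)
  finally have "b^2 \<le> a * c"
    using pos by (simp add: field_simps)
  then have "\<bar>b\<bar> \<le> sqrt (a * c)"
    by (metis real_sqrt_abs real_sqrt_le_iff)
  then show ?thesis
    by (simp add: hnorm_def real_sqrt_mult a_def b_def c_def)
qed

lemma hnorm_triangle: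
  assumes "x \<in> carrier H" "y \<in> carrier H"
  shows "hnorm H (x \<oplus> y) \<le> hnorm H x + hnorm H y"
proof (rule power2_le_imp_le)
  have "(hnorm H (x \<oplus> y))\<^sup>2 = (hnorm H x)\<^sup>2 + 2 * Re (ip H x y) + (hnorm H y)\<^sup>2"
    using Re_ip_add_smult [of x y 1] assms ip_nonneg [of x] ip_nonneg [of y]
      ip_nonneg [of "x \<oplus> y"] smult_one [of y] by (simp add: hnorm_def)
  also have "\<dots> \<le> (hnorm H x + hnorm H y)\<^sup>2"
    using Re_ip_le [of x y] assms by (simp add: power2_sum)
  finally show "(hnorm H (x \<oplus> y))\<^sup>2 \<le> (hnorm H x + hnorm H y)\<^sup>2" .
  show "0 \<le> hnorm H x + hnorm H y"
    using assms ip_nonneg by (simp add: hnorm_def)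
qed

lemma Metric_space_hdist: "Metric_space (carrier H) (hdist H)"
proof
  fix x y
  show "0 \<le> hdist H x y"
    by (simp add: hdist_def hnorm_def ip_nonneg)
  have "x \<ominus> y = (-1) \<odot> (y \<ominus> x)" if "x \<in> carrier H" "y \<in> carrier H"
    using that minus_one [of "y \<ominus> x"] by (metis M.minus_closed M.minus_add M.minus_minus M.a_comm M.a_inv_closed a_minus_def)
  then show "hdist H x y = hdist H y x"
    by (auto simp: hdist_def hnorm_def ip_smult_left ip_smult_right smult_mem)
next
  fix x y assume xy: "x \<in> carrier H" "y \<in> carrier H"
  have z: "ip H \<zero> \<zero> = 0"
    using ip_smult_left [of \<zero> \<zero> 0] smult_l_null [of \<zero>] by simp
  have "hdist H x y = 0 \<longleftrightarrow> ip H (x \<ominus> y) (x \<ominus> y) = 0"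
    using xy ip_self [of "x \<ominus> y"] by (auto simp: hdist_def hnorm_def complex_eq_iff)
  also have "\<dots> \<longleftrightarrow> x \<ominus> y = \<zero>"
    using ip_definite [of "x \<ominus> y"] xy z by auto
  also have "\<dots> \<longleftrightarrow> x = y"
    using xy by (metis M.minus_equality M.minus_minus M.r_neg M.a_inv_closed a_minus_def)
  finally show "hdist H x y = 0 \<longleftrightarrow> x = y" .
next
  fix x y z assume xyz: "x \<in> carrier H" "y \<in> carrier H" "z \<in> carrier H"
  have "x \<ominus> z = (x \<ominus> y) \<oplus> (y \<ominus> z)"
    using xyz by (simp add: a_minus_def M.a_ac M.r_neg1 M.r_neg2)
  then show "hdist H x z \<le> hdist H x y + hdist H y z"
    using hnorm_triangle [of "x \<ominus> y" "y \<ominus> z"] xyz by (simp add: hdist_def)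
qed

end


section \<open>Unbounded operators as graphs\<close>

text \<open>An operator is identified with its graph, so that an extension of operators is an inclusion
  of sets and \<^const>\<open>Domain\<close> is the domain.\<close>

definition linear_op :: "('a, 'm) inner_space_scheme \<Rightarrow> 'a rel \<Rightarrow> bool" where
  "linear_op H A \<longleftrightarrow> A \<subseteq> carrier H \<times> carrier H \<and> single_valued A \<and> (\<zero>\<^bsub>H\<^esub>, \<zero>\<^bsub>H\<^esub>) \<in> A \<and>
     (\<forall>(f, f') \<in> A. \<forall>(g, g') \<in> A. (f \<oplus>\<^bsub>H\<^esub> g, f' \<oplus>\<^bsub>H\<^esub> g') \<in> A) \<and>
     (\<forall>(f, f') \<in> A. \<forall>c. (c \<odot>\<^bsub>H\<^esub> f, c \<odot>\<^bsub>H\<^esub> f') \<in> A)"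

definition op_app :: "'a rel \<Rightarrow> 'a \<Rightarrow> 'a" where
  "op_app A f = (THE h. (f, h) \<in> A)"

definition closed_op :: "('a, 'm) inner_space_scheme \<Rightarrow> 'a rel \<Rightarrow> bool" where
  "closed_op H A \<longleftrightarrow> closedin (prod_topology (htopology H) (htopology H)) A"

definition densely_defined :: "('a, 'm) inner_space_scheme \<Rightarrow> 'a rel \<Rightarrow> bool" where
  "densely_defined H A \<longleftrightarrow> htopology H closure_of Domain A = carrier H"

definition adj :: "('a, 'm) inner_space_scheme \<Rightarrow> 'a rel \<Rightarrow> 'a rel" where
  "adj H A = {(g, k). g \<in> carrier H \<and> k \<in> carrier H \<and> (\<forall>(f, h) \<in> A. ip H h g = ip H f k)}"

definition symmetric_op :: "('a, 'm) inner_space_scheme \<Rightarrow> 'a rel \<Rightarrow> bool" where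
  "symmetric_op H A \<longleftrightarrow> linear_op H A \<and> densely_defined H A \<and> A \<subseteq> adj H A"

definition selfadjoint_op :: "('a, 'm) inner_space_scheme \<Rightarrow> 'a rel \<Rightarrow> bool" where
  "selfadjoint_op H A \<longleftrightarrow> linear_op H A \<and> densely_defined H A \<and> adj H A = A"

text \<open>Boundedness below of \<open>A - z\<close> gives both its injectivity and the boundedness of its inverse.\<close>

definition resolvent_set :: "('a, 'm) inner_space_scheme \<Rightarrow> 'a rel \<Rightarrow> complex set" where
  "resolvent_set H A = {z. (\<forall>h \<in> carrier H. \<exists>(f, f') \<in> A. f' \<ominus>\<^bsub>H\<^esub> z \<odot>\<^bsub>H\<^esub> f = h) \<and>
     (\<exists>C. \<forall>(f, f') \<in> A. hnorm H f \<le> C * hnorm H (f' \<ominus>\<^bsub>H\<^esub> z \<odot>\<^bsub>H\<^esub> f))}"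

definition eigenspace :: "'a rel \<Rightarrow> ('a, 'm) inner_space_scheme \<Rightarrow> complex \<Rightarrow> 'a set" where
  "eigenspace A H z = {g \<in> carrier H. (g, z \<odot>\<^bsub>H\<^esub> g) \<in> A}"

definition one_dimensional :: "('a, 'm) inner_space_scheme \<Rightarrow> 'a set \<Rightarrow> bool" where
  "one_dimensional H S \<longleftrightarrow> (\<exists>g \<in> carrier H. g \<noteq> \<zero>\<^bsub>H\<^esub> \<and> S = range (\<lambda>c. c \<odot>\<^bsub>H\<^esub> g))"

definition deficiency_indices_1_1 :: "('a, 'm) inner_space_scheme \<Rightarrow> 'a rel \<Rightarrow> bool" where
  "deficiency_indices_1_1 H A \<longleftrightarrow>
     one_dimensional H (eigenspace (adj H A) H \<i>) \<and> one_dimensional H (eigenspace (adj H A) H (- \<i>))"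

definition orthogonal_complement :: "('a, 'm) inner_space_scheme \<Rightarrow> 'a set \<Rightarrow> 'a set" where
  "orthogonal_complement H M = {g \<in> carrier H. \<forall>f \<in> M. ip H f g = 0}"

text \<open>\<open>M\<close> reduces \<open>A\<close> when \<open>A\<close> is the orthogonal sum of its parts in \<open>M\<close> and in the complement.\<close>

definition reducing_subspace :: "('a, 'm) inner_space_scheme \<Rightarrow> 'a rel \<Rightarrow> 'a set \<Rightarrow> bool" where
  "reducing_subspace H A M \<longleftrightarrow> submodule M complex_ring H \<and> closedin (htopology H) M \<and>
     (\<forall>(f, h) \<in> A. \<exists>(f\<^sub>1, h\<^sub>1) \<in> A \<inter> M \<times> M.
        \<exists>(f\<^sub>2, h\<^sub>2) \<in> A \<inter> orthogonal_complement H M \<times> orthogonal_complement H M.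
          f = f\<^sub>1 \<oplus>\<^bsub>H\<^esub> f\<^sub>2 \<and> h = h\<^sub>1 \<oplus>\<^bsub>H\<^esub> h\<^sub>2)"

definition prime_op :: "('a, 'm) inner_space_scheme \<Rightarrow> 'a rel \<Rightarrow> bool" where
  "prime_op H A \<longleftrightarrow> \<not> (\<exists>M. M \<noteq> {\<zero>\<^bsub>H\<^esub>} \<and> reducing_subspace H A M \<and>
     selfadjoint_op (H\<lparr>carrier := M\<rparr>) (A \<inter> M \<times> M))"


section \<open>Rigged spaces\<close>

definition plus_space :: "('a, 'm) inner_space_scheme \<Rightarrow> 'a rel \<Rightarrow> ('a, 'm) inner_space_scheme" where
  "plus_space H A = H\<lparr>carrier := Domain (adj H A),
     ip := (\<lambda>f g. ip H f g + ip H (op_app (adj H A) f) (op_app (adj H A) g))\<rparr>"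

text \<open>The negative space consists of the bounded antilinear functionals on the positive space \<open>P\<close>; the
  pairing of \<open>\<phi>\<close> with \<open>g\<close> is \<open>\<phi> g\<close>.  Functionals vanish outside the carrier of \<open>P\<close>, so that equality
  of functionals is equality of functions.\<close>

definition minus_space :: "('a, 'm) inner_space_scheme \<Rightarrow> ('a \<Rightarrow> complex) set" where
  "minus_space P = {\<phi>. (\<forall>g. g \<notin> carrier P \<longrightarrow> \<phi> g = 0) \<and>
     (\<forall>f \<in> carrier P. \<forall>g \<in> carrier P. \<phi> (f \<oplus>\<^bsub>P\<^esub> g) = \<phi> f + \<phi> g) \<and>
     (\<forall>g \<in> carrier P. \<forall>c. \<phi> (c \<odot>\<^bsub>P\<^esub> g) = cnj c * \<phi> g) \<and>
     (\<exists>C. \<forall>g \<in> carrier P. cmod (\<phi> g) \<le> C * hnorm P g)}"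

definition minus_norm :: "('a, 'm) inner_space_scheme \<Rightarrow> ('a \<Rightarrow> complex) \<Rightarrow> real" where
  "minus_norm P \<phi> = (SUP g \<in> {g \<in> carrier P. hnorm P g \<le> 1}. cmod (\<phi> g))"

text \<open>The embedding of the space \<open>H\<close> into the negative space.\<close>

definition embed :: "('a, 'm) inner_space_scheme \<Rightarrow> ('a, 'm) inner_space_scheme \<Rightarrow> 'a \<Rightarrow> 'a \<Rightarrow> complex" where
  "embed H P h = (\<lambda>g. if g \<in> carrier P then ip H h g else 0)"

definition bounded_plus_minus :: "('a, 'm) inner_space_scheme \<Rightarrow> ('a \<Rightarrow> 'a \<Rightarrow> complex) \<Rightarrow> bool" where
  "bounded_plus_minus P B \<longleftrightarrow> (\<forall>f \<in> carrier P. B f \<in> minus_space P) \<and>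
     (\<forall>f \<in> carrier P. \<forall>g \<in> carrier P. B (f \<oplus>\<^bsub>P\<^esub> g) = (\<lambda>u. B f u + B g u)) \<and>
     (\<forall>f \<in> carrier P. \<forall>c. B (c \<odot>\<^bsub>P\<^esub> f) = (\<lambda>u. c * B f u)) \<and>
     (\<exists>C. \<forall>f \<in> carrier P. minus_norm P (B f) \<le> C * hnorm P f)"

definition bounded_C_minus :: "('a, 'm) inner_space_scheme \<Rightarrow> (complex \<Rightarrow> 'a \<Rightarrow> complex) \<Rightarrow> bool" where
  "bounded_C_minus P K \<longleftrightarrow> (\<forall>c. K c \<in> minus_space P) \<and>
     (\<forall>c d. K (c + d) = (\<lambda>u. K c u + K d u)) \<and> (\<forall>c d. K (c * d) = (\<lambda>u. c * K d u)) \<and>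
     (\<exists>C. \<forall>c. minus_norm P (K c) \<le> C * cmod c)"

text \<open>The adjoint of \<open>B\<close> is given by \<open>(B\<^sup>* f, g) = (f, B g)\<close>, and that of \<open>K\<close> by
  \<open>(K c, f) = c * cnj (K\<^sup>* f)\<close>.\<close>

definition plus_minus_adj ::
    "('a, 'm) inner_space_scheme \<Rightarrow> ('a \<Rightarrow> 'a \<Rightarrow> complex) \<Rightarrow> 'a \<Rightarrow> 'a \<Rightarrow> complex" where
  "plus_minus_adj P B f = (\<lambda>g. if g \<in> carrier P then cnj (B g f) else 0)"

definition C_minus_adj :: "(complex \<Rightarrow> 'a \<Rightarrow> complex) \<Rightarrow> 'a \<Rightarrow> complex" where
  "C_minus_adj K f = cnj (K 1 f)"

definition re_part ::
    "('a, 'm) inner_space_scheme \<Rightarrow> ('a \<Rightarrow> 'a \<Rightarrow> complex) \<Rightarrow> 'a \<Rightarrow> 'a \<Rightarrow> complex" where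
  "re_part P B f = (\<lambda>g. (B f g + plus_minus_adj P B f g) / 2)"

definition im_part ::
    "('a, 'm) inner_space_scheme \<Rightarrow> ('a \<Rightarrow> 'a \<Rightarrow> complex) \<Rightarrow> 'a \<Rightarrow> 'a \<Rightarrow> complex" where
  "im_part P B f = (\<lambda>g. (B f g - plus_minus_adj P B f g) / (2 * \<i>))"

definition quasi_kernel ::
    "('a, 'm) inner_space_scheme \<Rightarrow> ('a, 'm) inner_space_scheme \<Rightarrow> ('a \<Rightarrow> 'a \<Rightarrow> complex) \<Rightarrow> 'a rel" where
  "quasi_kernel H P R = {(f, h). f \<in> carrier P \<and> h \<in> carrier H \<and> R f = embed H P h}"

definition restricts ::
    "('a, 'm) inner_space_scheme \<Rightarrow> ('a, 'm) inner_space_scheme \<Rightarrow> 'a rel \<Rightarrow> ('a \<Rightarrow> 'a \<Rightarrow> complex) \<Rightarrow> bool" where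
  "restricts H P T B \<longleftrightarrow> (\<forall>(f, h) \<in> T. f \<in> carrier P \<and> B f = embed H P h)"


section \<open>L-systems with one-dimensional input-output space\<close>

record 'a L_system =
  state_space :: "'a inner_space"
  sym_op :: "'a rel"
  main_op :: "'a rel"
  state_op :: "'a \<Rightarrow> 'a \<Rightarrow> complex"
  channel_op :: "complex \<Rightarrow> 'a \<Rightarrow> complex"

definition main_operator_of :: "('a, 'm) inner_space_scheme \<Rightarrow> 'a rel \<Rightarrow> 'a rel \<Rightarrow> bool" where
  "main_operator_of H A T \<longleftrightarrow> linear_op H T \<and> A \<subseteq> T \<and> T \<subseteq> adj H A \<and> \<not> T \<subseteq> adj H T \<and>
     resolvent_set H T \<noteq> {} \<and> Domain A = Domain T \<inter> Domain (adj H T)"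

definition star_extension ::
    "('a, 'm) inner_space_scheme \<Rightarrow> 'a rel \<Rightarrow> 'a rel \<Rightarrow> ('a \<Rightarrow> 'a \<Rightarrow> complex) \<Rightarrow> bool" where
  "star_extension H A T B \<longleftrightarrow> (let P = plus_space H A in
     bounded_plus_minus P B \<and> A \<subseteq> T \<and> restricts H P T B \<and>
     A \<subseteq> adj H T \<and> restricts H P (adj H T) (plus_minus_adj P B) \<and>
     selfadjoint_op H (quasi_kernel H P (re_part P B)))"

definition pos_space :: "'a L_system \<Rightarrow> 'a inner_space" where
  "pos_space \<Theta> = plus_space (state_space \<Theta>) (sym_op \<Theta>)"

definition is_L_system :: "'a L_system \<Rightarrow> bool" where
  "is_L_system \<Theta> \<longleftrightarrow>
     (let H = state_space \<Theta>; A = sym_op \<Theta>; T = main_op \<Theta>; P = pos_space \<Theta>;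
          B = state_op \<Theta>; K = channel_op \<Theta>
      in complex_hilbert_space H \<and>
         symmetric_op H A \<and> closed_op H A \<and> deficiency_indices_1_1 H A \<and>
         main_operator_of H A T \<and> star_extension H A T B \<and> bounded_C_minus P K \<and>
         (\<forall>f \<in> carrier P. im_part P B f = K (C_minus_adj K f)) \<and>
         range K = im_part P B ` carrier P)"

definition minimal_L_system :: "'a L_system \<Rightarrow> bool" where
  "minimal_L_system \<Theta> \<longleftrightarrow> is_L_system \<Theta> \<and> prime_op (state_space \<Theta>) (sym_op \<Theta>)"

definition L_quasi_kernel :: "'a L_system \<Rightarrow> 'a rel" where
  "L_quasi_kernel \<Theta> =
     quasi_kernel (state_space \<Theta>) (pos_space \<Theta>) (re_part (pos_space \<Theta>) (state_op \<Theta>))"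

definition re_state_minus :: "'a L_system \<Rightarrow> complex \<Rightarrow> 'a \<Rightarrow> 'a \<Rightarrow> complex" where
  "re_state_minus \<Theta> z f =
     (\<lambda>g. re_part (pos_space \<Theta>) (state_op \<Theta>) f g - z * embed (state_space \<Theta>) (pos_space \<Theta>) f g)"

definition impedance :: "'a L_system \<Rightarrow> complex \<Rightarrow> complex" where
  "impedance \<Theta> z = C_minus_adj (channel_op \<Theta>)
     (the_inv_into (carrier (pos_space \<Theta>)) (re_state_minus \<Theta> z) (channel_op \<Theta> 1))"

text \<open>The first three conjuncts say that the impedance function is defined at \<open>z\<close>; in particular its
  value is not an artefact of the totality of \<^const>\<open>the_inv_into\<close>.\<close>

definition realizes :: "'a L_system \<Rightarrow> (complex \<Rightarrow> complex) \<Rightarrow> bool" where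
  "realizes \<Theta> V \<longleftrightarrow> (\<forall>z. Im z \<noteq> 0 \<longrightarrow>
     z \<in> resolvent_set (state_space \<Theta>) (L_quasi_kernel \<Theta>) \<and>
     inj_on (re_state_minus \<Theta> z) (carrier (pos_space \<Theta>)) \<and>
     channel_op \<Theta> 1 \<in> re_state_minus \<Theta> z ` carrier (pos_space \<Theta>) \<and>
     V z = impedance \<Theta> z)"

definition normalized_deficiency_vectors :: "'a L_system \<Rightarrow> 'a \<Rightarrow> 'a \<Rightarrow> bool" where
  "normalized_deficiency_vectors \<Theta> gp gm \<longleftrightarrow>
     (let H = state_space \<Theta>; As = adj H (sym_op \<Theta>)
      in gp \<in> eigenspace As H \<i> \<and> hnorm H gp = 1 \<and> gm \<in> eigenspace As H (- \<i>) \<and> hnorm H gm = 1)"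

definition von_neumann_parameter :: "'a L_system \<Rightarrow> 'a \<Rightarrow> 'a \<Rightarrow> real \<Rightarrow> bool" where
  "von_neumann_parameter \<Theta> gp gm \<kappa> \<longleftrightarrow> 0 \<le> \<kappa> \<and> \<kappa> < 1 \<and>
     (let H = state_space \<Theta> in gp \<ominus>\<^bsub>H\<^esub> complex_of_real \<kappa> \<odot>\<^bsub>H\<^esub> gm \<in> Domain (main_op \<Theta>))"

definition quasi_kernel_von_neumann_parameter :: "'a L_system \<Rightarrow> 'a \<Rightarrow> 'a \<Rightarrow> complex \<Rightarrow> bool" where
  "quasi_kernel_von_neumann_parameter \<Theta> gp gm U \<longleftrightarrow> cmod U = 1 \<and>
     (let H = state_space \<Theta>; g = gp \<oplus>\<^bsub>H\<^esub> U \<odot>\<^bsub>H\<^esub> gm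
      in g \<notin> Domain (sym_op \<Theta>) \<and>
         Domain (L_quasi_kernel \<Theta>) = {f \<oplus>\<^bsub>H\<^esub> c \<odot>\<^bsub>H\<^esub> g | f c. f \<in> Domain (sym_op \<Theta>)})"


section \<open>Perturbed generalized Donoghue classes\<close>

definition infinite_borel_measure :: "real measure \<Rightarrow> bool" where
  "infinite_borel_measure \<mu> \<longleftrightarrow> sets \<mu> = sets borel \<and> emeasure \<mu> (space \<mu>) = \<infinity>"

text \<open>The class written \<open>M\<close> with superscript \<open>-1, Q\<close> and subscript \<open>\<kappa>\<close>; its members are functions on
  the complement of the real axis.\<close>

definition donoghue_inv_class :: "real \<Rightarrow> real \<Rightarrow> (complex \<Rightarrow> complex) set" where
  "donoghue_inv_class Q \<kappa> = {V. \<exists>\<mu>. infinite_borel_measure \<mu> \<and>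
     has_bochner_integral \<mu> (\<lambda>x. 1 / (1 + x\<^sup>2)) ((1 + \<kappa>) / (1 - \<kappa>)) \<and>
     (\<forall>z. Im z \<noteq> 0 \<longrightarrow>
        V z = complex_of_real Q + (LINT x|\<mu>. (1 / (complex_of_real x - z) - complex_of_real (x / (1 + x\<^sup>2)))))}"

end

theory Submission
  imports Defs
begin

text \<open>The state space is the complex \<open>L\<^sup>2(\<mu>)\<close>.  Multiplication by the variable, restricted to the functions of
  integral zero, is symmetric; its adjoint sends \<open>f\<close> to \<open>x f - c f\<close>, where \<open>c f\<close> is the unique constant that
  makes this square integrable.  With \<open>d f\<close> the integral of \<open>f - c f x / (1 + x\<^sup>2)\<close>, Green's identity reads
  \<open>(A\<^sup>* f, g) - (f, A\<^sup>* g) = d f cnj (c g) - c f cnj (d g)\<close>, and the deficiency vector \<open>\<gamma> z = 1 / (x - z)\<close> has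
  \<open>c (\<gamma> z) = 1\<close> and \<open>d (\<gamma> z) = V z - Q\<close>.  Put \<open>k = d + Q c\<close>.  The state-space operator
  \<open>(A\<^sup>* f, g) + (c f + \<i> k f) cnj (k g)\<close> has the imaginary part \<open>k f cnj (k g)\<close>; its real part minus \<open>z\<close> sends
  \<open>\<gamma> z\<close> to the channel functional, so the impedance is \<open>k (\<gamma> z) = V z\<close>.  The main operator is given by
  \<open>c f + \<i> k f = 0\<close> and the quasi-kernel by \<open>c f = 0\<close>, from which the von Neumann parameters are read off on
  \<open>\<gamma> \<i>\<close> and \<open>\<gamma> (-\<i>)\<close>, using \<open>d (\<gamma> (\<plusminus>\<i>)) = \<plusminus>\<i> a\<close>.\<close>

section \<open>Inner product spaces\<close>

context complex_inner_space
begin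

lemma ip_zero_left [simp]: "x \<in> carrier H \<Longrightarrow> ip H \<zero> x = 0"
  using ip_smult_left [of \<zero> x 0] smult_l_null [of \<zero>] by simp

lemma ip_zero_right [simp]: "x \<in> carrier H \<Longrightarrow> ip H x \<zero> = 0"
  using ip_cnj [of \<zero> x] by simp

lemma ip_minus_left: "\<lbrakk>x \<in> carrier H; y \<in> carrier H; z \<in> carrier H\<rbrakk>
    \<Longrightarrow> ip H (x \<ominus> y) z = ip H x z - ip H y z"
  by (simp add: a_minus_def minus_one ip_add_left ip_smult_left smult_mem)

lemma ip_minus_right: "\<lbrakk>x \<in> carrier H; y \<in> carrier H; z \<in> carrier H\<rbrakk>
    \<Longrightarrow> ip H z (x \<ominus> y) = ip H z x - ip H z y"
  by (simp add: a_minus_def minus_one ip_add_right ip_smult_right smult_mem)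

lemmas ip_simps = ip_add_left ip_add_right ip_minus_left ip_minus_right ip_smult_left ip_smult_right

lemma eq_iff_minus: "\<lbrakk>x \<in> carrier H; y \<in> carrier H\<rbrakk> \<Longrightarrow> x \<ominus> y = \<zero> \<longleftrightarrow> x = y"
  by (metis M.minus_equality M.minus_minus M.r_neg M.a_inv_closed a_minus_def)

text \<open>Vector identities are checked after pairing with an arbitrary vector, where they become
  identities of complex numbers.\<close>

lemma ip_eqI:
  assumes "x \<in> carrier H" "y \<in> carrier H" "\<And>u. u \<in> carrier H \<Longrightarrow> ip H x u = ip H y u"
  shows "x = y"
  using ip_definite [of "x \<ominus> y"] assms eq_iff_minus by (simp add: ip_minus_left)

lemma hnorm_nonneg [simp]: "x \<in> carrier H \<Longrightarrow> 0 \<le> hnorm H x"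
  by (simp add: hnorm_def ip_nonneg)

lemma hnorm_power2: "x \<in> carrier H \<Longrightarrow> (hnorm H x)\<^sup>2 = Re (ip H x x)"
  by (simp add: hnorm_def ip_nonneg)

lemma ip_self_hnorm: "x \<in> carrier H \<Longrightarrow> ip H x x = complex_of_real ((hnorm H x)\<^sup>2)"
  by (metis hnorm_power2 ip_self)

lemma hnorm_eq_0: "x \<in> carrier H \<Longrightarrow> hnorm H x = 0 \<longleftrightarrow> x = \<zero>"
  by (metis hnorm_power2 ip_definite ip_self ip_zero_left of_real_0 power_zero_numeral
      zero_complex.simps(1) zero_eq_power2)

lemma hnorm_smult: "x \<in> carrier H \<Longrightarrow> hnorm H (t \<odot> x) = cmod t * hnorm H x"
proof -
  assume x: "x \<in> carrier H"
  have "ip H (t \<odot> x) (t \<odot> x) = t * cnj t * ip H x x"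
    using x by (simp add: ip_simps smult_mem)
  also have "\<dots> = complex_of_real ((cmod t)\<^sup>2) * ip H x x"
    by (simp add: complex_norm_square del: of_real_power)
  finally have "Re (ip H (t \<odot> x) (t \<odot> x)) = (cmod t)\<^sup>2 * Re (ip H x x)"
    by (metis Re_complex_of_real ip_self of_real_mult x)
  then show ?thesis by (simp add: hnorm_def real_sqrt_mult)
qed

lemma cmod_ip_le:
  assumes "x \<in> carrier H" "y \<in> carrier H"
  shows "cmod (ip H x y) \<le> hnorm H x * hnorm H y"
proof (cases "ip H x y = 0")
  case False
  define u where "u = cnj (ip H x y) / cmod (ip H x y)"
  have "u * ip H x y = complex_of_real ((cmod (ip H x y))\<^sup>2) / cmod (ip H x y)"
    by (simp add: u_def complex_norm_square mult.commute del: of_real_power)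
  also have "\<dots> = complex_of_real (cmod (ip H x y))"
    using False by (simp add: power2_eq_square)
  finally have u: "u * ip H x y = complex_of_real (cmod (ip H x y))" .
  have "cmod (ip H x y) = Re (ip H (u \<odot> x) y)"
    using assms u by (simp add: ip_simps)
  also have "\<dots> \<le> hnorm H (u \<odot> x) * hnorm H y"
    using assms by (intro Re_ip_le) (auto simp: smult_mem)
  also have "\<dots> = hnorm H x * hnorm H y"
    using assms False by (simp add: hnorm_smult u_def norm_divide)
  finally show ?thesis .
qed (use assms in simp)

sublocale metric: Metric_space "carrier H" "hdist H"
  by (rule Metric_space_hdist)

lemma htopology_metric: "htopology H = metric.mtopology"
  by (simp add: htopology_def)

lemma topspace_htopology [simp]: "topspace (htopology H) = carrier H"
  by (simp add: htopology_metric)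

lemma continuous_map_ip:
  assumes "y \<in> carrier H"
  shows "continuous_map (htopology H) euclidean (\<lambda>x. ip H x y)"
proof -
  have "continuous_map metric.mtopology Met_TC.mtopology (\<lambda>x. ip H x y)"
    unfolding metric.metric_continuous_map [OF Met_TC.Metric_space_axioms]
  proof (intro conjI ballI allI impI)
    fix a and \<epsilon> :: real assume a: "a \<in> carrier H" and e: "0 < \<epsilon>"
    define \<delta> where "\<delta> = \<epsilon> / (hnorm H y + 1)"
    have pos: "hnorm H y + 1 > 0"
      using assms by (simp add: add_nonneg_pos)
    have "dist (ip H a y) (ip H x y) < \<epsilon>" if x: "x \<in> carrier H" "hdist H a x < \<delta>" for x
    proof -
      have "dist (ip H a y) (ip H x y) = cmod (ip H (a \<ominus> x) y)"
        using a x assms by (simp add: ip_simps dist_norm)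
      also have "\<dots> \<le> hnorm H (a \<ominus> x) * hnorm H y"
        using a x assms by (intro cmod_ip_le) auto
      also have "\<dots> \<le> hnorm H (a \<ominus> x) * (hnorm H y + 1)"
        using a x by (intro mult_left_mono) auto
      also have "\<dots> < \<epsilon>"
        using a x pos by (simp add: hdist_def \<delta>_def field_simps)
      finally show ?thesis .
    qed
    then show "\<exists>\<delta>>0. \<forall>x. x \<in> carrier H \<and> hdist H a x < \<delta> \<longrightarrow> dist (ip H a y) (ip H x y) < \<epsilon>"
      using e pos by (intro exI [of _ \<delta>]) (auto simp: \<delta>_def)
  qed auto
  then show ?thesis
    by (simp add: htopology_metric)
qed

lemma closed_op_adj:
  assumes "A \<subseteq> carrier H \<times> carrier H"
  shows "closed_op H (adj H A)"
proof -
  let ?X = "prod_topology (htopology H) (htopology H)"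
  have top: "topspace ?X = carrier H \<times> carrier H"
    by simp
  have 1: "continuous_map ?X euclidean (\<lambda>p. cnj (ip H (fst p) u))" if "u \<in> carrier H" for u
    using continuous_map_compose [OF continuous_map_compose [OF continuous_map_fst
          continuous_map_ip [OF that]], of euclidean cnj] by (simp add: o_def continuous_on_cnj)
  have 2: "continuous_map ?X euclidean (\<lambda>p. cnj (ip H (snd p) u))" if "u \<in> carrier H" for u
    using continuous_map_compose [OF continuous_map_compose [OF continuous_map_snd
          continuous_map_ip [OF that]], of euclidean cnj] by (simp add: o_def continuous_on_cnj)
  define F where "F q = {p \<in> topspace ?X. cnj (ip H (fst p) (snd q)) = cnj (ip H (snd p) (fst q))}" for q
  have F: "(g, k) \<in> F (f, h) \<longleftrightarrow> ip H h g = ip H f k"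
    if "(f, h) \<in> A" "g \<in> carrier H" "k \<in> carrier H" for f h g k
  proof -
    have "f \<in> carrier H" "h \<in> carrier H"
      using that assms by auto
    then show ?thesis
      using that ip_cnj [of g h] ip_cnj [of k f] by (simp add: F_def)
  qed
  have "adj H A = topspace ?X \<inter> (\<Inter>q \<in> A. F q)"
  proof (intro subset_antisym subsetI)
    fix p assume "p \<in> adj H A"
    then show "p \<in> topspace ?X \<inter> (\<Inter>q \<in> A. F q)"
      using F unfolding adj_def top by (cases p) auto
  next
    fix p assume "p \<in> topspace ?X \<inter> (\<Inter>q \<in> A. F q)"
    then show "p \<in> adj H A"
      using F unfolding adj_def top by (cases p) auto
  qed
  moreover have "closedin ?X (F q)" if "q \<in> A" for q
    unfolding F_def using that assms by (intro closedin_continuous_maps_eq [where Y = euclidean] 1 2) auto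
  then have "closedin ?X (topspace ?X \<inter> (\<Inter>q \<in> A. F q))"
    by (cases "A = {}") (auto intro!: closedin_Int closedin_INT simp del: topspace_prod_topology
        intro: closedin_topspace)
  ultimately show ?thesis
    by (simp add: closed_op_def)
qed

lemma dense_orthogonal:
  assumes "htopology H closure_of E = carrier H" "x \<in> carrier H" "E \<subseteq> carrier H"
    "\<And>g. g \<in> E \<Longrightarrow> ip H x g = 0"
  shows "x = \<zero>"
proof -
  have "\<forall>y \<in> carrier H. ip H y x = 0"
  proof -
    have "closedin (htopology H) {y \<in> topspace (htopology H). ip H y x = (\<lambda>_. 0) y}"
      by (intro closedin_continuous_maps_eq [where Y = euclidean] continuous_map_ip assms) auto
    moreover have "E \<subseteq> {y \<in> topspace (htopology H). ip H y x = (\<lambda>_. 0) y}"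
      using assms ip_cnj [of x] by (auto simp: subset_iff)
    ultimately have "htopology H closure_of E \<subseteq> {y \<in> topspace (htopology H). ip H y x = (\<lambda>_. 0) y}"
      by (intro closure_of_minimal)
    then show ?thesis
      using assms by auto
  qed
  then show ?thesis
    using assms ip_definite by blast
qed

lemma dense_sequence:
  assumes "htopology H closure_of E = carrier H" "x \<in> carrier H"
  obtains y where "\<And>n. y n \<in> E \<inter> carrier H" "(\<lambda>n::nat. hnorm H (x \<ominus> y n)) \<longlonglongrightarrow> 0"
proof -
  have *: "\<exists>y \<in> E. y \<in> metric.mball x r" if "r > 0" for r
    using assms that unfolding htopology_metric metric.metric_closure_of by blast
  have "\<exists>y. y \<in> E \<and> y \<in> metric.mball x (inverse (real (Suc n)))" for n
    using * [of "inverse (real (Suc n))"] by auto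
  then obtain y where y: "\<And>n. y n \<in> E" "\<And>n. y n \<in> metric.mball x (inverse (real (Suc n)))"
    by metis
  have le: "0 \<le> hnorm H (x \<ominus> y n)" "hnorm H (x \<ominus> y n) \<le> inverse (real (Suc n))"
    and mem: "y n \<in> E \<inter> carrier H" for n
    using y [of n] assms by (auto simp: hdist_def less_imp_le simp del: of_nat_Suc)
  have "(\<lambda>n. hnorm H (x \<ominus> y n)) \<longlonglongrightarrow> 0"
    by (rule tendsto_sandwich [OF _ _ tendsto_const LIMSEQ_inverse_real_of_nat])
      (intro always_eventually allI le)+
  then show ?thesis
    using mem by (intro that [of y])
qed

lemma limitin_hnorm:
  assumes "limitin metric.mtopology y l sequentially" "\<And>n. y n \<in> carrier H"
  shows "l \<in> carrier H" "(\<lambda>n. hnorm H (y n \<ominus> l)) \<longlonglongrightarrow> 0"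
proof -
  show l: "l \<in> carrier H"
    using assms metric.limitin_mspace by blast
  show "(\<lambda>n. hnorm H (y n \<ominus> l)) \<longlonglongrightarrow> 0"
    using assms l unfolding metric.limit_metric_sequentially
    by (auto simp: LIMSEQ_iff hdist_def)
qed

end

context complex_hilbert_space
begin

lemma reducing_decomposition:
  assumes red: "reducing_subspace H A N" and dense: "densely_defined H A"
    and sub: "A \<subseteq> carrier H \<times> carrier H" and x: "x \<in> carrier H"
  obtains u v where "u \<in> N" "v \<in> orthogonal_complement H N" "x = u \<oplus> v"
proof -
  have N: "submodule N complex_ring H" "closedin (htopology H) N"
    using red by (auto simp: reducing_subspace_def)
  interpret N: submodule N complex_ring H by (rule N)
  have NH: "N \<subseteq> carrier H"
    using N.subset by simp
  have N_minus: "f \<ominus> g \<in> N" if "f \<in> N" "g \<in> N" for f g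
    using that N.m_closed N.m_inv_closed NH by (simp add: a_minus_def a_inv_def subset_iff)
  obtain y where y: "\<And>n. y n \<in> Domain A \<inter> carrier H" "(\<lambda>n::nat. hnorm H (x \<ominus> y n)) \<longlonglongrightarrow> 0"
    using dense_sequence dense x unfolding densely_defined_def by metis
  have "\<exists>p q. p \<in> N \<and> q \<in> orthogonal_complement H N \<and> y n = p \<oplus> q" for n
  proof -
    obtain h where "(y n, h) \<in> A" using y by blast
    then show ?thesis using red unfolding reducing_subspace_def by fastforce
  qed
  then obtain p q where p: "\<And>n. p n \<in> N" and q: "\<And>n. q n \<in> orthogonal_complement H N"
    and pq: "\<And>n. y n = p n \<oplus> q n" by metis
  have mem: "p n \<in> carrier H" "q n \<in> carrier H" "y n \<in> carrier H" for n
    using p q y NH by (auto simp: orthogonal_complement_def)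
  have le: "hnorm H (p m \<ominus> p n) \<le> hnorm H (x \<ominus> y m) + hnorm H (x \<ominus> y n)" for m n
  proof -
    have "y m \<ominus> y n = (p m \<ominus> p n) \<oplus> (q m \<ominus> q n)"
      by (rule ip_eqI) (auto simp: mem pq ip_simps)
    moreover have "ip H (p m \<ominus> p n) (q m \<ominus> q n) = 0"
      using p q mem by (simp add: ip_simps orthogonal_complement_def)
    then have "Re (ip H ((p m \<ominus> p n) \<oplus> (q m \<ominus> q n)) ((p m \<ominus> p n) \<oplus> (q m \<ominus> q n)))
        = Re (ip H (p m \<ominus> p n) (p m \<ominus> p n)) + Re (ip H (q m \<ominus> q n) (q m \<ominus> q n))"
      using Re_ip_add_smult [of "p m \<ominus> p n" "q m \<ominus> q n" 1] mem smult_one [of "q m \<ominus> q n"] by simp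
    ultimately have eq: "(hnorm H (y m \<ominus> y n))\<^sup>2 = (hnorm H (p m \<ominus> p n))\<^sup>2 + (hnorm H (q m \<ominus> q n))\<^sup>2"
      by (metis hnorm_power2 M.minus_closed mem)
    have "hnorm H (p m \<ominus> p n) \<le> hnorm H (y m \<ominus> y n)"
      by (rule power2_le_imp_le) (use mem eq in auto)
    also have "y m \<ominus> y n = (x \<ominus> y n) \<oplus> (-1) \<odot> (x \<ominus> y m)"
      by (rule ip_eqI) (auto simp: mem x ip_simps smult_mem)
    also have "hnorm H \<dots> \<le> hnorm H (x \<ominus> y n) + hnorm H ((-1) \<odot> (x \<ominus> y m))"
      using mem x by (intro hnorm_triangle) (auto simp: smult_mem)
    finally show ?thesis
      using mem x by (simp add: hnorm_smult)
  qed
  have "metric.MCauchy p"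
    unfolding metric.MCauchy_def
  proof (intro conjI allI impI)
    fix \<epsilon> :: real assume "0 < \<epsilon>"
    then obtain n0 where n0: "\<And>n. n \<ge> n0 \<Longrightarrow> hnorm H (x \<ominus> y n) < \<epsilon> / 2"
      using LIMSEQ_D [OF y(2), of "\<epsilon> / 2"] by fastforce
    show "\<exists>N. \<forall>n n'. N \<le> n \<longrightarrow> N \<le> n' \<longrightarrow> hdist H (p n) (p n') < \<epsilon>"
    proof (intro exI allI impI)
      fix n n' assume "n0 \<le> n" "n0 \<le> n'"
      then show "hdist H (p n) (p n') < \<epsilon>"
        using le [of n n'] n0 [of n] n0 [of n'] mem by (simp add: hdist_def)
    qed
  qed (use mem in auto)
  then obtain u where lim: "limitin metric.mtopology p u sequentially"
    using complete unfolding metric.mcomplete_def by blast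
  have u: "u \<in> N"
    using lim N(2) p unfolding htopology_metric metric.metric_closedin_iff_sequentially_closed by blast
  have uH: "u \<in> carrier H"
    using u NH by blast
  have "ip H f (x \<ominus> u) = 0" if f: "f \<in> N" for f
  proof -
    have fH: "f \<in> carrier H" using f NH by blast
    have "cmod (ip H f (x \<ominus> u)) \<le> hnorm H f * (hnorm H (x \<ominus> y n) + hnorm H (p n \<ominus> u))" for n
    proof -
      have "ip H f (q n) = 0"
        using q [of n] f by (auto simp: orthogonal_complement_def)
      then have "ip H f (x \<ominus> u) = ip H f ((x \<ominus> y n) \<oplus> (p n \<ominus> u))"
        using mem x uH fH pq by (simp add: ip_simps)
      then have "cmod (ip H f (x \<ominus> u)) \<le> hnorm H f * hnorm H ((x \<ominus> y n) \<oplus> (p n \<ominus> u))"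
        using cmod_ip_le [of f "(x \<ominus> y n) \<oplus> (p n \<ominus> u)"] mem x uH fH by simp
      also have "\<dots> \<le> hnorm H f * (hnorm H (x \<ominus> y n) + hnorm H (p n \<ominus> u))"
        using mem x uH fH by (intro mult_left_mono hnorm_triangle) auto
      finally show ?thesis .
    qed
    moreover have "(\<lambda>n. hnorm H f * (hnorm H (x \<ominus> y n) + hnorm H (p n \<ominus> u))) \<longlonglongrightarrow> hnorm H f * (0 + 0)"
      by (intro tendsto_intros y limitin_hnorm [OF lim] mem)
    ultimately have "cmod (ip H f (x \<ominus> u)) \<le> hnorm H f * (0 + 0)"
      by (intro LIMSEQ_le_const) auto
    then show ?thesis by simp
  qed
  then have "x \<ominus> u \<in> orthogonal_complement H N"
    using x uH by (auto simp: orthogonal_complement_def)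
  moreover have "x = u \<oplus> (x \<ominus> u)"
    by (rule ip_eqI) (use x uH in \<open>auto simp: ip_simps\<close>)
  ultimately show ?thesis
    using that u by blast
qed

end

section \<open>Boundary triples\<close>

text \<open>The operator \<open>L\<close> on \<open>D\<close> is the adjoint of a symmetric operator with deficiency indices \<open>(1, 1)\<close>,
  which is its restriction to vanishing boundary values \<open>c\<close> and \<open>d\<close>.\<close>

locale boundary_triple = complex_hilbert_space H for H :: "'a inner_space" (structure) +
  fixes D :: "'a set" and L :: "'a \<Rightarrow> 'a" and c d :: "'a \<Rightarrow> complex" and \<gamma> :: "complex \<Rightarrow> 'a"
  assumes D_mem: "f \<in> D \<Longrightarrow> f \<in> carrier H"
    and L_mem: "f \<in> D \<Longrightarrow> L f \<in> carrier H"
    and D_add: "\<lbrakk>f \<in> D; g \<in> D\<rbrakk> \<Longrightarrow> f \<oplus> g \<in> D"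
    and D_smult: "f \<in> D \<Longrightarrow> t \<odot> f \<in> D"
    and L_add: "\<lbrakk>f \<in> D; g \<in> D\<rbrakk> \<Longrightarrow> L (f \<oplus> g) = L f \<oplus> L g"
    and L_smult: "f \<in> D \<Longrightarrow> L (t \<odot> f) = t \<odot> L f"
    and c_add: "\<lbrakk>f \<in> D; g \<in> D\<rbrakk> \<Longrightarrow> c (f \<oplus> g) = c f + c g"
    and c_smult: "f \<in> D \<Longrightarrow> c (t \<odot> f) = t * c f"
    and d_add: "\<lbrakk>f \<in> D; g \<in> D\<rbrakk> \<Longrightarrow> d (f \<oplus> g) = d f + d g"
    and d_smult: "f \<in> D \<Longrightarrow> d (t \<odot> f) = t * d f"
    and green: "\<lbrakk>f \<in> D; g \<in> D\<rbrakk> \<Longrightarrow> ip H (L f) g - ip H f (L g) = d f * cnj (c g) - c f * cnj (d g)"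
    and \<gamma>_mem: "Im z \<noteq> 0 \<Longrightarrow> \<gamma> z \<in> D"
    and L_\<gamma>: "Im z \<noteq> 0 \<Longrightarrow> L (\<gamma> z) = z \<odot> \<gamma> z"
    and c_\<gamma>: "Im z \<noteq> 0 \<Longrightarrow> c (\<gamma> z) = 1"
    and resolvent: "\<lbrakk>Im z \<noteq> 0; h \<in> carrier H\<rbrakk> \<Longrightarrow> \<exists>f \<in> D. c f = 0 \<and> L f \<ominus> z \<odot> f = h"
    and dense: "htopology H closure_of {f \<in> D. c f = 0 \<and> d f = 0} = carrier H"
begin

definition minimal :: "'a rel" where
  "minimal = {(f, L f) |f. f \<in> D \<and> c f = 0 \<and> d f = 0}"

text \<open>With \<open>\<alpha> = 0\<close> this is the reference self-adjoint extension, given by \<open>c f = 0\<close>.\<close>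

definition extension :: "complex \<Rightarrow> complex \<Rightarrow> 'a rel" where
  "extension \<alpha> \<beta> = {(f, L f) |f. f \<in> D \<and> \<alpha> * d f = \<beta> * c f}"

lemmas mem = D_mem L_mem D_add D_smult smult_mem
lemmas lin = L_add L_smult c_add c_smult d_add d_smult

lemma D_zero: "\<zero> \<in> D" and L_zero: "L \<zero> = \<zero>" and c_zero: "c \<zero> = 0" and d_zero: "d \<zero> = 0"
proof -
  have z: "0 \<odot> \<gamma> \<i> = \<zero>" "0 \<odot> L (\<gamma> \<i>) = \<zero>"
    using smult_l_null [of "\<gamma> \<i>"] smult_l_null [of "L (\<gamma> \<i>)"] \<gamma>_mem [of \<i>] mem by auto
  show "\<zero> \<in> D" "L \<zero> = \<zero>" "c \<zero> = 0" "d \<zero> = 0"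
    using D_smult [of "\<gamma> \<i>" 0] L_smult [of "\<gamma> \<i>" 0] c_smult [of "\<gamma> \<i>" 0] d_smult [of "\<gamma> \<i>" 0]
      \<gamma>_mem [of \<i>] unfolding z by auto
qed

lemma D_minus: "\<lbrakk>f \<in> D; g \<in> D\<rbrakk> \<Longrightarrow> f \<ominus> g \<in> D"
  and L_minus: "\<lbrakk>f \<in> D; g \<in> D\<rbrakk> \<Longrightarrow> L (f \<ominus> g) = L f \<ominus> L g"
  and c_minus: "\<lbrakk>f \<in> D; g \<in> D\<rbrakk> \<Longrightarrow> c (f \<ominus> g) = c f - c g"
  and d_minus: "\<lbrakk>f \<in> D; g \<in> D\<rbrakk> \<Longrightarrow> d (f \<ominus> g) = d f - d g"
  by (simp_all add: a_minus_def minus_one mem lin)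

lemma linear_op_minimal: "linear_op H minimal"
  and linear_op_extension: "linear_op H (extension \<alpha> \<beta>)"
  unfolding linear_op_def minimal_def extension_def
  by (auto simp: single_valued_def mem lin D_zero L_zero c_zero d_zero algebra_simps)

lemma orthogonal_minimal:
  assumes "h \<in> carrier H" "\<And>g. g \<in> D \<Longrightarrow> c g = 0 \<Longrightarrow> d g = 0 \<Longrightarrow> ip H h g = 0"
  shows "h = \<zero>"
  using dense_orthogonal [OF dense assms(1)] assms(2) mem by auto

lemma Im_ip_shift:
  assumes "f \<in> D"
  shows "Im (ip H (L f \<ominus> z \<odot> f) f) = Im (d f * cnj (c f)) - Im z * (hnorm H f)\<^sup>2"
proof -
  have "Im (ip H (L f) f - cnj (ip H (L f) f)) = Im (d f * cnj (c f) - c f * cnj (d f))"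
    using green [OF assms assms] ip_cnj [of "L f" f] assms mem by simp
  then have "Im (ip H (L f) f) = Im (d f * cnj (c f))"
    by (simp add: algebra_simps)
  then show ?thesis
    using assms mem by (simp add: ip_simps ip_self_hnorm del: of_real_power)
qed

lemma shift_bounded_below:
  assumes "f \<in> D" "Im z * Im (d f * cnj (c f)) \<le> 0" "Im z \<noteq> 0"
  shows "hnorm H f \<le> 1 / \<bar>Im z\<bar> * hnorm H (L f \<ominus> z \<odot> f)"
proof (cases "hnorm H f = 0")
  case False
  let ?t = "Im (d f * cnj (c f))"
  have pos: "hnorm H f > 0"
    using False assms mem hnorm_nonneg [of f] by (simp add: less_le)
  have "\<bar>Im z\<bar> * (hnorm H f)\<^sup>2 \<le> \<bar>?t - Im z * (hnorm H f)\<^sup>2\<bar>"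
  proof (cases "Im z > 0")
    case True
    then have "?t \<le> 0" using assms(2) by (simp add: mult_le_0_iff)
    then show ?thesis using True by simp
  next
    case False
    then have "Im z < 0" using assms(3) by simp
    then have "?t \<ge> 0" using assms(2) by (simp add: mult_le_0_iff)
    then show ?thesis using \<open>Im z < 0\<close> by simp
  qed
  also have "\<dots> \<le> cmod (ip H (L f \<ominus> z \<odot> f) f)"
    using Im_ip_shift [OF assms(1), of z] abs_Im_le_cmod by metis
  also have "\<dots> \<le> hnorm H (L f \<ominus> z \<odot> f) * hnorm H f"
    using assms mem by (intro cmod_ip_le) auto
  finally have "\<bar>Im z\<bar> * hnorm H f \<le> hnorm H (L f \<ominus> z \<odot> f)"
    using pos by (simp add: power2_eq_square)
  then show ?thesis
    using assms(3) by (simp add: field_simps)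
qed (use assms mem in auto)

lemma eigenvector_c_zero:
  assumes "f \<in> D" "c f = 0" "Im z \<noteq> 0" "L f = z \<odot> f"
  shows "f = \<zero>"
proof -
  have "L f \<ominus> z \<odot> f = \<zero>"
    using assms mem eq_iff_minus [of "L f" "z \<odot> f"] by simp
  then have "hnorm H f \<le> 0"
    using shift_bounded_below [of f z] assms hnorm_eq_0 [of \<zero>] by simp
  then show ?thesis
    using hnorm_eq_0 [of f] hnorm_nonneg [of f] assms mem by (metis order_antisym)
qed

lemma eigenspace_maximal:
  assumes "Im z \<noteq> 0"
  shows "eigenspace {(f, L f) |f. f \<in> D} H z = range (\<lambda>t. t \<odot> \<gamma> z)"
proof (intro subset_antisym subsetI)
  fix f assume "f \<in> eigenspace {(f, L f) |f. f \<in> D} H z"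
  then have f: "f \<in> D" "L f = z \<odot> f"
    by (auto simp: eigenspace_def)
  have "f \<ominus> c f \<odot> \<gamma> z = \<zero>"
  proof (rule eigenvector_c_zero [OF _ _ assms])
    have "L f \<ominus> c f \<odot> L (\<gamma> z) = z \<odot> (f \<ominus> c f \<odot> \<gamma> z)"
      by (rule ip_eqI) (use f \<gamma>_mem [OF assms] mem in \<open>auto simp: ip_simps L_\<gamma> [OF assms] algebra_simps\<close>)
    then show "L (f \<ominus> c f \<odot> \<gamma> z) = z \<odot> (f \<ominus> c f \<odot> \<gamma> z)"
      using f \<gamma>_mem [OF assms] by (simp add: L_minus lin mem)
  qed (use f \<gamma>_mem [OF assms] in \<open>auto simp: D_minus c_minus mem lin c_\<gamma> [OF assms]\<close>)
  then show "f \<in> range (\<lambda>t. t \<odot> \<gamma> z)"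
    using eq_iff_minus [of f "c f \<odot> \<gamma> z"] f \<gamma>_mem [OF assms] mem by auto
next
  fix f assume "f \<in> range (\<lambda>t. t \<odot> \<gamma> z)"
  then obtain t where t: "f = t \<odot> \<gamma> z" by blast
  have "t \<odot> (z \<odot> \<gamma> z) = z \<odot> (t \<odot> \<gamma> z)"
    using smult_assoc1 [of t z "\<gamma> z"] smult_assoc1 [of z t "\<gamma> z"] \<gamma>_mem [OF assms] mem
    by (simp add: mult.commute)
  then show "f \<in> eigenspace {(f, L f) |f. f \<in> D} H z"
    unfolding t eigenspace_def using \<gamma>_mem [OF assms] by (auto simp: mem lin L_\<gamma> [OF assms])
qed

lemma d_\<gamma>_cnj:
  assumes "Im z \<noteq> 0"
  shows "d (\<gamma> (cnj z)) = cnj (d (\<gamma> z))"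
proof -
  have "d (\<gamma> z) - cnj (d (\<gamma> (cnj z))) = 0"
    using green [of "\<gamma> z" "\<gamma> (cnj z)"] assms
    by (simp add: \<gamma>_mem L_\<gamma> c_\<gamma> ip_simps mem)
  then show ?thesis
    by (metis complex_cnj_cnj eq_iff_diff_eq_0)
qed

lemma Im_d_\<gamma>:
  assumes "Im z \<noteq> 0"
  shows "Im (d (\<gamma> z)) = Im z * (hnorm H (\<gamma> z))\<^sup>2"
proof -
  have "L (\<gamma> z) \<ominus> z \<odot> \<gamma> z = \<zero>"
    using eq_iff_minus assms by (simp add: L_\<gamma> \<gamma>_mem mem)
  then show ?thesis
    using Im_ip_shift [of "\<gamma> z" z] assms by (simp add: \<gamma>_mem c_\<gamma> mem)
qed

lemma Im_d_\<gamma>_nonzero: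
  assumes "Im z \<noteq> 0"
  shows "Im (d (\<gamma> z)) \<noteq> 0"
proof -
  have "\<gamma> z \<noteq> \<zero>"
    using c_\<gamma> [OF assms] c_zero by auto
  then show ?thesis
    using Im_d_\<gamma> [OF assms] assms hnorm_eq_0 [of "\<gamma> z"] \<gamma>_mem mem by simp
qed

lemma boundary_surj: "\<exists>f \<in> D. c f = s \<and> d f = t"
proof -
  define e where "e = d (\<gamma> \<i>)"
  have e: "e \<noteq> cnj e"
    using Im_d_\<gamma>_nonzero [of \<i>] by (auto simp: e_def complex_eq_iff)
  define x where "x = (t - s * cnj e) / (e - cnj e)"
  have "c (x \<odot> \<gamma> \<i> \<oplus> (s - x) \<odot> \<gamma> (-\<i>)) = s"
    using \<gamma>_mem [of \<i>] \<gamma>_mem [of "-\<i>"] by (simp add: lin mem c_\<gamma>)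
  moreover have "d (x \<odot> \<gamma> \<i> \<oplus> (s - x) \<odot> \<gamma> (-\<i>)) = x * e + (s - x) * cnj e"
    using \<gamma>_mem [of \<i>] \<gamma>_mem [of "-\<i>"] d_\<gamma>_cnj [of \<i>] by (simp add: lin mem e_def)
  moreover have "x * (e - cnj e) = t - s * cnj e"
    using e by (simp add: x_def)
  then have "x * e + (s - x) * cnj e = t"
    by (simp add: algebra_simps)
  ultimately show ?thesis
    using \<gamma>_mem [of \<i>] \<gamma>_mem [of "-\<i>"]
    by (intro bexI [of _ "x \<odot> \<gamma> \<i> \<oplus> (s - x) \<odot> \<gamma> (-\<i>)"]) (auto simp: mem)
qed

text \<open>The range of \<open>minimal - \<i>\<close> is the orthogonal complement of \<open>\<gamma> (-\<i>)\<close>, so that an element of the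
  adjoint differs from one in the range of the resolvent by a multiple of \<open>\<gamma> (-\<i>)\<close>.\<close>

lemma adj_minimal: "adj H minimal = {(f, L f) |f. f \<in> D}"
proof (intro subset_antisym subsetI)
  fix p assume "p \<in> adj H minimal"
  then obtain g k where p: "p = (g, k)" and g: "g \<in> carrier H" and k: "k \<in> carrier H"
    and adj: "\<And>f. f \<in> D \<Longrightarrow> c f = 0 \<Longrightarrow> d f = 0 \<Longrightarrow> ip H (L f) g = ip H f k"
    by (auto simp: adj_def minimal_def)
  let ?e = "\<gamma> (-\<i>)"
  have e: "?e \<in> D" "L ?e = (-\<i>) \<odot> ?e" "c ?e = 1"
    using \<gamma>_mem [of "-\<i>"] L_\<gamma> [of "-\<i>"] c_\<gamma> [of "-\<i>"] by auto
  have "k \<oplus> \<i> \<odot> g \<in> carrier H"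
    using g k mem by auto
  then obtain r where r: "r \<in> D" "c r = 0" "L r \<ominus> (-\<i>) \<odot> r = k \<oplus> \<i> \<odot> g"
    using resolvent [of "-\<i>"] by force
  define w where "w = g \<ominus> r"
  have w: "w \<in> carrier H"
    using g r mem by (auto simp: w_def)
  have ee: "ip H ?e ?e \<noteq> 0"
    using ip_definite [of ?e] e c_zero mem by force
  have orth: "ip H h w = 0" if h: "h \<in> carrier H" "ip H h ?e = 0" for h
  proof -
    obtain f where f: "f \<in> D" "c f = 0" "L f \<ominus> \<i> \<odot> f = h"
      using resolvent [of \<i>] h by auto
    have "d f = ip H (L f) ?e - ip H f (L ?e)"
      using green [of f ?e] f e by simp
    also have "\<dots> = ip H h ?e"
      using f(1) e mem by (simp add: ip_simps flip: f(3))
    finally have df: "d f = 0" using h by simp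
    have "ip H h r = ip H f (L r \<ominus> (-\<i>) \<odot> r)"
      using green [of f r] f(1,2) r(1,2) mem by (simp add: ip_simps flip: f(3))
    also have "\<dots> = ip H h g"
      using adj [OF f(1,2) df] f g k mem r(3) by (simp add: ip_simps flip: f(3))
    finally show ?thesis
      using h g r mem by (simp add: w_def ip_simps)
  qed
  define t where "t = ip H w ?e / ip H ?e ?e"
  have h: "w \<ominus> t \<odot> ?e \<in> carrier H" "ip H (w \<ominus> t \<odot> ?e) ?e = 0"
    using w e ee mem by (auto simp: ip_simps t_def)
  have "ip H (w \<ominus> t \<odot> ?e) (w \<ominus> t \<odot> ?e) = 0"
    using orth [OF h] h w e mem by (simp add: ip_simps)
  then have "w = t \<odot> ?e"
    using ip_definite h eq_iff_minus w e mem by metis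
  then have geq: "g = r \<oplus> t \<odot> ?e"
  proof (intro ip_eqI)
    fix u assume u: "u \<in> carrier H"
    show "ip H g u = ip H (r \<oplus> t \<odot> ?e) u"
      using arg_cong [OF \<open>w = t \<odot> ?e\<close>, where f = "\<lambda>x. ip H x u"] u g r(1) e(1) mem
      by (simp add: w_def ip_simps algebra_simps)
  qed (use g r e mem in auto)
  have "L g = k"
  proof (rule ip_eqI)
    fix u assume u: "u \<in> carrier H"
    have "ip H (L r) u + \<i> * ip H r u = ip H k u + \<i> * ip H g u"
      using arg_cong [OF r(3), where f = "\<lambda>x. ip H x u"] r(1) u g k mem by (simp add: ip_simps)
    then show "ip H (L g) u = ip H k u"
      using u r e mem unfolding geq by (simp add: lin ip_simps algebra_simps)
  qed (use geq r e k mem in auto)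
  then show "p \<in> {(f, L f) |f. f \<in> D}"
    using p geq r e mem by auto
next
  fix p assume "p \<in> {(f, L f) |f. f \<in> D}"
  then obtain g where g: "p = (g, L g)" "g \<in> D" by blast
  have "ip H (L f) g = ip H f (L g)" if "f \<in> D" "c f = 0" "d f = 0" for f
    using green [OF that(1) g(2)] that by simp
  then show "p \<in> adj H minimal"
    using g mem by (auto simp: adj_def minimal_def)
qed

lemma minimal_subset_extension: "minimal \<subseteq> extension \<alpha> \<beta>"
  by (auto simp: minimal_def extension_def)

lemma adj_antimono: "A \<subseteq> B \<Longrightarrow> adj H B \<subseteq> adj H A"
  by (fastforce simp: adj_def)

lemma adj_extension:
  assumes "\<alpha> \<noteq> 0 \<or> \<beta> \<noteq> 0"
  shows "adj H (extension \<alpha> \<beta>) = extension (cnj \<alpha>) (cnj \<beta>)"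
proof (intro subset_antisym subsetI)
  fix p assume p: "p \<in> adj H (extension \<alpha> \<beta>)"
  then obtain g where g: "p = (g, L g)" "g \<in> D"
    using adj_antimono [OF minimal_subset_extension] unfolding adj_minimal by blast
  obtain f where f: "f \<in> D" "c f = \<alpha>" "d f = \<beta>"
    using boundary_surj by blast
  have "(f, L f) \<in> extension \<alpha> \<beta>"
    using f by (auto simp: extension_def)
  then have "ip H (L f) g = ip H f (L g)"
    using p g by (auto simp: adj_def)
  then have "\<beta> * cnj (c g) = \<alpha> * cnj (d g)"
    using green [OF f(1) g(2)] f by simp
  then have "cnj \<alpha> * d g = cnj \<beta> * c g"
    by (metis complex_cnj_cnj complex_cnj_mult)
  then show "p \<in> extension (cnj \<alpha>) (cnj \<beta>)"
    using g by (auto simp: extension_def)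
next
  fix p assume "p \<in> extension (cnj \<alpha>) (cnj \<beta>)"
  then obtain g where p: "p = (g, L g)" and g: "g \<in> D" "cnj \<alpha> * d g = cnj \<beta> * c g"
    by (auto simp: extension_def)
  have g': "\<alpha> * cnj (d g) = \<beta> * cnj (c g)"
    using arg_cong [OF g(2), of cnj] by simp
  have "ip H (L f) g = ip H f (L g)" if f: "f \<in> D" "\<alpha> * d f = \<beta> * c f" for f
  proof -
    have 1: "\<alpha> * (d f * cnj (c g) - c f * cnj (d g)) = (\<alpha> * d f) * cnj (c g) - c f * (\<alpha> * cnj (d g))"
      "\<beta> * (d f * cnj (c g) - c f * cnj (d g)) = d f * (\<beta> * cnj (c g)) - (\<beta> * c f) * cnj (d g)"
      by (simp_all add: algebra_simps)
    have "\<alpha> * (d f * cnj (c g) - c f * cnj (d g)) = 0"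
      unfolding 1(1) f(2) g' by (simp add: algebra_simps)
    moreover have "\<beta> * (d f * cnj (c g) - c f * cnj (d g)) = 0"
      unfolding 1(2) f(2) [symmetric] g' [symmetric] by (simp add: algebra_simps)
    ultimately have "d f * cnj (c g) - c f * cnj (d g) = 0"
      using assms by auto
    then show ?thesis
      using green [OF f(1) g(1)] by simp
  qed
  then show "p \<in> adj H (extension \<alpha> \<beta>)"
    using g p mem by (auto simp: adj_def extension_def)
qed

lemma densely_defined_minimal: "densely_defined H minimal"
proof -
  have "Domain minimal = {f \<in> D. c f = 0 \<and> d f = 0}"
    by (auto simp: minimal_def)
  then show ?thesis
    using dense by (simp add: densely_defined_def)
qed

lemma symmetric_minimal: "symmetric_op H minimal"
  unfolding symmetric_op_def adj_minimal
  using linear_op_minimal densely_defined_minimal by (auto simp: minimal_def)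

lemma closed_minimal: "closed_op H minimal"
proof -
  have "adj H {(f, L f) |f. f \<in> D} = minimal"
  proof (intro subset_antisym subsetI)
    fix p assume p: "p \<in> adj H {(f, L f) |f. f \<in> D}"
    have "minimal \<subseteq> {(f, L f) |f. f \<in> D}"
      by (auto simp: minimal_def)
    then have "p \<in> adj H minimal"
      using p adj_antimono by blast
    then obtain g where g: "p = (g, L g)" "g \<in> D"
      unfolding adj_minimal by blast
    have eq: "ip H (L f) g = ip H f (L g)" if "f \<in> D" for f
      using p that unfolding g adj_def by auto
    obtain f1 f2 where f: "f1 \<in> D" "c f1 = 1" "d f1 = 0" "f2 \<in> D" "c f2 = 0" "d f2 = 1"
      using boundary_surj by metis
    then show "p \<in> minimal"
      using green [OF f(1) g(2)] green [OF f(4) g(2)] eq g by (auto simp: minimal_def)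
  next
    fix p assume "p \<in> minimal"
    then obtain g where g: "p = (g, L g)" "g \<in> D" "c g = 0" "d g = 0"
      by (auto simp: minimal_def)
    have "ip H (L f) g = ip H f (L g)" if "f \<in> D" for f
      using green [OF that g(2)] g by simp
    then show "p \<in> adj H {(f, L f) |f. f \<in> D}"
      using g mem by (auto simp: adj_def)
  qed
  moreover have "{(f, L f) |f. f \<in> D} \<subseteq> carrier H \<times> carrier H"
    using mem by auto
  ultimately show ?thesis
    using closed_op_adj [of "{(f, L f) |f. f \<in> D}"] by simp
qed

lemma deficiency_indices_minimal: "deficiency_indices_1_1 H minimal"
proof -
  have "one_dimensional H (eigenspace (adj H minimal) H z)" if "Im z \<noteq> 0" for z
    unfolding one_dimensional_def adj_minimal eigenspace_maximal [OF that]
    using c_\<gamma> [OF that] c_zero \<gamma>_mem [OF that] mem by (intro bexI [of _ "\<gamma> z"]) auto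
  then show ?thesis
    by (simp add: deficiency_indices_1_1_def)
qed

lemma selfadjoint_reference: "selfadjoint_op H (extension 0 1)"
proof -
  have "htopology H closure_of {f \<in> D. c f = 0 \<and> d f = 0} \<subseteq> htopology H closure_of Domain (extension 0 1)"
    by (intro closure_of_mono) (auto simp: extension_def)
  then have "densely_defined H (extension 0 1)"
    using dense closure_of_subset_topspace [of "htopology H"]
    by (auto simp: densely_defined_def)
  then show ?thesis
    using adj_extension [of 0 1] linear_op_extension by (simp add: selfadjoint_op_def)
qed

text \<open>The self-adjoint part has no nonreal eigenvalue, so the projection of a deficiency vector to the
  reducing subspace vanishes; hence the reducing subspace is invariant under resolvents.\<close>

lemma minimal_selfadjoint_part:
  assumes red: "reducing_subspace H minimal N"
    and sa: "selfadjoint_op (H\<lparr>carrier := N\<rparr>) (minimal \<inter> N \<times> N)"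
    and f: "f \<in> N" and z: "Im z \<noteq> 0"
  shows "ip H f (\<gamma> z) = 0" "\<exists>w \<in> N. w \<in> D \<and> c w = 0 \<and> d w = 0 \<and> L w = f \<oplus> z \<odot> w"
proof -
  have "submodule N complex_ring H"
    using red by (auto simp: reducing_subspace_def)
  then interpret N: submodule N complex_ring H .
  have NH: "f \<in> carrier H" if "f \<in> N" for f
    using that N.subset by auto
  have N_smult: "t \<odot> f \<in> N" if "f \<in> N" for t f
    using N.smult_closed [of t f] that by simp
  have sub: "minimal \<subseteq> carrier H \<times> carrier H"
    using mem by (auto simp: minimal_def)
  have orth: "ip H f (\<gamma> z) = 0" if f: "f \<in> N" and z: "Im z \<noteq> 0" for f z
  proof -
    obtain u v where uv: "u \<in> N" "v \<in> orthogonal_complement H N" "\<gamma> z = u \<oplus> v"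
      using reducing_decomposition [OF red densely_defined_minimal sub] \<gamma>_mem [OF z] mem by metis
    have vH: "v \<in> carrier H" and v: "\<And>f. f \<in> N \<Longrightarrow> ip H f v = 0"
      using uv by (auto simp: orthogonal_complement_def)
    have "(u, z \<odot> u) \<in> adj (H\<lparr>carrier := N\<rparr>) (minimal \<inter> N \<times> N)"
      unfolding adj_def
    proof (clarsimp simp: uv N_smult)
      fix f h assume fh: "(f, h) \<in> minimal" "f \<in> N" "h \<in> N"
      have "ip H h (\<gamma> z) = ip H f (z \<odot> \<gamma> z)"
        using fh green [of f "\<gamma> z"] \<gamma>_mem [OF z] by (auto simp: minimal_def L_\<gamma> [OF z])
      then show "ip H h u = ip H f (z \<odot> u)"
        using fh uv vH v NH by (simp add: ip_simps smult_mem)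
    qed
    then have "(u, z \<odot> u) \<in> minimal"
      using sa by (simp add: selfadjoint_op_def)
    then have "u = \<zero>"
      using eigenvector_c_zero [OF _ _ z] by (auto simp: minimal_def)
    then show ?thesis
      using uv v [OF f] vH by simp
  qed
  show "ip H f (\<gamma> z) = 0"
    by (rule orth) fact+
  obtain w where w: "w \<in> D" "c w = 0" "L w \<ominus> z \<odot> w = f"
    using resolvent [OF z] NH [OF f] by blast
  have cz: "Im (cnj z) \<noteq> 0" using z by simp
  have "d w = ip H (L w \<ominus> z \<odot> w) (\<gamma> (cnj z))"
    using green [OF w(1) \<gamma>_mem [OF cz]] w(1,2) \<gamma>_mem [OF cz] mem
    by (simp add: c_\<gamma> [OF cz] L_\<gamma> [OF cz] ip_simps)
  then have dw: "d w = 0"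
    using orth [OF f cz] w by simp
  have Lw: "L w = f \<oplus> z \<odot> w"
    using w NH [OF f] mem by (intro ip_eqI) (auto simp: ip_simps simp flip: w(3))
  have "(w, L w) \<in> minimal"
    using w dw by (auto simp: minimal_def)
  then obtain w1 h1 w2 h2 where 1: "(w1, h1) \<in> minimal" "w1 \<in> N" "h1 \<in> N"
    and 2: "(w2, h2) \<in> minimal" "w2 \<in> orthogonal_complement H N" "h2 \<in> orthogonal_complement H N"
    and eq: "w = w1 \<oplus> w2" "L w = h1 \<oplus> h2"
    using red unfolding reducing_subspace_def by fastforce
  have 3: "w1 \<in> D" "h1 = L w1" "w2 \<in> D" "h2 = L w2" "c w2 = 0"
    using 1 2 by (auto simp: minimal_def)
  have N2: "ip H u w2 = 0" "ip H u h2 = 0" if "u \<in> N" for u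
    using 2 that by (auto simp: orthogonal_complement_def)
  have "h2 \<ominus> z \<odot> w2 = \<zero>"
  proof (rule ip_definite)
    have "h2 \<ominus> z \<odot> w2 = (f \<ominus> h1) \<oplus> z \<odot> w1"
    proof (intro ip_eqI)
      fix u assume u: "u \<in> carrier H"
      have "ip H h1 u + ip H h2 u = ip H f u + z * (ip H w1 u + ip H w2 u)"
        using arg_cong [OF Lw [unfolded eq(2) eq(1)], where f = "\<lambda>x. ip H x u"] u 3 NH [OF f] mem
        by (simp add: ip_simps lin)
      then show "ip H (h2 \<ominus> z \<odot> w2) u = ip H ((f \<ominus> h1) \<oplus> z \<odot> w1) u"
        using u 3 NH [OF f] mem by (simp add: ip_simps algebra_simps)
    qed (use 3 NH [OF f] mem in auto)
    then have "ip H (h2 \<ominus> z \<odot> w2) (h2 \<ominus> z \<odot> w2) = ip H ((f \<ominus> h1) \<oplus> z \<odot> w1) (h2 \<ominus> z \<odot> w2)"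
      by simp
    also have "\<dots> = 0"
      using 3 1 f NH mem N2 by (simp add: ip_simps)
    finally show "ip H (h2 \<ominus> z \<odot> w2) (h2 \<ominus> z \<odot> w2) = 0" .
  qed (use 3 mem in auto)
  then have "w2 = \<zero>"
    using eigenvector_c_zero [OF 3(3,5) z] 3 eq_iff_minus mem by metis
  then have "w \<in> N"
    using eq 1 NH by simp
  then show "\<exists>w \<in> N. w \<in> D \<and> c w = 0 \<and> d w = 0 \<and> L w = f \<oplus> z \<odot> w"
    using w dw Lw by blast
qed

abbreviation P :: "'a inner_space" where "P \<equiv> plus_space H minimal"

lemma op_app_maximal: "f \<in> D \<Longrightarrow> op_app (adj H minimal) f = L f"
  by (auto simp: op_app_def adj_minimal)

lemma plus_space_simps [simp]:
  "carrier P = D" "add P = add H" "smult P = smult H"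
  by (auto simp: plus_space_def adj_minimal)

lemma hnorm_plus:
  assumes "f \<in> D"
  shows "hnorm P f = sqrt ((hnorm H f)\<^sup>2 + (hnorm H (L f))\<^sup>2)"
proof -
  have "ip P f f = ip H f f + ip H (L f) (L f)"
    using assms by (simp add: plus_space_def op_app_maximal)
  then show ?thesis
    using assms mem by (simp add: hnorm_def [of P] hnorm_power2)
qed

lemma hnorm_le_plus:
  assumes "f \<in> D"
  shows "hnorm H f \<le> hnorm P f" "hnorm H (L f) \<le> hnorm P f" "0 \<le> hnorm P f"
  using assms mem by (auto simp: hnorm_plus intro!: real_le_rsqrt)

lemma hnorm_plus_zero: "hnorm P \<zero> = 0"
  using D_zero by (simp add: hnorm_plus L_zero hnorm_eq_0)

lemma boundary_bound:
  obtains C where "C \<ge> 0" "\<And>f. f \<in> D \<Longrightarrow> cmod (c f) \<le> C * hnorm P f"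
    "\<And>f. f \<in> D \<Longrightarrow> cmod (d f) \<le> C * hnorm P f"
proof -
  have diff: "cmod (d f - c f * cnj (d (\<gamma> z))) \<le> (1 + cmod z) * hnorm H (\<gamma> z) * hnorm P f"
    if f: "f \<in> D" and z: "Im z \<noteq> 0" for f z
  proof -
    note g = \<gamma>_mem [OF z]
    have "d f - c f * cnj (d (\<gamma> z)) = ip H (L f) (\<gamma> z) - ip H f (z \<odot> \<gamma> z)"
      using green [OF f g] by (simp add: c_\<gamma> [OF z] L_\<gamma> [OF z])
    also have "cmod \<dots> \<le> cmod (ip H (L f) (\<gamma> z)) + cmod (ip H f (z \<odot> \<gamma> z))"
      by (rule norm_triangle_ineq4)
    also have "\<dots> \<le> hnorm H (L f) * hnorm H (\<gamma> z) + hnorm H f * hnorm H (z \<odot> \<gamma> z)"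
      using f g mem by (intro add_mono cmod_ip_le) auto
    also have "\<dots> \<le> hnorm P f * hnorm H (\<gamma> z) + hnorm P f * hnorm H (z \<odot> \<gamma> z)"
      using f g mem hnorm_le_plus [OF f] by (intro add_mono mult_right_mono) auto
    also have "\<dots> = (1 + cmod z) * hnorm H (\<gamma> z) * hnorm P f"
      using g mem by (simp add: hnorm_smult algebra_simps)
    finally show ?thesis .
  qed
  define e where "e = d (\<gamma> \<i>)"
  define M where "M = 2 * (hnorm H (\<gamma> \<i>) + hnorm H (\<gamma> (-\<i>)))"
  have M: "M \<ge> 0"
    using \<gamma>_mem [of \<i>] \<gamma>_mem [of "-\<i>"] mem by (simp add: M_def)
  have e: "d (\<gamma> (-\<i>)) = cnj e" "Im e \<noteq> 0"
    using d_\<gamma>_cnj [of \<i>] Im_d_\<gamma>_nonzero [of \<i>] by (simp_all add: e_def)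
  have c_le: "cmod (c f) \<le> M / (2 * \<bar>Im e\<bar>) * hnorm P f" if f: "f \<in> D" for f
  proof -
    have "c f * (e - cnj e) = (d f - c f * cnj e) - (d f - c f * e)"
      by (simp add: algebra_simps)
    also have "cmod \<dots> \<le> cmod (d f - c f * cnj e) + cmod (d f - c f * e)"
      by (rule norm_triangle_ineq4)
    also have "\<dots> \<le> M * hnorm P f"
      using diff [OF f, of \<i>] diff [OF f, of "-\<i>"] e
      by (simp add: M_def algebra_simps flip: e_def)
    also have "cmod (c f * (e - cnj e)) = cmod (c f) * (2 * \<bar>Im e\<bar>)"
      by (simp add: norm_mult complex_diff_cnj)
    finally show ?thesis
      using e by (simp add: field_simps)
  qed
  have d_le: "cmod (d f) \<le> (M + M / (2 * \<bar>Im e\<bar>) * cmod e) * hnorm P f" if f: "f \<in> D" for f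
  proof -
    have "cmod (d f) \<le> cmod (d f - c f * cnj e) + cmod (c f * cnj e)"
      using norm_triangle_ineq [of "d f - c f * cnj e" "c f * cnj e"] by simp
    moreover have "cmod (d f - c f * cnj e) \<le> M * hnorm P f"
      using diff [OF f, of \<i>] mult_nonneg_nonneg [OF _ hnorm_le_plus(3) [OF f], of "hnorm H (\<gamma> (-\<i>))"]
        \<gamma>_mem [of "-\<i>"] mem
      by (simp add: M_def algebra_simps flip: e_def)
    moreover have "cmod (c f * cnj e) \<le> M / (2 * \<bar>Im e\<bar>) * hnorm P f * cmod e"
      using mult_right_mono [OF c_le [OF f], of "cmod e"] by (simp add: norm_mult)
    ultimately show ?thesis
      by (simp add: algebra_simps)
  qed
  define C where "C = max (M / (2 * \<bar>Im e\<bar>)) (M + M / (2 * \<bar>Im e\<bar>) * cmod e)"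
  show ?thesis
  proof (rule that)
    show "C \<ge> 0" using M by (simp add: C_def le_max_iff_disj)
    fix f assume f: "f \<in> D"
    have "M / (2 * \<bar>Im e\<bar>) * hnorm P f \<le> C * hnorm P f"
      "(M + M / (2 * \<bar>Im e\<bar>) * cmod e) * hnorm P f \<le> C * hnorm P f"
      by (intro mult_right_mono hnorm_le_plus(3) [OF f]; simp add: C_def)+
    then show "cmod (c f) \<le> C * hnorm P f" "cmod (d f) \<le> C * hnorm P f"
      using c_le [OF f] d_le [OF f] by linarith+
  qed
qed

lemma minus_spaceI:
  assumes "\<And>g. g \<notin> D \<Longrightarrow> \<phi> g = 0" "\<And>f g. \<lbrakk>f \<in> D; g \<in> D\<rbrakk> \<Longrightarrow> \<phi> (f \<oplus> g) = \<phi> f + \<phi> g"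
    "\<And>t g. g \<in> D \<Longrightarrow> \<phi> (t \<odot> g) = cnj t * \<phi> g" "\<And>g. g \<in> D \<Longrightarrow> cmod (\<phi> g) \<le> C * hnorm P g"
  shows "\<phi> \<in> minus_space P"
  using assms unfolding minus_space_def by (auto intro!: exI [of _ C])

lemma minus_norm_le:
  assumes "0 \<le> C" "\<And>g. g \<in> D \<Longrightarrow> cmod (\<phi> g) \<le> C * hnorm P g"
  shows "minus_norm P \<phi> \<le> C"
  unfolding minus_norm_def
proof (rule cSUP_least)
  show "{g \<in> carrier P. hnorm P g \<le> 1} \<noteq> {}"
    using D_zero hnorm_plus_zero by force
next
  fix g assume "g \<in> {g \<in> carrier P. hnorm P g \<le> 1}"
  then have g: "g \<in> D" "hnorm P g \<le> 1" by auto
  have "cmod (\<phi> g) \<le> C * hnorm P g" by (rule assms) fact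
  also have "\<dots> \<le> C * 1" using g assms by (intro mult_left_mono)
  finally show "cmod (\<phi> g) \<le> C" by simp
qed

definition channel_functional :: "real \<Rightarrow> 'a \<Rightarrow> complex" where
  "channel_functional Q f = d f + complex_of_real Q * c f"

definition state :: "real \<Rightarrow> 'a \<Rightarrow> 'a \<Rightarrow> complex" where
  "state Q f g = (if g \<in> D
     then ip H (L f) g + (c f + \<i> * channel_functional Q f) * cnj (channel_functional Q g) else 0)"

definition channel :: "real \<Rightarrow> complex \<Rightarrow> 'a \<Rightarrow> complex" where
  "channel Q t g = (if g \<in> D then t * cnj (channel_functional Q g) else 0)"

definition system :: "real \<Rightarrow> 'a L_system" where
  "system Q = \<lparr>state_space = H, sym_op = minimal, main_op = extension 1 (\<i> - complex_of_real Q),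
     state_op = state Q, channel_op = channel Q\<rparr>"

lemma system_simps [simp]:
  "state_space (system Q) = H" "sym_op (system Q) = minimal"
  "main_op (system Q) = extension 1 (\<i> - complex_of_real Q)"
  "state_op (system Q) = state Q" "channel_op (system Q) = channel Q" "pos_space (system Q) = P"
  by (simp_all add: system_def pos_space_def)

lemma channel_functional_lin:
  "\<lbrakk>f \<in> D; g \<in> D\<rbrakk> \<Longrightarrow> channel_functional Q (f \<oplus> g) = channel_functional Q f + channel_functional Q g"
  "f \<in> D \<Longrightarrow> channel_functional Q (t \<odot> f) = t * channel_functional Q f"
  by (simp_all add: channel_functional_def lin algebra_simps)

lemma channel_functional_surj: "\<exists>f \<in> D. c f = s \<and> channel_functional Q f = t"
  using boundary_surj [of s "t - complex_of_real Q * s"] by (force simp: channel_functional_def)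

lemma channel_functional_bound:
  obtains C where "C \<ge> 0" "\<And>f. f \<in> D \<Longrightarrow> cmod (c f) \<le> C * hnorm P f"
    "\<And>f. f \<in> D \<Longrightarrow> cmod (channel_functional Q f) \<le> C * hnorm P f"
proof -
  obtain C where C: "C \<ge> 0" "\<And>f. f \<in> D \<Longrightarrow> cmod (c f) \<le> C * hnorm P f"
    "\<And>f. f \<in> D \<Longrightarrow> cmod (d f) \<le> C * hnorm P f"
    using boundary_bound by blast
  show ?thesis
  proof (rule that)
    show "0 \<le> C * (1 + \<bar>Q\<bar>)" using C(1) by simp
    fix f assume f: "f \<in> D"
    have n: "0 \<le> C * hnorm P f * \<bar>Q\<bar>" "0 \<le> C * hnorm P f"
      using C(1) hnorm_le_plus(3) [OF f] by auto
    show "cmod (c f) \<le> C * (1 + \<bar>Q\<bar>) * hnorm P f"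
      using C(2) [OF f] n by (simp add: algebra_simps)
    have "cmod (channel_functional Q f) \<le> cmod (d f) + \<bar>Q\<bar> * cmod (c f)"
      unfolding channel_functional_def using norm_triangle_ineq [of "d f" "complex_of_real Q * c f"]
      by (simp add: norm_mult)
    also have "\<dots> \<le> C * hnorm P f + \<bar>Q\<bar> * (C * hnorm P f)"
      using C f by (intro add_mono mult_left_mono) auto
    finally show "cmod (channel_functional Q f) \<le> C * (1 + \<bar>Q\<bar>) * hnorm P f"
      by (simp add: algebra_simps)
  qed
qed

lemma state_on: "g \<in> D \<Longrightarrow> state Q f g
    = ip H (L f) g + (c f + \<i> * channel_functional Q f) * cnj (channel_functional Q g)"
  and state_off: "g \<notin> D \<Longrightarrow> state Q f g = 0"
  by (auto simp: state_def)

lemma re_part_state: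
  assumes "f \<in> D"
  shows "re_part P (state Q) f
    = (\<lambda>g. if g \<in> D then ip H (L f) g + c f * cnj (channel_functional Q g) else 0)"
proof
  fix g
  show "re_part P (state Q) f g = (if g \<in> D then ip H (L f) g + c f * cnj (channel_functional Q g) else 0)"
  proof (cases "g \<in> D")
    case g: True
    have "ip H (L f) g - cnj (ip H (L g) f)
        = channel_functional Q f * cnj (c g) - c f * cnj (channel_functional Q g)"
      using green [OF assms g] ip_cnj [of "L g" f] assms g mem
      by (simp add: channel_functional_def algebra_simps)
    then have "cnj (ip H (L g) f)
        = ip H (L f) g - (channel_functional Q f * cnj (c g) - c f * cnj (channel_functional Q g))"
      by (simp add: algebra_simps)
    then show ?thesis
      using g assms by (simp add: re_part_def plus_minus_adj_def state_on field_simps)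
  qed (simp add: re_part_def plus_minus_adj_def state_off)
qed

lemma im_part_state:
  assumes "f \<in> D"
  shows "im_part P (state Q) f = channel Q (channel_functional Q f)"
proof
  fix g
  show "im_part P (state Q) f g = channel Q (channel_functional Q f) g"
  proof (cases "g \<in> D")
    case g: True
    have "ip H (L f) g - cnj (ip H (L g) f)
        = channel_functional Q f * cnj (c g) - c f * cnj (channel_functional Q g)"
      using green [OF assms g] ip_cnj [of "L g" f] assms g mem
      by (simp add: channel_functional_def algebra_simps)
    then have "cnj (ip H (L g) f)
        = ip H (L f) g - (channel_functional Q f * cnj (c g) - c f * cnj (channel_functional Q g))"
      by (simp add: algebra_simps)
    then show ?thesis
      using g assms by (simp add: im_part_def plus_minus_adj_def state_on channel_def field_simps)
  qed (simp add: im_part_def plus_minus_adj_def state_off channel_def)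
qed

lemma functional_zero:
  assumes "h \<in> carrier H" "\<And>g. g \<in> D \<Longrightarrow> ip H h g + s * cnj (channel_functional Q g) = 0"
  shows "h = \<zero>" "s = 0"
proof -
  show h: "h = \<zero>"
    using assms(2) by (intro orthogonal_minimal assms) (force simp: channel_functional_def)
  obtain g where "g \<in> D" "channel_functional Q g = 1"
    using channel_functional_surj by blast
  then show "s = 0"
    using assms(2) [of g] mem h by simp
qed

lemma quasi_kernel_state: "quasi_kernel H P (re_part P (state Q)) = extension 0 1"
proof (intro subset_antisym subsetI)
  fix p assume "p \<in> quasi_kernel H P (re_part P (state Q))"
  then obtain f h where p: "p = (f, h)" and f: "f \<in> D" and h: "h \<in> carrier H"
    and eq: "re_part P (state Q) f = embed H P h"
    by (auto simp: quasi_kernel_def)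
  have "ip H (L f \<ominus> h) g + c f * cnj (channel_functional Q g) = 0" if "g \<in> D" for g
  proof -
    have "ip H h g = ip H (L f) g + c f * cnj (channel_functional Q g)"
      using fun_cong [OF eq, of g] that f by (simp add: re_part_state embed_def)
    then show ?thesis
      using that f h mem by (simp add: ip_simps)
  qed
  then have "L f \<ominus> h = \<zero>" "c f = 0"
    using functional_zero [of "L f \<ominus> h" "c f" Q] f h mem by auto
  then show "p \<in> extension 0 1"
    using p f h mem eq_iff_minus by (auto simp: extension_def)
next
  fix p assume "p \<in> extension 0 1"
  then show "p \<in> quasi_kernel H P (re_part P (state Q))"
    using mem by (auto simp: extension_def quasi_kernel_def re_part_state embed_def)
qed

lemma L_quasi_kernel_system: "L_quasi_kernel (system Q) = extension 0 1"
  by (simp add: L_quasi_kernel_def quasi_kernel_state)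

lemma bounded_state: "bounded_plus_minus P (state Q)"
proof -
  obtain C where C: "C \<ge> 0" "\<And>f. f \<in> D \<Longrightarrow> cmod (c f) \<le> C * hnorm P f"
    "\<And>f. f \<in> D \<Longrightarrow> cmod (channel_functional Q f) \<le> C * hnorm P f"
    using channel_functional_bound by blast
  have bound: "cmod (state Q f g) \<le> (1 + 2 * C * C) * hnorm P f * hnorm P g" if f: "f \<in> D" and g: "g \<in> D" for f g
  proof -
    have "cmod (state Q f g) \<le> cmod (ip H (L f) g) +
        cmod ((c f + \<i> * channel_functional Q f) * cnj (channel_functional Q g))"
      unfolding state_on [OF g] by (rule norm_triangle_ineq)
    also have "\<dots> \<le> hnorm P f * hnorm P g + (2 * C * hnorm P f) * (C * hnorm P g)"
    proof (rule add_mono)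
      have "cmod (ip H (L f) g) \<le> hnorm H (L f) * hnorm H g"
        using f g mem by (intro cmod_ip_le) auto
      also have "\<dots> \<le> hnorm P f * hnorm P g"
        using f g mem hnorm_le_plus by (intro mult_mono) auto
      finally show "cmod (ip H (L f) g) \<le> hnorm P f * hnorm P g" .
      have "cmod (c f + \<i> * channel_functional Q f) \<le> 2 * C * hnorm P f"
        using norm_triangle_ineq [of "c f" "\<i> * channel_functional Q f"] C(2) [OF f] C(3) [OF f]
        by (simp add: norm_mult)
      then show "cmod ((c f + \<i> * channel_functional Q f) * cnj (channel_functional Q g))
          \<le> (2 * C * hnorm P f) * (C * hnorm P g)"
        using C f g hnorm_le_plus(3) unfolding norm_mult complex_mod_cnj by (intro mult_mono) auto
    qed
    finally show ?thesis by (simp add: algebra_simps)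
  qed
  have nonneg: "0 \<le> (1 + 2 * C * C) * hnorm P f" if "f \<in> D" for f
    using C(1) hnorm_le_plus(3) [OF that] by auto
  show ?thesis
    unfolding bounded_plus_minus_def
  proof (intro conjI ballI allI)
    fix f assume f: "f \<in> carrier P"
    show "state Q f \<in> minus_space P"
      using f bound [of f] mem
      by (intro minus_spaceI [where C = "(1 + 2 * C * C) * hnorm P f"])
        (auto simp: state_on state_off ip_simps channel_functional_lin algebra_simps)
    show "state Q (t \<odot>\<^bsub>P\<^esub> f) = (\<lambda>u. t * state Q f u)" for t
      using f mem by (auto simp: state_def ip_simps lin channel_functional_lin algebra_simps)
    show "state Q (f \<oplus>\<^bsub>P\<^esub> g) = (\<lambda>u. state Q f u + state Q g u)" if "g \<in> carrier P" for g
      using f that mem by (auto simp: state_def ip_simps lin channel_functional_lin algebra_simps)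
  next
    show "\<exists>C. \<forall>f\<in>carrier P. minus_norm P (state Q f) \<le> C * hnorm P f"
      using bound nonneg by (intro exI [of _ "1 + 2 * C * C"] ballI minus_norm_le) auto
  qed
qed

lemma bounded_channel: "bounded_C_minus P (channel Q)"
proof -
  obtain C where C: "C \<ge> 0" "\<And>f. f \<in> D \<Longrightarrow> cmod (channel_functional Q f) \<le> C * hnorm P f"
    using channel_functional_bound by metis
  have bound: "cmod (channel Q t g) \<le> C * cmod t * hnorm P g" if "g \<in> D" for t g
    using mult_left_mono [OF C(2) [OF that], of "cmod t"] that
    by (simp add: channel_def norm_mult algebra_simps)
  show ?thesis
    unfolding bounded_C_minus_def
  proof (intro conjI allI)
    fix t s
    show "channel Q t \<in> minus_space P"
      using bound [of _ t] mem by (intro minus_spaceI [where C = "C * cmod t"])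
        (auto simp: channel_def channel_functional_lin algebra_simps)
    show "channel Q (t + s) = (\<lambda>u. channel Q t u + channel Q s u)"
      "channel Q (t * s) = (\<lambda>u. t * channel Q s u)"
      by (auto simp: channel_def algebra_simps)
  next
    show "\<exists>C. \<forall>t. minus_norm P (channel Q t) \<le> C * cmod t"
      using bound C(1) by (intro exI [of _ C] allI minus_norm_le) auto
  qed
qed

lemma adj_main: "adj H (extension 1 (\<i> - complex_of_real Q)) = extension 1 (- \<i> - complex_of_real Q)"
  by (simp add: adj_extension)

lemma C_minus_adj_channel: "f \<in> D \<Longrightarrow> C_minus_adj (channel Q) f = channel_functional Q f"
  by (simp add: C_minus_adj_def channel_def)

lemma star_extension_state: "star_extension H minimal (extension 1 (\<i> - complex_of_real Q)) (state Q)"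
proof -
  have "restricts H P (extension 1 (\<i> - complex_of_real Q)) (state Q)"
  proof -
    have "c f + \<i> * channel_functional Q f = 0" if "d f = (\<i> - complex_of_real Q) * c f" for f
      using that by (simp add: channel_functional_def algebra_simps)
    then show ?thesis
      by (auto simp: restricts_def extension_def embed_def state_def)
  qed
  moreover have "restricts H P (extension 1 (- \<i> - complex_of_real Q)) (plus_minus_adj P (state Q))"
  proof -
    have "plus_minus_adj P (state Q) f g = embed H P (L f) g" if f: "f \<in> D" "d f = (- \<i> - complex_of_real Q) * c f" for f g
    proof (cases "g \<in> D")
      case g: True
      have "channel_functional Q f = - \<i> * c f"
        using f(2) by (simp add: channel_functional_def algebra_simps)
      moreover have "plus_minus_adj P (state Q) f g
          = re_part P (state Q) f g - \<i> * im_part P (state Q) f g"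
        by (simp add: re_part_def im_part_def field_simps)
      ultimately show ?thesis
        using f(1) g by (simp add: re_part_state im_part_state channel_def embed_def flip: mult.assoc)
    qed (auto simp: plus_minus_adj_def embed_def)
    then show ?thesis
      by (auto simp: restricts_def extension_def)
  qed
  ultimately show ?thesis
    by (simp add: star_extension_def Let_def bounded_state minimal_subset_extension adj_main
        quasi_kernel_state selfadjoint_reference)
qed

lemma resolvent_set_extensionI:
  assumes "\<And>h. h \<in> carrier H \<Longrightarrow> \<exists>f \<in> D. \<alpha> * d f = \<beta> * c f \<and> L f \<ominus> z \<odot> f = h"
    and "\<And>f. f \<in> D \<Longrightarrow> \<alpha> * d f = \<beta> * c f \<Longrightarrow> hnorm H f \<le> C * hnorm H (L f \<ominus> z \<odot> f)"
  shows "z \<in> resolvent_set H (extension \<alpha> \<beta>)"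
  unfolding resolvent_set_def
proof (intro CollectI conjI ballI exI [of _ C])
  fix h assume "h \<in> carrier H"
  then obtain f where "f \<in> D" "\<alpha> * d f = \<beta> * c f" "L f \<ominus> z \<odot> f = h"
    using assms(1) by blast
  then show "\<exists>(f, f') \<in> extension \<alpha> \<beta>. f' \<ominus> z \<odot> f = h"
    by (intro bexI [of _ "(f, L f)"]) (auto simp: extension_def)
next
  fix p assume "p \<in> extension \<alpha> \<beta>"
  then show "case p of (f, f') \<Rightarrow> hnorm H f \<le> C * hnorm H (f' \<ominus> z \<odot> f)"
    using assms(2) by (auto simp: extension_def)
qed

lemma resolvent_set_main: "- \<i> \<in> resolvent_set H (extension 1 (\<i> - complex_of_real Q))"
proof -
  have Im: "Im (d (\<gamma> (-\<i>))) \<le> 0"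
    using Im_d_\<gamma> [of "-\<i>"] by simp
  have g: "\<gamma> (-\<i>) \<in> D" "L (\<gamma> (-\<i>)) = (-\<i>) \<odot> \<gamma> (-\<i>)" "c (\<gamma> (-\<i>)) = 1"
    using \<gamma>_mem [of "-\<i>"] L_\<gamma> [of "-\<i>"] c_\<gamma> [of "-\<i>"] by auto
  have "\<exists>f \<in> D. d f = (\<i> - complex_of_real Q) * c f \<and> L f \<ominus> (-\<i>) \<odot> f = h" if h: "h \<in> carrier H" for h
  proof -
    obtain f where f: "f \<in> D" "c f = 0" "L f \<ominus> (-\<i>) \<odot> f = h"
      using resolvent [of "-\<i>" h] h by auto
    define s where "s = \<i> - complex_of_real Q - d (\<gamma> (-\<i>))"
    have "s \<noteq> 0"
      using Im by (auto simp: s_def complex_eq_iff)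
    define t where "t = d f / s"
    have "t * s = d f"
      using \<open>s \<noteq> 0\<close> by (simp add: t_def)
    then have "d (f \<oplus> t \<odot> \<gamma> (-\<i>)) = (\<i> - complex_of_real Q) * c (f \<oplus> t \<odot> \<gamma> (-\<i>))"
      using f(1,2) g by (simp add: lin mem s_def algebra_simps)
    moreover have "L (f \<oplus> t \<odot> \<gamma> (-\<i>)) \<ominus> (-\<i>) \<odot> (f \<oplus> t \<odot> \<gamma> (-\<i>)) = L f \<ominus> (-\<i>) \<odot> f"
      by (rule ip_eqI) (use f(1) g mem in \<open>auto simp: lin ip_simps algebra_simps\<close>)
    ultimately show ?thesis
      using f g mem by (intro bexI [of _ "f \<oplus> t \<odot> \<gamma> (-\<i>)"]) auto
  qed
  moreover have "hnorm H f \<le> 1 * hnorm H (L f \<ominus> (-\<i>) \<odot> f)"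
    if "f \<in> D" "d f = (\<i> - complex_of_real Q) * c f" for f
  proof -
    have "Im (d f * cnj (c f)) = (cmod (c f))\<^sup>2"
      unfolding that(2) cmod_power2 by (simp add: power2_eq_square algebra_simps)
    then show ?thesis
      using shift_bounded_below [OF that(1), of "-\<i>"] by simp
  qed
  ultimately show ?thesis
    by (intro resolvent_set_extensionI [where C = 1]) auto
qed

lemma main_operator: "main_operator_of H minimal (extension 1 (\<i> - complex_of_real Q))"
proof -
  have "Domain minimal = Domain (extension 1 (\<i> - complex_of_real Q)) \<inter> Domain (extension 1 (- \<i> - complex_of_real Q))"
    by (auto simp: minimal_def extension_def algebra_simps)
  moreover have "\<not> extension 1 (\<i> - complex_of_real Q) \<subseteq> extension 1 (- \<i> - complex_of_real Q)"
  proof -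
    obtain f where f: "f \<in> D" "c f = 1" "d f = \<i> - complex_of_real Q"
      using boundary_surj by blast
    then have "(f, L f) \<in> extension 1 (\<i> - complex_of_real Q)" "(f, L f) \<notin> extension 1 (- \<i> - complex_of_real Q)"
      by (auto simp: extension_def)
    then show ?thesis by blast
  qed
  moreover have "extension 1 (\<i> - complex_of_real Q) \<subseteq> {(f, L f) |f. f \<in> D}"
    by (auto simp: extension_def)
  ultimately show ?thesis
    using resolvent_set_main [of Q] unfolding main_operator_of_def adj_main adj_minimal
    by (intro conjI linear_op_extension minimal_subset_extension) auto
qed

lemma is_L_system_system: "is_L_system (system Q)"
proof -
  have "range (channel Q) = im_part P (state Q) ` D"
  proof (intro subset_antisym subsetI)
    fix x assume "x \<in> range (channel Q)"
    then obtain t where t: "x = channel Q t" by blast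
    obtain f where "f \<in> D" "channel_functional Q f = t"
      using channel_functional_surj by blast
    then show "x \<in> im_part P (state Q) ` D"
      using t im_part_state by force
  qed (auto simp: im_part_state)
  then show ?thesis
    by (simp add: is_L_system_def Let_def complex_hilbert_space_axioms symmetric_minimal closed_minimal
        deficiency_indices_minimal main_operator star_extension_state bounded_channel im_part_state
        C_minus_adj_channel)
qed

lemma resolvent_set_reference:
  assumes "Im z \<noteq> 0"
  shows "z \<in> resolvent_set H (extension 0 1)"
proof -
  have "hnorm H f \<le> 1 / \<bar>Im z\<bar> * hnorm H (L f \<ominus> z \<odot> f)" if "f \<in> D" "c f = 0" for f
    using shift_bounded_below [OF that(1) _ assms] that by simp
  then show ?thesis
    using resolvent [OF assms] by (intro resolvent_set_extensionI [where C = "1 / \<bar>Im z\<bar>"]) auto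
qed

lemma re_state_minus_system:
  assumes "f \<in> D"
  shows "re_state_minus (system Q) z f
    = (\<lambda>g. if g \<in> D then ip H (L f \<ominus> z \<odot> f) g + c f * cnj (channel_functional Q g) else 0)"
  using assms mem by (auto simp: re_state_minus_def re_part_state embed_def ip_simps)

lemma realizes_system:
  assumes "\<And>z. Im z \<noteq> 0 \<Longrightarrow> V z = d (\<gamma> z) + complex_of_real Q"
  shows "realizes (system Q) V"
  unfolding realizes_def
proof (intro allI impI conjI)
  fix z :: complex assume z: "Im z \<noteq> 0"
  show "z \<in> resolvent_set (state_space (system Q)) (L_quasi_kernel (system Q))"
    using resolvent_set_reference [OF z] by (simp add: L_quasi_kernel_system)
  show inj: "inj_on (re_state_minus (system Q) z) (carrier (pos_space (system Q)))"
  proof (rule inj_onI)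
    fix f g assume "f \<in> carrier (pos_space (system Q))" "g \<in> carrier (pos_space (system Q))"
      and eq: "re_state_minus (system Q) z f = re_state_minus (system Q) z g"
    then have f: "f \<in> D" and g: "g \<in> D" by auto
    define h where "h = f \<ominus> g"
    have h: "h \<in> D" using f g D_minus by (simp add: h_def)
    have "ip H (L h \<ominus> z \<odot> h) u + c h * cnj (channel_functional Q u) = 0" if "u \<in> D" for u
      using fun_cong [OF eq, of u] that f g mem
      by (simp add: re_state_minus_system h_def ip_simps L_minus c_minus algebra_simps)
    then have *: "L h \<ominus> z \<odot> h = \<zero>" "c h = 0"
      using functional_zero [of "L h \<ominus> z \<odot> h" "c h" Q] h mem by auto
    then have "h = \<zero>"
      using eigenvector_c_zero [OF h _ z] eq_iff_minus h mem by metis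
    then show "f = g"
      using eq_iff_minus f g mem by (simp add: h_def)
  qed
  have "L (\<gamma> z) \<ominus> z \<odot> \<gamma> z = \<zero>"
    using eq_iff_minus z by (simp add: L_\<gamma> \<gamma>_mem mem)
  then have ch: "re_state_minus (system Q) z (\<gamma> z) = channel Q 1"
    using z \<gamma>_mem [OF z] mem by (auto simp: re_state_minus_system channel_def c_\<gamma>)
  then show "channel_op (system Q) 1 \<in> re_state_minus (system Q) z ` carrier (pos_space (system Q))"
    using \<gamma>_mem [OF z] by force
  have "the_inv_into (carrier (pos_space (system Q))) (re_state_minus (system Q) z) (channel_op (system Q) 1) = \<gamma> z"
    using \<gamma>_mem [OF z] ch by (intro the_inv_into_f_eq [OF inj]) auto
  then show "V z = impedance (system Q) z"
    using \<gamma>_mem [OF z] z assms by (simp add: impedance_def C_minus_adj_channel channel_functional_def c_\<gamma>)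
qed

lemma von_neumann_parameters_system:
  assumes a: "d (\<gamma> \<i>) = \<i> * complex_of_real a" "a > 0" and \<kappa>: "0 < \<kappa>" "\<kappa> < 1"
    and w: "cmod w = \<kappa>" "w * ((1 + a) + \<i> * Q) = (1 - a) + \<i> * Q"
    and U: "U * w = - complex_of_real \<kappa>"
  defines "gp \<equiv> complex_of_real (1 / sqrt a) \<odot> \<gamma> \<i>"
    and "gm \<equiv> (w / \<kappa> * complex_of_real (1 / sqrt a)) \<odot> \<gamma> (-\<i>)"
  shows "normalized_deficiency_vectors (system Q) gp gm"
    "von_neumann_parameter (system Q) gp gm \<kappa>"
    "quasi_kernel_von_neumann_parameter (system Q) gp gm U"
proof -
  note g = \<gamma>_mem [of \<i>] \<gamma>_mem [of "-\<i>"]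
  have gD: "\<gamma> \<i> \<in> D" "\<gamma> (-\<i>) \<in> D" "c (\<gamma> \<i>) = 1" "c (\<gamma> (-\<i>)) = 1"
    using g c_\<gamma> [of \<i>] c_\<gamma> [of "-\<i>"] by auto
  have dm: "d (\<gamma> (-\<i>)) = - \<i> * complex_of_real a"
    using d_\<gamma>_cnj [of \<i>] a by simp
  have "(hnorm H (\<gamma> \<i>))\<^sup>2 = a" "(hnorm H (\<gamma> (-\<i>)))\<^sup>2 = a"
    using Im_d_\<gamma> [of \<i>] Im_d_\<gamma> [of "-\<i>"] a dm by auto
  then have n: "hnorm H (\<gamma> \<i>) = sqrt a" "hnorm H (\<gamma> (-\<i>)) = sqrt a"
    using gD mem by (metis hnorm_nonneg real_sqrt_unique)+
  have eig: "s \<odot> \<gamma> z \<in> eigenspace (adj H minimal) H z" if "Im z \<noteq> 0" for s z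
    using eigenspace_maximal [OF that] by (auto simp: adj_minimal)
  show "normalized_deficiency_vectors (system Q) gp gm"
    using eig [of \<i>] eig [of "-\<i>"] gD mem n a \<kappa> w
    by (simp add: normalized_deficiency_vectors_def Let_def gp_def gm_def hnorm_smult norm_mult norm_divide)
  have gpm: "gp \<in> D" "gm \<in> D"
    using gD mem by (auto simp: gp_def gm_def)
  have s: "complex_of_real (sqrt a) \<noteq> 0" "complex_of_real \<kappa> \<noteq> 0"
    using a \<kappa> by auto
  define r where "r = complex_of_real (1 / sqrt a)"
  have r: "r \<noteq> 0" using a by (simp add: r_def)
  have bv: "c gp = r" "d gp = \<i> * a * r" "c gm = w / \<kappa> * r" "d gm = - (\<i> * a * (w / \<kappa> * r))"
    using gD a dm by (auto simp: gp_def gm_def lin r_def)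
  have "d (gp \<ominus> complex_of_real \<kappa> \<odot> gm) = (\<i> - complex_of_real Q) * c (gp \<ominus> complex_of_real \<kappa> \<odot> gm)"
  proof -
    have "c (gp \<ominus> complex_of_real \<kappa> \<odot> gm) = r * (1 - w)"
      using gpm bv s mem by (simp add: c_minus lin field_simps)
    moreover have "d (gp \<ominus> complex_of_real \<kappa> \<odot> gm) = r * (\<i> * a * (1 + w))"
      using gpm bv s mem by (simp add: d_minus lin field_simps)
    moreover have "\<i> * a * (1 + w) = (\<i> - complex_of_real Q) * (1 - w)"
    proof -
      have "\<i> * (w * ((1 + a) + \<i> * Q)) = \<i> * ((1 - a) + \<i> * Q)"
        using w(2) by simp
      then show ?thesis
        by (simp add: algebra_simps)
    qed
    ultimately show ?thesis
      by simp
  qed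
  then have "(gp \<ominus> complex_of_real \<kappa> \<odot> gm, L (gp \<ominus> complex_of_real \<kappa> \<odot> gm)) \<in> extension 1 (\<i> - complex_of_real Q)"
    using gpm D_minus mem by (auto simp: extension_def)
  then show "von_neumann_parameter (system Q) gp gm \<kappa>"
    using \<kappa> by (auto simp: von_neumann_parameter_def Let_def)
  have "w \<noteq> 0" using w \<kappa> by auto
  have "cmod U * \<kappa> = \<kappa>"
    using arg_cong [OF U, of cmod] w \<kappa> by (simp add: norm_mult)
  then have cU: "cmod U = 1"
    using \<kappa> by simp
  define e where "e = gp \<oplus> U \<odot> gm"
  have eD: "e \<in> D"
    using gpm mem by (simp add: e_def)
  have Uw: "U * (w / \<kappa> * r) = - r"
  proof -
    have "U * (w / \<kappa> * r) = U * w * r / \<kappa>" by simp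
    also have "\<dots> = - r" using s unfolding U by simp
    finally show ?thesis .
  qed
  have ce: "c e = 0"
    using gpm mem bv Uw by (simp add: e_def lin)
  have "d e = \<i> * a * r - \<i> * a * (U * (w / \<kappa> * r))"
    using gpm mem bv by (simp add: e_def lin algebra_simps)
  also have "\<dots> = 2 * \<i> * a * r"
    unfolding Uw by simp
  finally have de: "d e \<noteq> 0"
    using a r by simp
  have "Domain (extension 0 1) = {f \<oplus> t \<odot> e | f t. f \<in> Domain minimal}"
  proof (intro subset_antisym subsetI)
    fix f assume "f \<in> Domain (extension 0 1)"
    then have f: "f \<in> D" "c f = 0" by (auto simp: extension_def)
    define t where "t = d f / d e"
    have "f \<ominus> t \<odot> e \<in> Domain minimal"
      using f eD ce de mem D_minus by (auto simp: minimal_def c_minus d_minus lin t_def)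
    moreover have "f = (f \<ominus> t \<odot> e) \<oplus> t \<odot> e"
      by (rule ip_eqI) (use f eD mem in \<open>auto simp: ip_simps\<close>)
    ultimately show "f \<in> {f \<oplus> t \<odot> e | f t. f \<in> Domain minimal}"
      by blast
  next
    fix f assume "f \<in> {f \<oplus> t \<odot> e | f t. f \<in> Domain minimal}"
    then show "f \<in> Domain (extension 0 1)"
      using eD ce mem by (auto simp: minimal_def extension_def lin)
  qed
  moreover have "e \<notin> Domain minimal"
    using de by (auto simp: minimal_def)
  ultimately show "quasi_kernel_von_neumann_parameter (system Q) gp gm U"
    using cU by (simp add: quasi_kernel_von_neumann_parameter_def Let_def L_quasi_kernel_system flip: e_def)
qed

end

section \<open>The space of square-integrable functions\<close>

lemma borel_measurable_cnj [measurable]: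
  "f \<in> borel_measurable M \<Longrightarrow> (\<lambda>x. cnj (f x)) \<in> borel_measurable M"
  by (rule measurable_compose [OF _ borel_measurable_continuous_onI]) (auto intro: continuous_intros)

definition sq_int :: "'b measure \<Rightarrow> ('b \<Rightarrow> complex) set" where
  "sq_int M = {f \<in> borel_measurable M. integrable M (\<lambda>x. (cmod (f x))\<^sup>2)}"

lemma sq_int_measurable [measurable_dest]: "f \<in> sq_int M \<Longrightarrow> f \<in> borel_measurable M"
  by (simp add: sq_int_def)

lemma sq_int_integrable: "f \<in> sq_int M \<Longrightarrow> integrable M (\<lambda>x. (cmod (f x))\<^sup>2)"
  by (simp add: sq_int_def)

lemma sq_int_bound:
  assumes "f \<in> sq_int M" "g \<in> borel_measurable M" "AE x in M. cmod (g x) \<le> B * cmod (f x)"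
  shows "g \<in> sq_int M"
proof -
  have "integrable M (\<lambda>x. (cmod (g x))\<^sup>2)"
  proof (rule Bochner_Integration.integrable_bound)
    show "integrable M (\<lambda>x. B\<^sup>2 * (cmod (f x))\<^sup>2)"
      using assms sq_int_integrable by auto
    show "AE x in M. norm ((cmod (g x))\<^sup>2) \<le> norm (B\<^sup>2 * (cmod (f x))\<^sup>2)"
      using assms(3)
    proof eventually_elim
      case (elim x)
      then have "(cmod (g x))\<^sup>2 \<le> (B * cmod (f x))\<^sup>2"
        by (intro power_mono) auto
      then show ?case by (simp add: power_mult_distrib)
    qed
  qed (use assms in measurable)
  then show ?thesis
    using assms by (simp add: sq_int_def)
qed

lemma sq_int_mult:
  assumes "f \<in> sq_int M" "p \<in> borel_measurable M" "\<And>x. cmod (p x) \<le> B"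
  shows "(\<lambda>x. p x * f x) \<in> sq_int M"
  using assms by (intro sq_int_bound [OF assms(1), where B = B]) (auto simp: norm_mult mult_right_mono)

lemma sq_int_cmult: "f \<in> sq_int M \<Longrightarrow> (\<lambda>x. t * f x) \<in> sq_int M"
  by (rule sq_int_mult [where B = "cmod t"]) auto

lemma sq_int_add:
  assumes "f \<in> sq_int M" "g \<in> sq_int M"
  shows "(\<lambda>x. f x + g x) \<in> sq_int M"
proof -
  have [measurable]: "f \<in> borel_measurable M" "g \<in> borel_measurable M"
    using assms by (auto dest: sq_int_measurable)
  have "integrable M (\<lambda>x. (cmod (f x + g x))\<^sup>2)"
  proof (rule Bochner_Integration.integrable_bound)
    show "integrable M (\<lambda>x. 2 * (cmod (f x))\<^sup>2 + 2 * (cmod (g x))\<^sup>2)"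
      by (intro Bochner_Integration.integrable_add integrable_mult_right sq_int_integrable assms)
    show "AE x in M. norm ((cmod (f x + g x))\<^sup>2) \<le> norm (2 * (cmod (f x))\<^sup>2 + 2 * (cmod (g x))\<^sup>2)"
    proof (rule AE_I2)
      fix x
      have "(cmod (f x + g x))\<^sup>2 \<le> (cmod (f x) + cmod (g x))\<^sup>2"
        by (intro power_mono norm_triangle_ineq) auto
      also have "\<dots> \<le> 2 * (cmod (f x))\<^sup>2 + 2 * (cmod (g x))\<^sup>2"
        using sum_squares_bound [of "cmod (f x)" "cmod (g x)"] by (simp add: power2_sum)
      finally show "norm ((cmod (f x + g x))\<^sup>2) \<le> norm (2 * (cmod (f x))\<^sup>2 + 2 * (cmod (g x))\<^sup>2)"
        by simp
    qed
  qed measurable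
  then show ?thesis
    by (simp add: sq_int_def)
qed

lemma sq_int_diff:
  assumes "f \<in> sq_int M" "g \<in> sq_int M"
  shows "(\<lambda>x. f x - g x) \<in> sq_int M"
  using sq_int_add [OF assms(1) sq_int_cmult [OF assms(2), of "-1"]] by simp

lemma sq_int_zero: "(\<lambda>x. 0) \<in> sq_int M"
  by (simp add: sq_int_def)

lemma sq_int_cnj: "f \<in> sq_int M \<Longrightarrow> (\<lambda>x. cnj (f x)) \<in> sq_int M"
  by (rule sq_int_bound [where f = f and B = 1]) (auto dest: sq_int_measurable)

lemma integrable_mult_sq_int:
  assumes "f \<in> sq_int M" "g \<in> sq_int M"
  shows "integrable M (\<lambda>x. f x * g x)"
proof -
  have [measurable]: "f \<in> borel_measurable M" "g \<in> borel_measurable M"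
    using assms by (auto dest: sq_int_measurable)
  show ?thesis
  proof (rule Bochner_Integration.integrable_bound)
    show "integrable M (\<lambda>x. (cmod (f x))\<^sup>2 + (cmod (g x))\<^sup>2)"
      by (intro Bochner_Integration.integrable_add sq_int_integrable assms)
    show "AE x in M. norm (f x * g x) \<le> norm ((cmod (f x))\<^sup>2 + (cmod (g x))\<^sup>2)"
    proof (rule AE_I2)
      fix x
      have "2 * (cmod (f x) * cmod (g x)) \<le> (cmod (f x))\<^sup>2 + (cmod (g x))\<^sup>2"
        using sum_squares_bound [of "cmod (f x)" "cmod (g x)"] by (simp add: mult.assoc)
      moreover have "0 \<le> cmod (f x) * cmod (g x)" by simp
      ultimately have "cmod (f x) * cmod (g x) \<le> (cmod (f x))\<^sup>2 + (cmod (g x))\<^sup>2"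
        by linarith
      then show "norm (f x * g x) \<le> norm ((cmod (f x))\<^sup>2 + (cmod (g x))\<^sup>2)"
        by (simp add: norm_mult)
    qed
  qed measurable
qed

lemma sq_int_cong_AE:
  assumes "f \<in> sq_int M" "g \<in> borel_measurable M" "AE x in M. g x = f x"
  shows "g \<in> sq_int M"
  using assms by (intro sq_int_bound [OF assms(1,2), where B = 1]) auto

definition ae_class :: "'b measure \<Rightarrow> ('b \<Rightarrow> complex) \<Rightarrow> ('b \<Rightarrow> complex) set" where
  "ae_class M f = {g \<in> borel_measurable M. AE x in M. g x = f x}"

definition rep :: "('b \<Rightarrow> complex) set \<Rightarrow> 'b \<Rightarrow> complex" where
  "rep X = (SOME f. f \<in> X)"

definition L2 :: "'b measure \<Rightarrow> ('b \<Rightarrow> complex) set inner_space" where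
  "L2 M = \<lparr>carrier = ae_class M ` sq_int M, mult = (\<lambda>X Y. X), one = ae_class M (\<lambda>x. 0),
     zero = ae_class M (\<lambda>x. 0), add = (\<lambda>X Y. ae_class M (\<lambda>x. rep X x + rep Y x)),
     smult = (\<lambda>t X. ae_class M (\<lambda>x. t * rep X x)),
     ip = (\<lambda>X Y. LINT x|M. rep X x * cnj (rep Y x))\<rparr>"

lemma ae_class_eq_iff:
  assumes "f \<in> borel_measurable M" "g \<in> borel_measurable M"
  shows "ae_class M f = ae_class M g \<longleftrightarrow> (AE x in M. f x = g x)"
proof
  assume "ae_class M f = ae_class M g"
  then have "f \<in> ae_class M g"
    using assms by (auto simp: ae_class_def)
  then show "AE x in M. f x = g x"
    by (auto simp: ae_class_def)
next
  assume ae: "AE x in M. f x = g x"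
  have "(AE x in M. h x = f x) \<longleftrightarrow> (AE x in M. h x = g x)" for h
    using ae by (intro iffI; elim eventually_elim2) auto
  then show "ae_class M f = ae_class M g"
    by (simp add: ae_class_def)
qed

lemma ae_class_cong:
  assumes "AE x in M. f x = g x"
  shows "ae_class M f = ae_class M g"
proof -
  have "(AE x in M. h x = f x) \<longleftrightarrow> (AE x in M. h x = g x)" for h
    using assms by (intro iffI; elim eventually_elim2) auto
  then show ?thesis
    by (simp add: ae_class_def)
qed

lemma rep_ae_class:
  assumes "f \<in> borel_measurable M"
  shows "rep (ae_class M f) \<in> borel_measurable M" "AE x in M. rep (ae_class M f) x = f x"
proof -
  have "rep (ae_class M f) \<in> ae_class M f"
    unfolding rep_def by (rule someI [of _ f]) (use assms in \<open>simp add: ae_class_def\<close>)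
  then show "rep (ae_class M f) \<in> borel_measurable M" "AE x in M. rep (ae_class M f) x = f x"
    by (auto simp: ae_class_def)
qed

lemma carrier_L2: "carrier (L2 M) = ae_class M ` sq_int M"
  and zero_L2: "\<zero>\<^bsub>L2 M\<^esub> = ae_class M (\<lambda>x. 0)"
  by (simp_all add: L2_def)

lemma add_L2:
  assumes "f \<in> borel_measurable M" "g \<in> borel_measurable M"
  shows "ae_class M f \<oplus>\<^bsub>L2 M\<^esub> ae_class M g = ae_class M (\<lambda>x. f x + g x)"
proof -
  have "AE x in M. rep (ae_class M f) x + rep (ae_class M g) x = f x + g x"
    using rep_ae_class(2) [OF assms(1)] rep_ae_class(2) [OF assms(2)] by eventually_elim simp
  then show ?thesis
    by (simp add: L2_def ae_class_cong)
qed

lemma smult_L2: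
  assumes "f \<in> borel_measurable M"
  shows "t \<odot>\<^bsub>L2 M\<^esub> ae_class M f = ae_class M (\<lambda>x. t * f x)"
proof -
  have "AE x in M. t * rep (ae_class M f) x = t * f x"
    using rep_ae_class(2) [OF assms] by eventually_elim simp
  then show ?thesis
    by (simp add: L2_def ae_class_cong)
qed

lemma ip_L2:
  assumes "f \<in> borel_measurable M" "g \<in> borel_measurable M"
  shows "ip (L2 M) (ae_class M f) (ae_class M g) = (LINT x|M. f x * cnj (g x))"
proof -
  note [measurable] = assms rep_ae_class(1) [OF assms(1)] rep_ae_class(1) [OF assms(2)]
  have "(LINT x|M. rep (ae_class M f) x * cnj (rep (ae_class M g) x)) = (LINT x|M. f x * cnj (g x))"
  proof (rule Bochner_Integration.integral_cong_AE)
    show "AE x in M. rep (ae_class M f) x * cnj (rep (ae_class M g) x) = f x * cnj (g x)"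
      using rep_ae_class(2) [OF assms(1)] rep_ae_class(2) [OF assms(2)] by eventually_elim simp
  qed measurable
  then show ?thesis
    by (simp add: L2_def)
qed

lemma abelian_group_L2: "abelian_group (L2 M)"
proof (rule abelian_groupI)
  fix X assume "X \<in> carrier (L2 M)"
  then obtain f where f: "f \<in> sq_int M" "X = ae_class M f"
    by (auto simp: carrier_L2)
  then show "\<exists>Y\<in>carrier (L2 M). Y \<oplus>\<^bsub>L2 M\<^esub> X = \<zero>\<^bsub>L2 M\<^esub>"
    using sq_int_cmult [OF f(1), of "-1"]
    by (intro bexI [of _ "ae_class M (\<lambda>x. - f x)"]) (auto simp: carrier_L2 add_L2 zero_L2 sq_int_measurable)
qed (auto simp: carrier_L2 add_L2 zero_L2 sq_int_measurable sq_int_zero ac_simps intro: sq_int_add)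

lemma complex_inner_space_L2: "complex_inner_space (L2 M)"
proof -
  interpret abelian_group "L2 M"
    by (rule abelian_group_L2)
  show ?thesis
  proof (intro complex_inner_space.intro complex_inner_space_axioms.intro)
    show "module complex_ring (L2 M)"
      by (intro module.intro module_axioms.intro cring_complex_ring abelian_group_L2)
        (auto simp: carrier_L2 add_L2 smult_L2 sq_int_measurable algebra_simps intro: sq_int_cmult)
  next
    fix X Y Z and t assume "X \<in> carrier (L2 M)" "Y \<in> carrier (L2 M)" "Z \<in> carrier (L2 M)"
    then show "ip (L2 M) (X \<oplus>\<^bsub>L2 M\<^esub> Y) Z = ip (L2 M) X Z + ip (L2 M) Y Z"
      by (auto simp: carrier_L2 add_L2 ip_L2 sq_int_measurable distrib_right
          intro!: Bochner_Integration.integral_add integrable_mult_sq_int sq_int_cnj)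
  next
    fix X Y and t assume "X \<in> carrier (L2 M)" "Y \<in> carrier (L2 M)"
    then show "ip (L2 M) (t \<odot>\<^bsub>L2 M\<^esub> X) Y = t * ip (L2 M) X Y"
      by (auto simp: carrier_L2 smult_L2 ip_L2 sq_int_measurable mult.assoc)
  next
    fix X Y assume "X \<in> carrier (L2 M)" "Y \<in> carrier (L2 M)"
    then show "ip (L2 M) Y X = cnj (ip (L2 M) X Y)"
      by (auto simp: carrier_L2 ip_L2 sq_int_measurable mult.commute simp flip: Bochner_Integration.integral_cnj)
  next
    fix X assume "X \<in> carrier (L2 M)"
    then obtain f where f: "f \<in> sq_int M" "X = ae_class M f"
      by (auto simp: carrier_L2)
    have ip: "ip (L2 M) X X = complex_of_real (LINT x|M. (cmod (f x))\<^sup>2)"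
      using f by (simp add: ip_L2 sq_int_measurable complex_norm_square flip: integral_complex_of_real del: of_real_power)
    then show "0 \<le> Re (ip (L2 M) X X)"
      by simp
    assume "ip (L2 M) X X = 0"
    then have "AE x in M. (cmod (f x))\<^sup>2 = 0"
      using ip f integral_nonneg_eq_0_iff_AE [OF sq_int_integrable [OF f(1)]] by auto
    then show "X = \<zero>\<^bsub>L2 M\<^esub>"
      unfolding f(2) zero_L2 by (intro ae_class_cong) auto
  qed
qed

lemma hnorm_L2:
  assumes "f \<in> sq_int M"
  shows "hnorm (L2 M) (ae_class M f) = sqrt (LINT x|M. (cmod (f x))\<^sup>2)"
proof -
  have "ip (L2 M) (ae_class M f) (ae_class M f) = complex_of_real (LINT x|M. (cmod (f x))\<^sup>2)"
    using assms by (simp add: ip_L2 sq_int_measurable complex_norm_square flip: integral_complex_of_real del: of_real_power)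
  then show ?thesis
    by (simp add: hnorm_def)
qed

lemma minus_L2:
  assumes "f \<in> sq_int M" "g \<in> sq_int M"
  shows "ae_class M f \<ominus>\<^bsub>L2 M\<^esub> ae_class M g = ae_class M (\<lambda>x. f x - g x)"
proof -
  interpret complex_inner_space "L2 M"
    by (rule complex_inner_space_L2)
  have mem: "ae_class M g \<in> carrier (L2 M)"
    using assms by (simp add: carrier_L2)
  have [measurable]: "f \<in> borel_measurable M" "g \<in> borel_measurable M"
    using assms by (auto dest: sq_int_measurable)
  show ?thesis
    unfolding a_minus_def minus_one [OF mem] by (simp add: smult_L2 add_L2)
qed

text \<open>Riesz and Fischer: along a subsequence with steps of squared norm at most \<open>4\<^sup>-\<^sup>k\<close>, the series of
  \<open>2\<^sup>k\<close> times the squared steps is finite almost everywhere, so the subsequence converges almost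
  everywhere, and Fatou's lemma identifies the limit.\<close>

lemma complex_hilbert_space_L2: "complex_hilbert_space (L2 M)"
proof -
  interpret complex_inner_space "L2 M"
    by (rule complex_inner_space_L2)
  have "\<exists>l. limitin metric.mtopology \<sigma> l sequentially" if \<sigma>: "metric.MCauchy \<sigma>" for \<sigma>
  proof -
    have "range \<sigma> \<subseteq> carrier (L2 M)"
      using \<sigma> by (simp add: metric.MCauchy_def)
    then have "\<forall>n. \<exists>f. f \<in> sq_int M \<and> \<sigma> n = ae_class M f"
      unfolding carrier_L2 by blast
    then obtain F where F: "\<And>n. F n \<in> sq_int M" and \<sigma>F: "\<And>n. \<sigma> n = ae_class M (F n)"
      by metis
    have [measurable]: "F n \<in> borel_measurable M" for n
      using F by (auto dest: sq_int_measurable)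
    have nn: "(\<integral>\<^sup>+x. ennreal ((cmod (h x))\<^sup>2) \<partial>M) = ennreal ((hnorm (L2 M) (ae_class M h))\<^sup>2)"
      if "h \<in> sq_int M" for h
      using that by (simp add: hnorm_L2 nn_integral_eq_integral [OF sq_int_integrable])
    have dist: "hdist (L2 M) (\<sigma> m) (\<sigma> n) = hnorm (L2 M) (ae_class M (\<lambda>x. F m x - F n x))" for m n
    proof -
      have "\<sigma> m \<in> carrier (L2 M)" "\<sigma> n \<in> carrier (L2 M)"
        using F by (auto simp: \<sigma>F carrier_L2)
      then have "hdist (L2 M) (\<sigma> m) (\<sigma> n) = hnorm (L2 M) (\<sigma> m \<ominus>\<^bsub>L2 M\<^esub> \<sigma> n)"
        by (simp add: hdist_def)
      then show ?thesis
        by (simp only: \<sigma>F minus_L2 [OF F F])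
    qed
    have cauchy: "\<exists>N. \<forall>m\<ge>N. \<forall>n\<ge>N. (\<integral>\<^sup>+x. ennreal ((cmod (F m x - F n x))\<^sup>2) \<partial>M) \<le> ennreal (e\<^sup>2)" if e: "e > 0" for e
    proof -
      obtain N where N: "\<And>m n. N \<le> m \<Longrightarrow> N \<le> n \<Longrightarrow> hdist (L2 M) (\<sigma> m) (\<sigma> n) < e"
        using conjunct2 [OF \<sigma> [unfolded metric.MCauchy_def], rule_format, OF e] by auto
      have "(\<integral>\<^sup>+x. ennreal ((cmod (F m x - F n x))\<^sup>2) \<partial>M) \<le> ennreal (e\<^sup>2)" if "m \<ge> N" "n \<ge> N" for m n
      proof -
        have "hnorm (L2 M) (ae_class M (\<lambda>x. F m x - F n x)) \<le> e"
          using N [OF that] unfolding dist by simp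
        moreover have "ae_class M (\<lambda>x. F m x - F n x) \<in> carrier (L2 M)"
          unfolding carrier_L2 by (intro imageI sq_int_diff F)
        ultimately have "(hnorm (L2 M) (ae_class M (\<lambda>x. F m x - F n x)))\<^sup>2 \<le> e\<^sup>2"
          using hnorm_nonneg by (intro power_mono)
        then show ?thesis
          using nn [OF sq_int_diff [OF F F, of m n]] by (simp add: ennreal_leI)
      qed
      then show ?thesis by blast
    qed
    have "\<exists>N. \<forall>m\<ge>N. \<forall>n\<ge>N. (\<integral>\<^sup>+x. ennreal ((cmod (F m x - F n x))\<^sup>2) \<partial>M) \<le> ennreal ((1 / 4) ^ k)" for k
      using cauchy [of "(1/2) ^ k"] by (simp add: power2_eq_square flip: power_mult_distrib)
    then obtain N where N: "\<And>k m n. N k \<le> m \<Longrightarrow> N k \<le> n \<Longrightarrow>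
        (\<integral>\<^sup>+x. ennreal ((cmod (F m x - F n x))\<^sup>2) \<partial>M) \<le> ennreal ((1 / 4) ^ k)"
      by metis
    define r where "r k = (\<Sum>j\<le>k. N j) + k" for k
    have r: "N k \<le> r k" "r k \<le> r (Suc k)" "k \<le> r k" for k
      by (auto simp: r_def intro: member_le_sum trans_le_add1)
    define G where "G k = F (r k)" for k
    have [measurable]: "G k \<in> borel_measurable M" for k
      by (simp add: G_def)
    have step: "(\<integral>\<^sup>+x. ennreal ((cmod (G (Suc k) x - G k x))\<^sup>2) \<partial>M) \<le> ennreal ((1 / 4) ^ k)" for k
      unfolding G_def using r [of k] by (intro N) auto
    have "(\<integral>\<^sup>+x. (\<Sum>k. ennreal (2 ^ k * (cmod (G (Suc k) x - G k x))\<^sup>2)) \<partial>M)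
        = (\<Sum>k. \<integral>\<^sup>+x. ennreal (2 ^ k * (cmod (G (Suc k) x - G k x))\<^sup>2) \<partial>M)"
      by (intro nn_integral_suminf) measurable
    also have "\<dots> \<le> (\<Sum>k. ennreal ((1 / 2) ^ k))"
    proof (intro suminf_le summableI)
      fix k
      have "(\<integral>\<^sup>+x. ennreal (2 ^ k * (cmod (G (Suc k) x - G k x))\<^sup>2) \<partial>M)
          = ennreal (2 ^ k) * (\<integral>\<^sup>+x. ennreal ((cmod (G (Suc k) x - G k x))\<^sup>2) \<partial>M)"
        by (simp add: ennreal_mult nn_integral_cmult)
      also have "\<dots> \<le> ennreal (2 ^ k) * ennreal ((1 / 4) ^ k)"
        by (intro mult_left_mono step) auto
      also have "\<dots> = ennreal ((1 / 2) ^ k)"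
        by (simp add: flip: ennreal_mult power_mult_distrib)
      finally show "(\<integral>\<^sup>+x. ennreal (2 ^ k * (cmod (G (Suc k) x - G k x))\<^sup>2) \<partial>M) \<le> ennreal ((1 / 2) ^ k)" .
    qed
    also have "\<dots> < \<infinity>"
      by (subst suminf_ennreal2) (auto intro: summable_geometric)
    finally have "AE x in M. (\<Sum>k. ennreal (2 ^ k * (cmod (G (Suc k) x - G k x))\<^sup>2)) \<noteq> \<infinity>"
      by (intro nn_integral_PInf_AE) auto
    then have ae: "AE x in M. (\<lambda>k. G k x) \<longlonglongrightarrow> lim (\<lambda>k. G k x)"
    proof eventually_elim
      case (elim x)
      define a where "a k = 2 ^ k * (cmod (G (Suc k) x - G k x))\<^sup>2" for k
      define S where "S = enn2real (\<Sum>k. ennreal (a k))"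
      have S: "a k \<le> S" for k
      proof -
        have "ennreal (a k) \<le> (\<Sum>k. ennreal (a k))"
          using sum_le_suminf [OF summableI, of "{k}" "\<lambda>k. ennreal (a k)"] by simp
        also have "\<dots> = ennreal S"
          using elim unfolding S_def a_def [symmetric] by (simp add: less_top)
        finally show ?thesis
          by (subst (asm) ennreal_le_iff) (simp_all add: S_def)
      qed
      have bound: "cmod (G (Suc k) x - G k x) \<le> sqrt S * (1 / sqrt 2) ^ k" for k
      proof (rule power2_le_imp_le)
        have "S \<ge> 0" by (simp add: S_def)
        have "((1 / sqrt 2) ^ k)\<^sup>2 = ((1 / sqrt 2)\<^sup>2) ^ k"
          by (metis mult.commute power_mult)
        also have "\<dots> = (1 / 2) ^ k"
          by (simp add: power_divide)
        finally have eq: "(sqrt S * (1 / sqrt 2) ^ k)\<^sup>2 = S * (1 / 2) ^ k"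
          using \<open>S \<ge> 0\<close> by (simp add: power_mult_distrib)
        show "(cmod (G (Suc k) x - G k x))\<^sup>2 \<le> (sqrt S * (1 / sqrt 2) ^ k)\<^sup>2"
          unfolding eq using S [of k] by (simp add: a_def field_simps power_divide)
      qed (simp add: S_def)
      have "summable (\<lambda>k. G (Suc k) x - G k x)"
      proof (rule summable_comparison_test')
        show "summable (\<lambda>k. sqrt S * (1 / sqrt 2) ^ k)"
          by (intro summable_mult summable_geometric) simp
      qed (rule bound)
      then have "convergent (\<lambda>n. \<Sum>k<n. G (Suc k) x - G k x)"
        by (simp add: summable_iff_convergent)
      then have "convergent (\<lambda>n. (G n x - G 0 x) + G 0 x)"
        unfolding sum_lessThan_telescope [of "\<lambda>k. G k x"] by (intro convergent_add convergent_const)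
      then show ?case
        by (simp add: convergent_LIMSEQ_iff)
    qed
    define f where "f x = lim (\<lambda>k. G k x)" for x
    have [measurable]: "f \<in> borel_measurable M"
      unfolding f_def by measurable
    have fatou: "(\<integral>\<^sup>+x. ennreal ((cmod (f x - F n x))\<^sup>2) \<partial>M) \<le> ennreal (e\<^sup>2)"
      if N: "\<And>m. m \<ge> N \<Longrightarrow> (\<integral>\<^sup>+x. ennreal ((cmod (F m x - F n x))\<^sup>2) \<partial>M) \<le> ennreal (e\<^sup>2)" for n e N
    proof -
      have "(\<integral>\<^sup>+x. ennreal ((cmod (f x - F n x))\<^sup>2) \<partial>M)
          = (\<integral>\<^sup>+x. liminf (\<lambda>k. ennreal ((cmod (G k x - F n x))\<^sup>2)) \<partial>M)"
      proof (rule nn_integral_cong_AE)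
        show "AE x in M. ennreal ((cmod (f x - F n x))\<^sup>2) = liminf (\<lambda>k. ennreal ((cmod (G k x - F n x))\<^sup>2))"
          using ae
        proof eventually_elim
          case (elim x)
          have "(\<lambda>k. ennreal ((cmod (G k x - F n x))\<^sup>2)) \<longlonglongrightarrow> ennreal ((cmod (f x - F n x))\<^sup>2)"
            unfolding f_def by (intro tendsto_intros elim)
          then show ?case
            by (intro lim_imp_Liminf [symmetric]) auto
        qed
      qed
      also have "\<dots> \<le> liminf (\<lambda>k. \<integral>\<^sup>+x. ennreal ((cmod (G k x - F n x))\<^sup>2) \<partial>M)"
        by (rule nn_integral_liminf) measurable
      also have "\<dots> \<le> ennreal (e\<^sup>2)"
      proof (rule Liminf_le)
        show "\<forall>\<^sub>F k in sequentially. (\<integral>\<^sup>+x. ennreal ((cmod (G k x - F n x))\<^sup>2) \<partial>M) \<le> ennreal (e\<^sup>2)"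
          unfolding eventually_sequentially G_def using r(3) N by (meson order_trans)
      qed simp
      finally show ?thesis .
    qed
    have sq: "(\<lambda>x. f x - F n x) \<in> sq_int M \<and> hnorm (L2 M) (ae_class M (\<lambda>x. f x - F n x)) \<le> e"
      if N: "\<And>m. m \<ge> N \<Longrightarrow> (\<integral>\<^sup>+x. ennreal ((cmod (F m x - F n x))\<^sup>2) \<partial>M) \<le> ennreal (e\<^sup>2)" and e: "e \<ge> 0" for n e N
    proof -
      have le: "(\<integral>\<^sup>+x. ennreal ((cmod (f x - F n x))\<^sup>2) \<partial>M) \<le> ennreal (e\<^sup>2)"
        by (rule fatou [OF N])
      then have "integrable M (\<lambda>x. (cmod (f x - F n x))\<^sup>2)"
        by (intro integrableI_bounded) (auto intro: le_less_trans)
      then have *: "(\<lambda>x. f x - F n x) \<in> sq_int M"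
        by (simp add: sq_int_def)
      then have "hnorm (L2 M) (ae_class M (\<lambda>x. f x - F n x)) \<le> e"
        using le nn [OF *] e by (auto intro: power2_le_imp_le simp: ennreal_le_iff)
      with * show ?thesis by blast
    qed
    obtain n0 where n0: "\<And>m. m \<ge> n0 \<Longrightarrow> (\<integral>\<^sup>+x. ennreal ((cmod (F m x - F n0 x))\<^sup>2) \<partial>M) \<le> ennreal (1\<^sup>2)"
      using cauchy [of 1] by auto
    have f: "f \<in> sq_int M"
      using sq_int_add [OF conjunct1 [OF sq [OF n0]] F [of n0]] by simp
    have "limitin metric.mtopology \<sigma> (ae_class M f) sequentially"
      unfolding metric.limit_metric_sequentially
    proof (intro conjI allI impI)
      show mem: "ae_class M f \<in> carrier (L2 M)"
        using f by (simp add: carrier_L2)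
      fix e :: real assume e: "e > 0"
      obtain n1 where n1: "\<And>m n. m \<ge> n1 \<Longrightarrow> n \<ge> n1 \<Longrightarrow>
          (\<integral>\<^sup>+x. ennreal ((cmod (F m x - F n x))\<^sup>2) \<partial>M) \<le> ennreal ((e / 2)\<^sup>2)"
        using cauchy [of "e / 2"] e by auto
      have "hdist (L2 M) (\<sigma> n) (ae_class M f) < e" if n: "n \<ge> n1" for n
      proof -
        have "hdist (L2 M) (\<sigma> n) (ae_class M f) = hdist (L2 M) (ae_class M f) (\<sigma> n)"
          by (rule metric.commute)
        also have "\<dots> = hnorm (L2 M) (ae_class M f \<ominus>\<^bsub>L2 M\<^esub> ae_class M (F n))"
          using F mem by (auto simp: hdist_def \<sigma>F carrier_L2)
        also have "\<dots> = hnorm (L2 M) (ae_class M (\<lambda>x. f x - F n x))"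
          by (simp only: minus_L2 [OF f F])
        also have "\<dots> \<le> e / 2"
          using sq [OF n1 [OF _ n]] e by auto
        finally show ?thesis using e by simp
      qed
      then show "\<exists>N. \<forall>n\<ge>N. \<sigma> n \<in> carrier (L2 M) \<and> hdist (L2 M) (\<sigma> n) (ae_class M f) < e"
        using F by (intro exI [of _ n1]) (auto simp: \<sigma>F carrier_L2)
    qed
    then show ?thesis by blast
  qed
  then show ?thesis
    by (intro complex_hilbert_space.intro complex_hilbert_space_axioms.intro complex_inner_space_axioms)
      (simp add: metric.mcomplete_def)
qed

section \<open>Multiplication by the variable\<close>

locale multiplication_model =
  fixes \<mu> :: "real measure"
  assumes sets_eq [measurable_cong]: "sets \<mu> = sets borel"
    and infinite: "emeasure \<mu> (space \<mu>) = \<infinity>"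
    and weight: "integrable \<mu> (\<lambda>x. 1 / (1 + x\<^sup>2))"
begin

lemma space_eq [simp]: "space \<mu> = UNIV"
  using sets_eq_imp_space_eq [OF sets_eq] by simp

lemma shift_nonzero: "Im z \<noteq> 0 \<Longrightarrow> complex_of_real x - z \<noteq> 0"
  by (auto simp: complex_eq_iff)

lemma sq_int_decay:
  assumes "f \<in> borel_measurable \<mu>" "\<And>x. cmod (f x) * sqrt (1 + x\<^sup>2) \<le> B"
  shows "f \<in> sq_int \<mu>"
proof (rule sq_int_bound)
  have pos: "1 + x\<^sup>2 > 0" for x :: real
    by (simp add: add_pos_nonneg)
  show "(\<lambda>x. complex_of_real (1 / sqrt (1 + x\<^sup>2))) \<in> sq_int \<mu>"
    using weight pos by (simp add: sq_int_def norm_divide power_divide less_imp_le)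
  have "cmod (f x) \<le> B * cmod (complex_of_real (1 / sqrt (1 + x\<^sup>2)))" for x
    using assms(2) [of x] pos [of x] by (simp add: norm_divide field_simps)
  then show "AE x in \<mu>. cmod (f x) \<le> B * cmod (complex_of_real (1 / sqrt (1 + x\<^sup>2)))"
    by simp
qed fact

lemma sqrt_weight_le: "sqrt (1 + x\<^sup>2) \<le> 1 + x\<^sup>2" "\<bar>x\<bar> * sqrt (1 + x\<^sup>2) \<le> 1 + x\<^sup>2" for x :: real
proof -
  have "\<bar>x\<bar> \<le> sqrt (1 + x\<^sup>2)" "1 \<le> sqrt (1 + x\<^sup>2)"
    by (auto intro: real_le_rsqrt)
  then have "1 * sqrt (1 + x\<^sup>2) \<le> sqrt (1 + x\<^sup>2) * sqrt (1 + x\<^sup>2)"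
    "\<bar>x\<bar> * sqrt (1 + x\<^sup>2) \<le> sqrt (1 + x\<^sup>2) * sqrt (1 + x\<^sup>2)"
    by (intro mult_right_mono; simp)+
  then show "sqrt (1 + x\<^sup>2) \<le> 1 + x\<^sup>2" "\<bar>x\<bar> * sqrt (1 + x\<^sup>2) \<le> 1 + x\<^sup>2"
    by simp_all
qed

lemma sq_int_weights: "(\<lambda>x. complex_of_real (1 / (1 + x\<^sup>2))) \<in> sq_int \<mu>"
  "(\<lambda>x. complex_of_real (x / (1 + x\<^sup>2))) \<in> sq_int \<mu>"
proof -
  have pos: "1 + x\<^sup>2 > 0" for x :: real
    by (simp add: add_pos_nonneg)
  show "(\<lambda>x. complex_of_real (1 / (1 + x\<^sup>2))) \<in> sq_int \<mu>"
    "(\<lambda>x. complex_of_real (x / (1 + x\<^sup>2))) \<in> sq_int \<mu>"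
    using sqrt_weight_le pos
    by (intro sq_int_decay [where B = 1]; simp add: norm_divide abs_of_pos [OF pos] del: of_real_divide of_real_add)+
qed

lemma weight_le_shift:
  assumes "Im z \<noteq> 0"
  shows "sqrt (1 + x\<^sup>2) \<le> (1 + cmod (z + \<i>) / \<bar>Im z\<bar>) * cmod (complex_of_real x - z)"
proof -
  have "\<bar>Im z\<bar> \<le> cmod (complex_of_real x - z)"
    using abs_Im_le_cmod [of "complex_of_real x - z"] by simp
  then have "cmod (z + \<i>) / \<bar>Im z\<bar> * \<bar>Im z\<bar> \<le> cmod (z + \<i>) / \<bar>Im z\<bar> * cmod (complex_of_real x - z)"
    by (intro mult_left_mono) auto
  then have "cmod (z + \<i>) \<le> cmod (z + \<i>) / \<bar>Im z\<bar> * cmod (complex_of_real x - z)"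
    using assms by simp
  moreover have "sqrt (1 + x\<^sup>2) = cmod ((complex_of_real x - z) + (z + \<i>))"
    by (simp add: cmod_def add.commute)
  ultimately show ?thesis
    using norm_triangle_ineq [of "complex_of_real x - z" "z + \<i>"] by (simp add: algebra_simps)
qed

lemma sq_int_res:
  assumes "Im z \<noteq> 0"
  shows "(\<lambda>x. 1 / (complex_of_real x - z)) \<in> sq_int \<mu>"
  using weight_le_shift [OF assms] shift_nonzero [OF assms]
  by (intro sq_int_decay [where B = "1 + cmod (z + \<i>) / \<bar>Im z\<bar>"]) (auto simp: norm_divide field_simps)

lemma sq_int_res_mult:
  assumes "Im z \<noteq> 0" "f \<in> sq_int \<mu>"
  shows "(\<lambda>x. f x / (complex_of_real x - z)) \<in> sq_int \<mu>"
proof -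
  have "cmod (1 / (complex_of_real x - z)) \<le> 1 / \<bar>Im z\<bar>" for x
    using abs_Im_le_cmod [of "complex_of_real x - z"] assms(1) by (simp add: norm_divide frac_le)
  then have "(\<lambda>x. (1 / (complex_of_real x - z)) * f x) \<in> sq_int \<mu>"
    by (intro sq_int_mult assms) auto
  then show ?thesis by simp
qed

lemma const_sq_int: "(\<lambda>x. t) \<in> sq_int \<mu> \<longleftrightarrow> t = 0"
proof
  assume "(\<lambda>x. t) \<in> sq_int \<mu>"
  then have int: "integrable \<mu> (\<lambda>x. (cmod t)\<^sup>2)"
    by (rule sq_int_integrable)
  show "t = 0"
  proof (rule ccontr)
    assume "t \<noteq> 0"
    have "(\<integral>\<^sup>+x. ennreal ((cmod t)\<^sup>2) \<partial>\<mu>) < \<infinity>"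
      using int by (simp add: integrable_iff_bounded)
    then show False
      using infinite \<open>t \<noteq> 0\<close> by (simp add: ennreal_mult_top)
  qed
qed (simp add: sq_int_zero)

text \<open>\<open>bd f t\<close> says that the class of \<open>f\<close> is in the domain of the maximal operator, which
  maps it to the class of \<open>x * f x - t\<close>.  The number \<open>t\<close> is unique because \<open>\<mu>\<close> is infinite.\<close>

definition bd :: "(real \<Rightarrow> complex) \<Rightarrow> complex \<Rightarrow> bool" where
  "bd f t \<longleftrightarrow> f \<in> sq_int \<mu> \<and> (\<lambda>x. complex_of_real x * f x - t) \<in> sq_int \<mu>"

definition D :: "(real \<Rightarrow> complex) set set" where
  "D = {X \<in> carrier (L2 \<mu>). \<exists>t. bd (rep X) t}"

definition c :: "(real \<Rightarrow> complex) set \<Rightarrow> complex" where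
  "c X = (THE t. bd (rep X) t)"

definition L :: "(real \<Rightarrow> complex) set \<Rightarrow> (real \<Rightarrow> complex) set" where
  "L X = ae_class \<mu> (\<lambda>x. complex_of_real x * rep X x - c X)"

definition d :: "(real \<Rightarrow> complex) set \<Rightarrow> complex" where
  "d X = (LINT x|\<mu>. rep X x - c X * complex_of_real (x / (1 + x\<^sup>2)))"

definition \<gamma> :: "complex \<Rightarrow> (real \<Rightarrow> complex) set" where
  "\<gamma> z = ae_class \<mu> (\<lambda>x. 1 / (complex_of_real x - z))"

lemma bd_measurable [measurable_dest]: "bd f t \<Longrightarrow> f \<in> borel_measurable \<mu>"
  by (auto simp: bd_def dest: sq_int_measurable)

lemma bd_unique:
  assumes "bd f s" "bd f t"
  shows "s = t"
proof -
  have "(\<lambda>x. (complex_of_real x * f x - t) - (complex_of_real x * f x - s)) \<in> sq_int \<mu>"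
    by (rule sq_int_diff) (use assms in \<open>auto simp: bd_def\<close>)
  then show ?thesis
    using const_sq_int [of "s - t"] by simp
qed

lemma bd_cong_AE:
  assumes "bd f t" "g \<in> borel_measurable \<mu>" "AE x in \<mu>. g x = f x"
  shows "bd g t"
proof -
  have [measurable]: "f \<in> borel_measurable \<mu>" "g \<in> borel_measurable \<mu>"
    using assms by (auto dest: bd_measurable)
  have "AE x in \<mu>. complex_of_real x * g x - t = complex_of_real x * f x - t"
    using assms(3) by eventually_elim simp
  then show ?thesis
    using assms unfolding bd_def by (auto intro: sq_int_cong_AE)
qed

lemma D_class:
  assumes "bd f t"
  shows "ae_class \<mu> f \<in> D" "c (ae_class \<mu> f) = t"
    "L (ae_class \<mu> f) = ae_class \<mu> (\<lambda>x. complex_of_real x * f x - t)"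
    "d (ae_class \<mu> f) = (LINT x|\<mu>. f x - t * complex_of_real (x / (1 + x\<^sup>2)))"
proof -
  have f [measurable]: "f \<in> borel_measurable \<mu>"
    using assms by (rule bd_measurable)
  note r [measurable] = rep_ae_class(1) [OF f]
  have b: "bd (rep (ae_class \<mu> f)) t"
    by (rule bd_cong_AE [OF assms rep_ae_class [OF f]])
  show "ae_class \<mu> f \<in> D"
    using b assms by (auto simp: D_def carrier_L2 bd_def)
  show c: "c (ae_class \<mu> f) = t"
    unfolding c_def using b bd_unique by blast
  show "L (ae_class \<mu> f) = ae_class \<mu> (\<lambda>x. complex_of_real x * f x - t)"
    unfolding L_def c
  proof (rule ae_class_cong)
    show "AE x in \<mu>. complex_of_real x * rep (ae_class \<mu> f) x - t = complex_of_real x * f x - t"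
      using rep_ae_class(2) [OF f] by eventually_elim simp
  qed
  show "d (ae_class \<mu> f) = (LINT x|\<mu>. f x - t * complex_of_real (x / (1 + x\<^sup>2)))"
    unfolding d_def c
  proof (rule Bochner_Integration.integral_cong_AE)
    show "AE x in \<mu>. rep (ae_class \<mu> f) x - t * complex_of_real (x / (1 + x\<^sup>2))
        = f x - t * complex_of_real (x / (1 + x\<^sup>2))"
      using rep_ae_class(2) [OF f] by eventually_elim simp
  qed measurable
qed

lemma D_E:
  assumes "X \<in> D"
  obtains f t where "bd f t" "X = ae_class \<mu> f"
proof -
  obtain f where f: "f \<in> sq_int \<mu>" "X = ae_class \<mu> f"
    using assms by (auto simp: D_def carrier_L2)
  obtain t where "bd (rep X) t"
    using assms by (auto simp: D_def)
  moreover have "AE x in \<mu>. f x = rep X x"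
    using rep_ae_class(2) [OF sq_int_measurable [OF f(1)]] unfolding f(2) by eventually_elim simp
  ultimately have "bd f t"
    using bd_cong_AE sq_int_measurable [OF f(1)] by blast
  then show ?thesis
    using f that by blast
qed

lemma bd_add:
  assumes "bd f s" "bd g t"
  shows "bd (\<lambda>x. f x + g x) (s + t)"
proof -
  have "(\<lambda>x. (complex_of_real x * f x - s) + (complex_of_real x * g x - t)) \<in> sq_int \<mu>"
    using assms by (intro sq_int_add) (auto simp: bd_def)
  then show ?thesis
    using assms by (auto simp: bd_def algebra_simps intro: sq_int_add)
qed

lemma bd_cmult:
  assumes "bd f s"
  shows "bd (\<lambda>x. t * f x) (t * s)"
proof -
  have "(\<lambda>x. t * (complex_of_real x * f x - s)) \<in> sq_int \<mu>"
    using assms by (intro sq_int_cmult) (auto simp: bd_def)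
  then show ?thesis
    using assms by (auto simp: bd_def algebra_simps intro: sq_int_cmult)
qed

lemma bd_res:
  assumes "Im z \<noteq> 0"
  shows "bd (\<lambda>x. 1 / (complex_of_real x - z)) 1"
proof -
  have "complex_of_real x * (1 / (complex_of_real x - z)) - 1 = z * (1 / (complex_of_real x - z))" for x
    using shift_nonzero [OF assms, of x] by (simp add: field_simps)
  then show ?thesis
    using sq_int_res [OF assms] sq_int_cmult [OF sq_int_res [OF assms], of z] by (simp add: bd_def)
qed

lemma bd_res_mult:
  assumes "Im z \<noteq> 0" "f \<in> sq_int \<mu>"
  shows "bd (\<lambda>x. f x / (complex_of_real x - z)) 0"
proof -
  have "complex_of_real x * (f x / (complex_of_real x - z)) = f x + z * (f x / (complex_of_real x - z))" for x
    using shift_nonzero [OF assms(1), of x] by (simp add: field_simps)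
  then show ?thesis
    using sq_int_res_mult [OF assms] sq_int_add [OF assms(2) sq_int_cmult [OF sq_int_res_mult [OF assms], of z]]
    by (simp add: bd_def)
qed

lemma integrable_regular_part:
  assumes "bd f t"
  shows "integrable \<mu> (\<lambda>x. f x - t * complex_of_real (x / (1 + x\<^sup>2)))"
proof -
  have "f x - t * complex_of_real (x / (1 + x\<^sup>2)) = complex_of_real (1 / (1 + x\<^sup>2)) * f x
      + complex_of_real (x / (1 + x\<^sup>2)) * (complex_of_real x * f x - t)" for x
  proof -
    have nz: "complex_of_real (1 + x\<^sup>2) \<noteq> 0"
      by (metis add_nonneg_eq_0_iff of_real_eq_0_iff zero_le_one zero_le_power2 zero_neq_one)
    define y where "y = complex_of_real (1 + x\<^sup>2)"
    have y: "y \<noteq> 0" "y = 1 + complex_of_real x * complex_of_real x"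
      using nz by (simp_all add: y_def power2_eq_square)
    have "f x - t * (complex_of_real x / y) = 1 / y * f x + complex_of_real x / y * (complex_of_real x * f x - t)"
      using y(1) by (simp add: divide_simps) (simp add: y(2) algebra_simps)
    then show ?thesis
      by (simp add: y_def)
  qed
  then show ?thesis
    using assms integrable_mult_sq_int [OF sq_int_weights(1), of f] integrable_mult_sq_int [OF sq_int_weights(2), of "\<lambda>x. complex_of_real x * f x - t"]
    by (simp add: bd_def)
qed

lemma green_L2:
  assumes "bd f s" "bd g t"
  shows "(LINT x|\<mu>. (complex_of_real x * f x - s) * cnj (g x)) - (LINT x|\<mu>. f x * cnj (complex_of_real x * g x - t))
    = (LINT x|\<mu>. f x - s * complex_of_real (x / (1 + x\<^sup>2))) * cnj t
      - s * cnj (LINT x|\<mu>. g x - t * complex_of_real (x / (1 + x\<^sup>2)))"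
proof -
  let ?f = "\<lambda>x. f x - s * complex_of_real (x / (1 + x\<^sup>2))"
  let ?g = "\<lambda>x. g x - t * complex_of_real (x / (1 + x\<^sup>2))"
  have "(LINT x|\<mu>. (complex_of_real x * f x - s) * cnj (g x)) - (LINT x|\<mu>. f x * cnj (complex_of_real x * g x - t))
      = (LINT x|\<mu>. (complex_of_real x * f x - s) * cnj (g x) - f x * cnj (complex_of_real x * g x - t))"
    using assms by (intro Bochner_Integration.integral_diff [symmetric] integrable_mult_sq_int sq_int_cnj)
      (auto simp: bd_def)
  also have "\<dots> = (LINT x|\<mu>. ?f x * cnj t - s * cnj (?g x))"
    by (intro Bochner_Integration.integral_cong) (auto simp: algebra_simps)
  also have "\<dots> = (LINT x|\<mu>. ?f x * cnj t) - (LINT x|\<mu>. s * cnj (?g x))"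
    using integrable_regular_part [OF assms(1)] integrable_regular_part [OF assms(2)]
    by (intro Bochner_Integration.integral_diff integrable_mult_left integrable_mult_right integrable_cnj)
  also have "\<dots> = (LINT x|\<mu>. ?f x) * cnj t - s * cnj (LINT x|\<mu>. ?g x)"
    by (simp only: integral_mult_left_zero integral_mult_right_zero Bochner_Integration.integral_cnj)
  finally show ?thesis .
qed

lemma integrable_zero_bd: "bd f 0 \<Longrightarrow> integrable \<mu> f"
  using integrable_regular_part [of f 0] by simp

lemma emeasure_interval_finite: "emeasure \<mu> {-real n..real n} < \<infinity>"
proof -
  have "integrable \<mu> (\<lambda>x. indicator {-real n..real n} x :: real)"
  proof (rule Bochner_Integration.integrable_bound)
    show "integrable \<mu> (\<lambda>x. (1 + (real n)\<^sup>2) * (1 / (1 + x\<^sup>2)))"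
      using weight by (rule integrable_mult_right)
    have "indicator {-real n..real n} x \<le> (1 + (real n)\<^sup>2) * (1 / (1 + x\<^sup>2))" for x
    proof (cases "x \<in> {-real n..real n}")
      case True
      then have "x\<^sup>2 \<le> (real n)\<^sup>2"
        by (intro abs_le_square_iff [THEN iffD1]) auto
      then show ?thesis
        using True by (simp add: add_pos_nonneg)
    qed (simp add: add_pos_nonneg)
    then show "AE x in \<mu>. norm (indicator {-real n..real n} x :: real) \<le> norm ((1 + (real n)\<^sup>2) * (1 / (1 + x\<^sup>2)))"
      by (intro AE_I2) (simp add: abs_of_nonneg order_trans [OF _ abs_ge_self])
  qed measurable
  then show ?thesis
    by (simp add: integrable_indicator_iff)
qed

lemma interval_cover: "(\<Union>n. {-real n..real n}) = UNIV"
proof -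
  have "\<exists>n. x \<in> {-real n..real n}" for x
    using real_arch_simple [of "\<bar>x\<bar>"] by (auto simp: abs_le_iff minus_le_iff)
  then show ?thesis by blast
qed

lemma measure_interval_unbounded: "\<exists>n. C < measure \<mu> {-real n..real n}"
proof (rule ccontr)
  assume "\<not> (\<exists>n. C < measure \<mu> {-real n..real n})"
  then have "emeasure \<mu> {-real n..real n} \<le> ennreal C" for n
    using emeasure_interval_finite [of n] by (simp add: emeasure_eq_ennreal_measure not_less ennreal_leI)
  then have "(SUP n. emeasure \<mu> {-real n..real n}) \<le> ennreal C"
    by (intro SUP_least)
  moreover have "(SUP n. emeasure \<mu> {-real n..real n}) = emeasure \<mu> (\<Union>n. {-real n..real n})"
    by (intro SUP_emeasure_incseq) (auto simp: incseq_def)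
  ultimately show False
    using infinite by (simp add: interval_cover top_unique)
qed

lemma sigma_finite: "sigma_finite_measure \<mu>"
proof
  show "\<exists>A. countable A \<and> A \<subseteq> sets \<mu> \<and> \<Union> A = space \<mu> \<and> (\<forall>a\<in>A. emeasure \<mu> a \<noteq> \<infinity>)"
  proof (intro exI conjI)
    show "\<Union> (range (\<lambda>n. {-real n..real n})) = space \<mu>"
      using interval_cover by simp
    show "\<forall>a\<in>range (\<lambda>n. {-real n..real n}). emeasure \<mu> a \<noteq> \<infinity>"
      using emeasure_interval_finite less_top by auto
  qed (auto simp: sets_eq)
qed

end

context multiplication_model
begin

lemma truncation_tendsto:
  assumes "f \<in> sq_int \<mu>"
  shows "(\<lambda>n. LINT x|\<mu>. (cmod (f x - indicator {-real n..real n} x * f x))\<^sup>2) \<longlonglongrightarrow> 0"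
proof -
  have [measurable]: "f \<in> borel_measurable \<mu>"
    using assms by (rule sq_int_measurable)
  have "(\<lambda>n. LINT x|\<mu>. (cmod (f x - indicator {-real n..real n} x * f x))\<^sup>2) \<longlonglongrightarrow> (LINT x|\<mu>. 0)"
  proof (rule integral_dominated_convergence [where w = "\<lambda>x. (cmod (f x))\<^sup>2"])
    show "AE x in \<mu>. (\<lambda>n. (cmod (f x - indicator {-real n..real n} x * f x))\<^sup>2) \<longlonglongrightarrow> 0"
    proof (rule AE_I2)
      fix x :: real
      obtain m where m: "\<bar>x\<bar> \<le> real m"
        using real_arch_simple by blast
      have "(cmod (f x - indicator {-real n..real n} x * f x))\<^sup>2 = 0" if "n \<ge> m" for n
      proof -
        have "\<bar>x\<bar> \<le> real n"
          using m that by linarith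
        then show ?thesis
          by (simp add: indicator_def abs_le_iff minus_le_iff)
      qed
      then show "(\<lambda>n. (cmod (f x - indicator {-real n..real n} x * f x))\<^sup>2) \<longlonglongrightarrow> 0"
        by (intro tendsto_eventually) (auto simp: eventually_sequentially)
    qed
    show "AE x in \<mu>. norm ((cmod (f x - indicator {-real n..real n} x * f x))\<^sup>2) \<le> (cmod (f x))\<^sup>2" for n
      by (intro AE_I2) (auto simp: indicator_def)
  qed (use sq_int_integrable [OF assms] in measurable)
  then show ?thesis by simp
qed

lemma bd_truncation:
  assumes "f \<in> sq_int \<mu>"
  shows "bd (\<lambda>x. indicator {-real n..real n} x * f x) 0"
proof -
  have "(\<lambda>x. indicator {-real n..real n} x * f x) \<in> sq_int \<mu>"
    using assms by (rule sq_int_mult [where B = 1]) (auto simp: indicator_def)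
  moreover have "(\<lambda>x. (complex_of_real x * indicator {-real n..real n} x) * f x) \<in> sq_int \<mu>"
    using assms by (rule sq_int_mult [where B = "real n"]) (auto simp: indicator_def)
  ultimately show ?thesis
    by (simp add: bd_def mult.assoc)
qed

lemma dense_L2: "htopology (L2 \<mu>) closure_of {X \<in> D. c X = 0 \<and> d X = 0} = carrier (L2 \<mu>)"
proof -
  interpret complex_inner_space "L2 \<mu>"
    by (rule complex_inner_space_L2)
  have approx: "\<exists>g. bd g 0 \<and> (LINT x|\<mu>. g x) = 0 \<and> hdist (L2 \<mu>) (ae_class \<mu> f) (ae_class \<mu> g) < e"
    if f: "f \<in> sq_int \<mu>" and e: "e > 0" for f e
  proof -
    have [measurable]: "f \<in> borel_measurable \<mu>"
      using f by (rule sq_int_measurable)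
    have pos: "e\<^sup>2 / 4 > 0" using e by simp
    obtain n where n: "(LINT x|\<mu>. (cmod (f x - indicator {-real n..real n} x * f x))\<^sup>2) < e\<^sup>2 / 4"
      using order_tendstoD(2) [OF truncation_tendsto [OF f] pos] by (auto simp: eventually_sequentially)
    define h where "h x = indicator {-real n..real n} x * f x" for x
    have h: "bd h 0"
      unfolding h_def by (rule bd_truncation [OF f])
    define s where "s = (LINT x|\<mu>. h x)"
    obtain m where m: "max 1 (4 * (cmod s)\<^sup>2 / e\<^sup>2) < measure \<mu> {-real m..real m}"
      using measure_interval_unbounded by blast
    define v where "v = measure \<mu> {-real m..real m}"
    have v: "v > 0" "4 * (cmod s)\<^sup>2 < e\<^sup>2 * v"
      using m e by (auto simp: v_def field_simps)
    define k where "k x = (s / v) * indicator {-real m..real m} x" for x :: real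
    have ind: "(\<lambda>x. indicator {-real m..real m} x) \<in> sq_int \<mu>"
    proof -
      have "(\<lambda>x. (cmod (indicator {-real m..real m} x))\<^sup>2) = (\<lambda>x. indicator {-real m..real m} x)"
        by (auto simp: indicator_def)
      then show ?thesis
        using emeasure_interval_finite [of m] by (simp add: sq_int_def integrable_indicator_iff)
    qed
    have "bd (\<lambda>x. (s / v) * (indicator {-real m..real m} x * indicator {-real m..real m} x)) ((s / v) * 0)"
      by (intro bd_cmult bd_truncation ind)
    moreover have "(\<lambda>x. (s / v) * (indicator {-real m..real m} x * indicator {-real m..real m} x)) = k"
      by (auto simp: k_def indicator_def)
    ultimately have k: "bd k 0"
      by simp
    have int_k: "(LINT x|\<mu>. k x) = s"
    proof -
      have "(LINT x|\<mu>. indicator {-real m..real m} x :: complex) = complex_of_real v"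
      proof -
        have "(LINT x|\<mu>. indicator {-real m..real m} x :: complex)
            = (LINT x|\<mu>. complex_of_real (indicator {-real m..real m} x))"
          by (intro Bochner_Integration.integral_cong) (auto simp: indicator_def)
        then show ?thesis
          by (simp add: v_def)
      qed
      then show ?thesis
        using v by (simp add: k_def)
    qed
    have norm_k: "(LINT x|\<mu>. (cmod (k x))\<^sup>2) = (cmod s)\<^sup>2 / v"
    proof -
      have "(LINT x|\<mu>. (cmod (k x))\<^sup>2) = (LINT x|\<mu>. (cmod s / v)\<^sup>2 * indicator {-real m..real m} x)"
        using v by (intro Bochner_Integration.integral_cong) (auto simp: k_def indicator_def norm_mult norm_divide)
      also have "\<dots> = (cmod s / v)\<^sup>2 * v"
        by (simp add: v_def)
      finally show ?thesis
        using v by (simp add: power_divide power2_eq_square)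
    qed
    define g where "g x = h x + (- 1) * k x" for x
    have g: "bd g 0"
      using bd_add [OF h bd_cmult [OF k, of "-1"]] by (simp add: g_def [abs_def])
    have sq: "g \<in> sq_int \<mu>" "h \<in> sq_int \<mu>" "k \<in> sq_int \<mu>"
      using g h k by (auto simp: bd_def)
    have "(LINT x|\<mu>. g x) = s - s"
      unfolding g_def using integrable_zero_bd [OF h] integrable_zero_bd [OF k] int_k by (simp add: s_def)
    moreover have "hdist (L2 \<mu>) (ae_class \<mu> f) (ae_class \<mu> g) < e"
    proof -
      have mem: "ae_class \<mu> u \<in> carrier (L2 \<mu>)" if "u \<in> sq_int \<mu>" for u
        using that by (simp add: carrier_L2)
      have "hdist (L2 \<mu>) (ae_class \<mu> f) (ae_class \<mu> g) = hnorm (L2 \<mu>) (ae_class \<mu> (\<lambda>x. f x - g x))"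
        using mem [OF f] mem [OF sq(1)] by (simp add: hdist_def minus_L2 [OF f sq(1)])
      also have "ae_class \<mu> (\<lambda>x. f x - g x) = ae_class \<mu> (\<lambda>x. f x - h x) \<oplus>\<^bsub>L2 \<mu>\<^esub> ae_class \<mu> k"
        using sq_int_measurable [OF sq_int_diff [OF f sq(2)]] sq_int_measurable [OF sq(3)]
        by (simp add: add_L2 g_def algebra_simps)
      also have "hnorm (L2 \<mu>) \<dots> \<le> hnorm (L2 \<mu>) (ae_class \<mu> (\<lambda>x. f x - h x)) + hnorm (L2 \<mu>) (ae_class \<mu> k)"
        by (intro hnorm_triangle mem sq_int_diff f sq)
      also have "\<dots> = sqrt (LINT x|\<mu>. (cmod (f x - h x))\<^sup>2) + sqrt ((cmod s)\<^sup>2 / v)"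
        by (simp add: hnorm_L2 [OF sq_int_diff [OF f sq(2)]] hnorm_L2 [OF sq(3)] norm_k)
      also have "\<dots> < sqrt (e\<^sup>2 / 4) + sqrt (e\<^sup>2 / 4)"
        using n v by (intro add_strict_mono real_sqrt_less_mono) (auto simp: h_def field_simps)
      also have "\<dots> = e"
        using e by (simp add: real_sqrt_divide)
      finally show ?thesis .
    qed
    ultimately show ?thesis
      using g by auto
  qed
  show ?thesis
  proof (intro subset_antisym subsetI)
    fix X assume "X \<in> htopology (L2 \<mu>) closure_of {X \<in> D. c X = 0 \<and> d X = 0}"
    then show "X \<in> carrier (L2 \<mu>)"
      using closure_of_subset_topspace [of "htopology (L2 \<mu>)"] by auto
  next
    fix X assume X: "X \<in> carrier (L2 \<mu>)"
    then obtain f where f: "f \<in> sq_int \<mu>" "X = ae_class \<mu> f"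
      by (auto simp: carrier_L2)
    have "\<exists>Y \<in> {X \<in> D. c X = 0 \<and> d X = 0}. Y \<in> metric.mball X e" if e: "e > 0" for e
    proof -
      obtain g where g: "bd g 0" "(LINT x|\<mu>. g x) = 0" "hdist (L2 \<mu>) X (ae_class \<mu> g) < e"
        using approx [OF f(1) e] f(2) by blast
      then have "ae_class \<mu> g \<in> {X \<in> D. c X = 0 \<and> d X = 0}"
        using D_class [OF g(1)] by simp
      moreover have "ae_class \<mu> g \<in> carrier (L2 \<mu>)"
        using g by (auto simp: bd_def carrier_L2)
      ultimately show ?thesis
        using X g(3) by (intro bexI [of _ "ae_class \<mu> g"]) auto
    qed
    then show "X \<in> htopology (L2 \<mu>) closure_of {X \<in> D. c X = 0 \<and> d X = 0}"
      unfolding htopology_metric metric.metric_closure_of using X by blast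
  qed
qed

sublocale boundary_triple "L2 \<mu>" D L c d \<gamma>
proof -
  interpret H: complex_hilbert_space "L2 \<mu>"
    by (rule complex_hilbert_space_L2)
  show "boundary_triple (L2 \<mu>) D L c d \<gamma>"
  proof (intro boundary_triple.intro boundary_triple_axioms.intro H.complex_hilbert_space_axioms dense_L2)
    fix X assume "X \<in> D"
    then obtain f s where f: "bd f s" "X = ae_class \<mu> f"
      by (rule D_E)
    have [measurable]: "f \<in> borel_measurable \<mu>"
      using f by (auto dest: bd_measurable)
    show "X \<in> carrier (L2 \<mu>)" "L X \<in> carrier (L2 \<mu>)"
      using f D_class [OF f(1)] by (auto simp: bd_def carrier_L2)
    show "t \<odot>\<^bsub>L2 \<mu>\<^esub> X \<in> D" "c (t \<odot>\<^bsub>L2 \<mu>\<^esub> X) = t * c X" for t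
      using D_class [OF bd_cmult [OF f(1), of t]] D_class [OF f(1)] f(2) by (simp_all add: smult_L2)
    show "L (t \<odot>\<^bsub>L2 \<mu>\<^esub> X) = t \<odot>\<^bsub>L2 \<mu>\<^esub> L X" for t
      using D_class [OF bd_cmult [OF f(1), of t]] D_class [OF f(1)] f(2)
      by (simp add: smult_L2 algebra_simps)
    show "d (t \<odot>\<^bsub>L2 \<mu>\<^esub> X) = t * d X" for t
    proof -
      have "d (t \<odot>\<^bsub>L2 \<mu>\<^esub> X) = (LINT x|\<mu>. t * (f x - s * complex_of_real (x / (1 + x\<^sup>2))))"
        using D_class [OF bd_cmult [OF f(1), of t]] f(2) by (simp add: smult_L2 right_diff_distrib mult.assoc)
      then show ?thesis
        using D_class [OF f(1)] f(2) by simp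
    qed
  next
    fix X Y assume "X \<in> D" "Y \<in> D"
    then obtain f s g t where f: "bd f s" "X = ae_class \<mu> f" and g: "bd g t" "Y = ae_class \<mu> g"
      using D_E by metis
    have [measurable]: "f \<in> borel_measurable \<mu>" "g \<in> borel_measurable \<mu>"
      using f g by (auto dest: bd_measurable)
    note D = D_class [OF f(1)] D_class [OF g(1)] D_class [OF bd_add [OF f(1) g(1)]]
    show "X \<oplus>\<^bsub>L2 \<mu>\<^esub> Y \<in> D" "c (X \<oplus>\<^bsub>L2 \<mu>\<^esub> Y) = c X + c Y"
      using D f(2) g(2) by (simp_all add: add_L2)
    show "L (X \<oplus>\<^bsub>L2 \<mu>\<^esub> Y) = L X \<oplus>\<^bsub>L2 \<mu>\<^esub> L Y"
      using D f(2) g(2) by (simp add: add_L2 algebra_simps)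
    show "d (X \<oplus>\<^bsub>L2 \<mu>\<^esub> Y) = d X + d Y"
    proof -
      have "d (X \<oplus>\<^bsub>L2 \<mu>\<^esub> Y) = (LINT x|\<mu>. f x + g x - (s + t) * complex_of_real (x / (1 + x\<^sup>2)))"
        unfolding f(2) g(2) by (simp only: add_L2 D(12) \<open>f \<in> borel_measurable \<mu>\<close> \<open>g \<in> borel_measurable \<mu>\<close>)
      also have "\<dots> = (LINT x|\<mu>. (f x - s * complex_of_real (x / (1 + x\<^sup>2)))
          + (g x - t * complex_of_real (x / (1 + x\<^sup>2))))"
        by (intro Bochner_Integration.integral_cong refl) (simp add: distrib_right del: of_real_divide)
      also have "\<dots> = d X + d Y"
        unfolding f(2) g(2) D(4) D(8) using f(1) g(1)
        by (intro Bochner_Integration.integral_add integrable_regular_part)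
      finally show ?thesis .
    qed
    show "ip (L2 \<mu>) (L X) Y - ip (L2 \<mu>) X (L Y) = d X * cnj (c Y) - c X * cnj (d Y)"
      using green_L2 [OF f(1) g(1)] D f(2) g(2) by (simp add: ip_L2)
  next
    fix z :: complex assume z: "Im z \<noteq> 0"
    note D = D_class [OF bd_res [OF z]]
    show "\<gamma> z \<in> D" "c (\<gamma> z) = 1"
      using D by (simp_all add: \<gamma>_def)
    have "complex_of_real x * (1 / (complex_of_real x - z)) - 1 = z * (1 / (complex_of_real x - z))" for x
      using shift_nonzero [OF z, of x] by (simp add: field_simps)
    then show "L (\<gamma> z) = z \<odot>\<^bsub>L2 \<mu>\<^esub> \<gamma> z"
      using D by (simp add: \<gamma>_def smult_L2 sq_int_measurable [OF sq_int_res [OF z]])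
  next
    fix z X assume z: "Im z \<noteq> 0" and "X \<in> carrier (L2 \<mu>)"
    then obtain h where h: "h \<in> sq_int \<mu>" "X = ae_class \<mu> h"
      by (auto simp: carrier_L2)
    let ?f = "\<lambda>x. h x / (complex_of_real x - z)"
    note b = bd_res_mult [OF z h(1)]
    have eq: "complex_of_real x * ?f x - 0 - z * ?f x = h x" for x
    proof -
      have "complex_of_real x * ?f x - 0 - z * ?f x = (complex_of_real x - z) * ?f x"
        by (simp only: left_diff_distrib diff_0_right)
      also have "\<dots> = h x"
        by (metis nonzero_mult_div_cancel_left times_divide_eq_right shift_nonzero z)
      finally show ?thesis .
    qed
    have sq: "?f \<in> sq_int \<mu>" "(\<lambda>x. complex_of_real x * ?f x - 0) \<in> sq_int \<mu>"
      using b unfolding bd_def by blast+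
    have "L (ae_class \<mu> ?f) \<ominus>\<^bsub>L2 \<mu>\<^esub> z \<odot>\<^bsub>L2 \<mu>\<^esub> ae_class \<mu> ?f
        = ae_class \<mu> (\<lambda>x. complex_of_real x * ?f x - 0 - z * ?f x)"
      unfolding D_class(3) [OF b] smult_L2 [OF bd_measurable [OF b]]
      by (rule minus_L2 [OF sq(2) sq_int_cmult [OF sq(1)]])
    also have "\<dots> = X"
      by (simp only: eq h(2))
    finally have "L (ae_class \<mu> ?f) \<ominus>\<^bsub>L2 \<mu>\<^esub> z \<odot>\<^bsub>L2 \<mu>\<^esub> ae_class \<mu> ?f = X" .
    then show "\<exists>f\<in>D. c f = 0 \<and> L f \<ominus>\<^bsub>L2 \<mu>\<^esub> z \<odot>\<^bsub>L2 \<mu>\<^esub> f = X"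
      using D_class [OF b] by blast
  qed
qed

end

text \<open>The polynomial \<open>u \<mapsto> (3 u - u\<^sup>3) / 2\<close> fixes \<open>-1\<close>, \<open>0\<close>, \<open>1\<close>; its iterates approximate the sign.\<close>

definition sgn_poly :: "real \<Rightarrow> real" where
  "sgn_poly u = (3 * u - u ^ 3) / 2"

lemma sgn_poly_bounds:
  assumes "0 \<le> u" "u \<le> 1"
  shows "u \<le> sgn_poly u" "sgn_poly u \<le> 1" "1 - sgn_poly u \<le> (1 - u) * (1 - u / 2)"
proof -
  have eq: "sgn_poly u - u = u * (1 - u) * (1 + u) / 2"
    "1 - sgn_poly u = (1 - u) * ((1 - u) * (2 + u) / 2)"
    by (simp_all add: sgn_poly_def field_simps power3_eq_cube)
  show "u \<le> sgn_poly u"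
  proof -
    have "0 \<le> u * (1 - u) * (1 + u) / 2"
      using assms by (intro divide_nonneg_nonneg mult_nonneg_nonneg) auto
    then show ?thesis
      using eq(1) by linarith
  qed
  have "0 \<le> (1 - u) * ((1 - u) * (2 + u) / 2)"
    using assms by simp
  then show "sgn_poly u \<le> 1"
    using eq(2) by simp
  have "(1 - u) * (2 + u) / 2 \<le> 1 - u / 2"
    using assms by (simp add: field_simps)
  then show "1 - sgn_poly u \<le> (1 - u) * (1 - u / 2)"
    unfolding eq(2) using assms by (intro mult_left_mono) auto
qed

lemma sgn_poly_minus: "sgn_poly (- u) = - sgn_poly u"
  by (simp add: sgn_poly_def field_simps)

lemma sgn_poly_iter_minus: "(sgn_poly ^^ n) (- u) = - (sgn_poly ^^ n) u"
  by (induction n) (simp_all add: sgn_poly_minus)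

lemma sgn_poly_iter_nonneg:
  assumes "0 \<le> u" "u \<le> 1"
  shows "u \<le> (sgn_poly ^^ n) u \<and> (sgn_poly ^^ n) u \<le> 1 \<and> 1 - (sgn_poly ^^ n) u \<le> (1 - u / 2) ^ n"
proof (induction n)
  case (Suc n)
  let ?v = "(sgn_poly ^^ n) u"
  have v: "u \<le> ?v" "?v \<le> 1" "1 - ?v \<le> (1 - u / 2) ^ n"
    using Suc by auto
  then have v0: "0 \<le> ?v" using assms by linarith
  have "1 - sgn_poly ?v \<le> (1 - ?v) * (1 - ?v / 2)"
    using sgn_poly_bounds(3) [OF v0 v(2)] .
  also have "\<dots> \<le> (1 - u / 2) ^ n * (1 - u / 2)"
    using v v0 assms by (intro mult_mono) auto
  finally show ?case
    using sgn_poly_bounds(1,2) [OF v0 v(2)] v by (simp add: mult.commute)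
qed (use assms in auto)

lemma sgn_poly_iter_le:
  assumes "\<bar>u\<bar> \<le> 1"
  shows "\<bar>(sgn_poly ^^ n) u\<bar> \<le> 1"
proof (cases "u \<ge> 0")
  case True
  then show ?thesis
    using sgn_poly_iter_nonneg [of u n] assms by auto
next
  case False
  then show ?thesis
    using sgn_poly_iter_nonneg [of "- u" n] assms by (auto simp: sgn_poly_iter_minus)
qed

lemma sgn_poly_iter_tendsto:
  assumes "\<bar>u\<bar> \<le> 1"
  shows "(\<lambda>n. (sgn_poly ^^ n) u) \<longlonglongrightarrow> sgn u"
proof -
  have pos: "(\<lambda>n. (sgn_poly ^^ n) u) \<longlonglongrightarrow> 1" if u: "0 < u" "u \<le> 1" for u
  proof -
    have lim: "(\<lambda>n. 1 - (1 - u / 2) ^ n) \<longlonglongrightarrow> 1 - 0"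
      using u by (intro tendsto_diff tendsto_const LIMSEQ_realpow_zero) auto
    have le: "1 - (1 - u / 2) ^ n \<le> (sgn_poly ^^ n) u" "(sgn_poly ^^ n) u \<le> 1" for n
      using sgn_poly_iter_nonneg [of u n] u by auto
    show ?thesis
      by (rule real_tendsto_sandwich [OF always_eventually always_eventually lim [simplified] tendsto_const])
        (use le in auto)
  qed
  consider "u > 0" | "u = 0" | "u < 0" by linarith
  then show ?thesis
  proof cases
    case 1
    then show ?thesis using pos assms by simp
  next
    case 2
    have "(sgn_poly ^^ n) 0 = 0" for n
      by (induction n) (simp_all add: sgn_poly_def)
    then show ?thesis using 2 by simp
  next
    case 3
    then have "(\<lambda>n. - (sgn_poly ^^ n) (- u)) \<longlonglongrightarrow> - 1"
      using assms by (intro tendsto_minus pos) auto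
    then show ?thesis
      using 3 by (simp add: sgn_poly_iter_minus)
  qed
qed

context multiplication_model
begin

text \<open>Multiplication by resolvents generates enough multipliers to approximate half-line indicators:
  the real part of \<open>1 / (x - t - \<i>)\<close> has the sign of \<open>x - t\<close>.\<close>

lemma resolvent_invariant_zero:
  assumes sub: "N \<subseteq> sq_int \<mu>"
    and add: "\<And>f g. f \<in> N \<Longrightarrow> g \<in> N \<Longrightarrow> (\<lambda>x. f x + g x) \<in> N"
    and cmult: "\<And>f s. f \<in> N \<Longrightarrow> (\<lambda>x. s * f x) \<in> N"
    and res: "\<And>f z. f \<in> N \<Longrightarrow> Im z \<noteq> 0 \<Longrightarrow> (\<lambda>x. f x / (complex_of_real x - z)) \<in> N"
    and int: "\<And>f z. f \<in> N \<Longrightarrow> Im z \<noteq> 0 \<Longrightarrow> (LINT x|\<mu>. f x / (complex_of_real x - z)) = 0"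
    and f: "f \<in> N"
  shows "AE x in \<mu>. f x = 0"
proof -
  define q where "q t x = (x - t) / (1 + (x - t)\<^sup>2)" for t x :: real
  have q_le: "\<bar>q t x\<bar> \<le> 1" for t x
  proof -
    have "\<bar>x - t\<bar> \<le> 2 * \<bar>x - t\<bar> * 1"
      by simp
    also have "\<dots> \<le> \<bar>x - t\<bar>\<^sup>2 + 1\<^sup>2"
      by (rule sum_squares_bound)
    finally have "\<bar>x - t\<bar> \<le> 1 + (x - t)\<^sup>2"
      by (simp add: add.commute)
    then show ?thesis
      by (simp add: q_def divide_le_eq_1 add_pos_nonneg)
  qed
  have q_mult: "(\<lambda>x. complex_of_real (q t x) * g x) \<in> N" if "g \<in> N" for g t
  proof -
    have q_eq: "complex_of_real (q t x) * g x = 1/2 * (g x / (complex_of_real x - (t + \<i>)) + g x / (complex_of_real x - (t - \<i>)))" for x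
    proof -
      have nz: "complex_of_real x - (t + \<i>) \<noteq> 0" "complex_of_real x - (t - \<i>) \<noteq> 0"
        by (auto simp: complex_eq_iff)
      have "(complex_of_real x - (t + \<i>)) * (complex_of_real x - (t - \<i>)) = complex_of_real (1 + (x - t)\<^sup>2)"
        by (simp add: algebra_simps power2_eq_square)
      then have "1 / (complex_of_real x - (t + \<i>)) + 1 / (complex_of_real x - (t - \<i>))
          = 2 * complex_of_real (x - t) / complex_of_real (1 + (x - t)\<^sup>2)"
        using nz by (simp add: add_frac_eq)
      then have eq: "1 / (complex_of_real x - (t + \<i>)) + 1 / (complex_of_real x - (t - \<i>))
          = 2 * complex_of_real (q t x)"
        by (simp add: q_def)
      have "complex_of_real (q t x) = 1/2 * (1 / (complex_of_real x - (t + \<i>)) + 1 / (complex_of_real x - (t - \<i>)))"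
        unfolding eq by simp
      then show ?thesis
        by (simp add: algebra_simps)
    qed
    show ?thesis
      unfolding q_eq using that by (intro cmult add res) auto
  qed
  define p where "p t n x = (sgn_poly ^^ n) (q t x)" for t n x
  have p_mult: "(\<lambda>x. complex_of_real (p t n x) * g x) \<in> N" if "g \<in> N" for g t n
    using that
  proof (induction n arbitrary: g)
    case 0
    then show ?case using q_mult by (simp add: p_def)
  next
    case (Suc n)
    have "(\<lambda>x. 3/2 * (complex_of_real (p t n x) * g x) + (-1/2) * (complex_of_real (p t n x)
        * (complex_of_real (p t n x) * (complex_of_real (p t n x) * g x)))) \<in> N"
      by (intro cmult add Suc)
    then show ?case
      by (simp add: p_def sgn_poly_def power3_eq_cube algebra_simps diff_divide_distrib)
  qed
  define F where "F x = f x / (complex_of_real x - \<i>)" for x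
  have F: "integrable \<mu> F"
    unfolding F_def using bd_res_mult [of \<i> f] f sub by (intro integrable_zero_bd) auto
  note F_meas [measurable] = borel_measurable_integrable [OF F]
  have [measurable]: "p t n \<in> borel_measurable \<mu>" for t n
  proof (induction n)
    case 0
    show ?case by (simp add: p_def [abs_def] q_def)
  next
    case (Suc n)
    then have [measurable]: "p t n \<in> borel_measurable \<mu>" .
    have "p t (Suc n) = (\<lambda>x. (3 * p t n x - p t n x ^ 3) / 2)"
      by (simp add: p_def fun_eq_iff sgn_poly_def)
    then show ?case by simp
  qed
  define \<psi> where "\<psi> t n x = (p t n x + (p t n x)\<^sup>2) / 2" for t n x
  have \<psi>_int: "(LINT x|\<mu>. complex_of_real (\<psi> t n x) * F x) = 0" for t n
  proof -
    have "(\<lambda>x. 1/2 * (complex_of_real (p t n x) * f x + complex_of_real (p t n x) * (complex_of_real (p t n x) * f x))) \<in> N"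
      by (intro cmult add p_mult f)
    then have "(LINT x|\<mu>. (1/2 * (complex_of_real (p t n x) * f x + complex_of_real (p t n x) * (complex_of_real (p t n x) * f x)))
        / (complex_of_real x - \<i>)) = 0"
      by (rule int) simp
    moreover have "(1/2 * (complex_of_real (p t n x) * f x + complex_of_real (p t n x) * (complex_of_real (p t n x) * f x)))
        / (complex_of_real x - \<i>) = complex_of_real (\<psi> t n x) * F x" for x
      by (simp add: \<psi>_def F_def power2_eq_square algebra_simps add_divide_distrib)
    ultimately show ?thesis by simp
  qed
  have half_line: "(LINT x|\<mu>. indicator {t<..} x *\<^sub>R F x) = 0" for t
  proof -
    have "(\<lambda>n. LINT x|\<mu>. complex_of_real (\<psi> t n x) * F x) \<longlonglongrightarrow> (LINT x|\<mu>. indicator {t<..} x *\<^sub>R F x)"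
    proof (rule integral_dominated_convergence [where w = "\<lambda>x. cmod (F x)"])
      show "AE x in \<mu>. (\<lambda>n. complex_of_real (\<psi> t n x) * F x) \<longlonglongrightarrow> indicator {t<..} x *\<^sub>R F x"
      proof (rule AE_I2)
        fix x
        have "(\<lambda>n. \<psi> t n x) \<longlonglongrightarrow> (sgn (q t x) + (sgn (q t x))\<^sup>2) / 2"
          unfolding \<psi>_def p_def by (intro tendsto_intros sgn_poly_iter_tendsto q_le) auto
        moreover have "0 < 1 + (x - t)\<^sup>2"
          by (simp add: add_pos_nonneg)
        then have "sgn (q t x) = sgn (x - t)"
          by (auto simp: q_def sgn_if zero_less_divide_iff)
        moreover have "(sgn (x - t) + (sgn (x - t))\<^sup>2) / 2 = indicator {t<..} x"
          by (auto simp: sgn_if indicator_def)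
        ultimately have "(\<lambda>n. complex_of_real (\<psi> t n x) * F x) \<longlonglongrightarrow> complex_of_real (indicator {t<..} x) * F x"
          by (intro tendsto_intros) simp
        then show "(\<lambda>n. complex_of_real (\<psi> t n x) * F x) \<longlonglongrightarrow> indicator {t<..} x *\<^sub>R F x"
          by (simp add: scaleR_conv_of_real)
      qed
      have "\<bar>\<psi> t n x\<bar> \<le> 1" for n x
      proof -
        have p: "\<bar>p t n x\<bar> \<le> 1"
          unfolding p_def by (intro sgn_poly_iter_le q_le)
        then have "(p t n x)\<^sup>2 \<le> 1"
          by (simp add: abs_square_le_1)
        then show ?thesis
          using p by (simp add: \<psi>_def abs_le_iff)
            (smt (verit) zero_le_power2)
      qed
      then show "AE x in \<mu>. norm (complex_of_real (\<psi> t n x) * F x) \<le> cmod (F x)" for n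
        by (intro AE_I2) (simp add: norm_mult mult_left_le_one_le)
    qed (use F in \<open>auto simp: \<psi>_def\<close>)
    then show ?thesis
      by (simp add: \<psi>_int LIMSEQ_const_iff)
  qed
  have all: "(LINT x|\<mu>. indicator A x *\<^sub>R F x) = 0" if "A \<in> sets \<mu>" for A
  proof -
    have intA: "integrable \<mu> (\<lambda>x. indicator A x *\<^sub>R F x)" if "A \<in> sets \<mu>" for A
      using that F by (rule integrable_mult_indicator)
    have UN: "(LINT x|\<mu>. F x) = 0"
      using int [OF f, of \<i>] by (simp add: F_def)
    have "{a<..} \<inter> {b<..} = {max a b<..}" for a b :: real
      by auto
    then have "Int_stable (range (greaterThan :: real \<Rightarrow> real set))"
      by (auto simp: Int_stable_def)
    moreover have "range (greaterThan :: real \<Rightarrow> real set) \<subseteq> Pow UNIV"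
      by simp
    moreover have "A \<in> sigma_sets UNIV (range greaterThan)"
      using that unfolding sets_eq borel_Ioi by simp
    ultimately show ?thesis
    proof (induction rule: sigma_sets_induct_disjoint)
      case (basic A)
      then show ?case using half_line by auto
    next
      case (compl A)
      have A: "A \<in> sets \<mu>"
        using compl unfolding sets_eq borel_Ioi by simp
      have "(LINT x|\<mu>. indicator (UNIV - A) x *\<^sub>R F x) = (LINT x|\<mu>. F x - indicator A x *\<^sub>R F x)"
        by (intro Bochner_Integration.integral_cong) (auto simp: indicator_def)
      also have "\<dots> = 0"
        using F intA [OF A] UN compl by simp
      finally show ?case .
    next
      case (union A)
      have A: "A i \<in> sets \<mu>" for i
        using union unfolding sets_eq borel_Ioi by auto
      have "(LINT x:(\<Union>i. A i)|\<mu>. F x) = (\<Sum>i. LINT x:(A i)|\<mu>. F x)"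
        using union(1) A intA [of "\<Union>i. A i"]
        by (intro lebesgue_integral_countable_add) (auto simp: disjoint_family_on_def set_integrable_def)
      then show ?case
        using union by (simp add: set_lebesgue_integral_def)
    qed simp
  qed
  interpret sigma_finite_measure \<mu>
    by (rule sigma_finite)
  have "AE x in \<mu>. F x = 0"
    using all by (intro density_zero F) (simp add: set_lebesgue_integral_def)
  then show ?thesis
    by eventually_elim (use shift_nonzero [of \<i>] in \<open>auto simp: F_def\<close>)
qed

lemma prime_minimal: "prime_op (L2 \<mu>) minimal"
  unfolding prime_op_def
proof (rule notI, elim exE conjE)
  fix M assume M: "M \<noteq> {\<zero>\<^bsub>L2 \<mu>\<^esub>}" and red: "reducing_subspace (L2 \<mu>) minimal M"
    and sa: "selfadjoint_op (L2 \<mu>\<lparr>carrier := M\<rparr>) (minimal \<inter> M \<times> M)"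
  have "submodule M complex_ring (L2 \<mu>)"
    using red by (auto simp: reducing_subspace_def)
  then interpret M: submodule M complex_ring "L2 \<mu>" .
  note part = minimal_selfadjoint_part [OF red sa]
  define N where "N = {f \<in> sq_int \<mu>. ae_class \<mu> f \<in> M}"
  have N_meas [measurable_dest]: "f \<in> N \<Longrightarrow> f \<in> borel_measurable \<mu>" for f
    by (auto simp: N_def dest: sq_int_measurable)
  have "AE x in \<mu>. f x = 0" if f: "f \<in> N" for f
  proof (rule resolvent_invariant_zero [of N, OF _ _ _ _ _ f])
    show "N \<subseteq> sq_int \<mu>"
      by (auto simp: N_def)
  next
    fix f g assume f: "f \<in> N" and g: "g \<in> N"
    have "ae_class \<mu> f \<oplus>\<^bsub>L2 \<mu>\<^esub> ae_class \<mu> g \<in> M"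
      using f g M.m_closed by (simp add: N_def)
    then show "(\<lambda>x. f x + g x) \<in> N"
      using f g by (simp add: N_def add_L2 sq_int_measurable sq_int_add)
  next
    fix f and s :: complex assume f: "f \<in> N"
    have "s \<odot>\<^bsub>L2 \<mu>\<^esub> ae_class \<mu> f \<in> M"
      using f M.smult_closed [of s] by (simp add: N_def)
    then show "(\<lambda>x. s * f x) \<in> N"
      using f by (simp add: N_def smult_L2 sq_int_measurable sq_int_cmult)
  next
    fix f and z :: complex assume f: "f \<in> N" and z: "Im z \<noteq> 0"
    have fM: "ae_class \<mu> f \<in> M" and sq: "f \<in> sq_int \<mu>"
      using f by (auto simp: N_def)
    obtain w where w: "w \<in> M" "w \<in> D" "c w = 0" "L w = ae_class \<mu> f \<oplus>\<^bsub>L2 \<mu>\<^esub> z \<odot>\<^bsub>L2 \<mu>\<^esub> w"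
      using part(2) [OF fM z] by blast
    obtain g t where g: "bd g t" "w = ae_class \<mu> g"
      using D_E [OF w(2)] .
    have t: "t = 0"
      using D_class(2) [OF g(1)] g(2) w(3) by simp
    have [measurable]: "f \<in> borel_measurable \<mu>" "g \<in> borel_measurable \<mu>"
      using bd_measurable [OF g(1)] sq_int_measurable [OF sq] by auto
    have "ae_class \<mu> (\<lambda>x. complex_of_real x * g x) = ae_class \<mu> (\<lambda>x. f x + z * g x)"
      using w(4) D_class(3) [OF g(1)] g(2) t by (simp add: smult_L2 add_L2)
    then have "AE x in \<mu>. complex_of_real x * g x = f x + z * g x"
      by (subst (asm) ae_class_eq_iff) auto
    then have "AE x in \<mu>. g x = f x / (complex_of_real x - z)"
    proof eventually_elim
      case (elim x)
      then have "g x * (complex_of_real x - z) = f x"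
        by (simp add: algebra_simps)
      then show ?case
        using shift_nonzero [OF z, of x] by (metis nonzero_eq_divide_eq)
    qed
    then have "ae_class \<mu> (\<lambda>x. f x / (complex_of_real x - z)) = w"
      unfolding g(2) by (intro ae_class_cong) (auto elim: eventually_mono)
    then show "(\<lambda>x. f x / (complex_of_real x - z)) \<in> N"
      using w(1) sq_int_res_mult [OF z sq] by (simp add: N_def)
  next
    fix f and z :: complex assume f: "f \<in> N" and z: "Im z \<noteq> 0"
    have fM: "ae_class \<mu> f \<in> M" and sq: "f \<in> sq_int \<mu>"
      using f by (auto simp: N_def)
    have z': "Im (cnj z) \<noteq> 0" using z by simp
    have "ip (L2 \<mu>) (ae_class \<mu> f) (\<gamma> (cnj z)) = 0"
      by (rule part(1) [OF fM z'])
    then show "(LINT x|\<mu>. f x / (complex_of_real x - z)) = 0"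
      by (simp add: \<gamma>_def ip_L2 sq_int_measurable sq sq_int_res [OF z'])
  qed
  then have "ae_class \<mu> f = \<zero>\<^bsub>L2 \<mu>\<^esub>" if "f \<in> N" for f
    unfolding zero_L2 using that by (intro ae_class_cong)
  moreover have "\<exists>f \<in> N. X = ae_class \<mu> f" if X: "X \<in> M" for X
  proof -
    have "X \<in> carrier (L2 \<mu>)"
      using M.subset X by auto
    then show ?thesis
      using X by (auto simp: carrier_L2 N_def)
  qed
  ultimately have "M \<subseteq> {\<zero>\<^bsub>L2 \<mu>\<^esub>}"
    by blast
  moreover have "\<zero>\<^bsub>L2 \<mu>\<^esub> \<in> M"
    using M.one_closed by simp
  ultimately show False
    using M by blast
qed

lemma d_\<gamma>:
  assumes "Im z \<noteq> 0"
  shows "d (\<gamma> z) = (LINT x|\<mu>. 1 / (complex_of_real x - z) - complex_of_real (x / (1 + x\<^sup>2)))"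
  using D_class(4) [OF bd_res [OF assms]] by (simp add: \<gamma>_def)

lemma d_\<gamma>_imaginary_unit:
  "d (\<gamma> \<i>) = \<i> * complex_of_real (LINT x|\<mu>. 1 / (1 + x\<^sup>2))"
proof -
  have "1 / (complex_of_real x - \<i>) - complex_of_real (x / (1 + x\<^sup>2)) = \<i> * complex_of_real (1 / (1 + x\<^sup>2))" for x
  proof -
    have nz: "complex_of_real x - \<i> \<noteq> 0" "complex_of_real x + \<i> \<noteq> 0"
      by (auto simp: complex_eq_iff)
    have eq: "complex_of_real (1 + x\<^sup>2) = (complex_of_real x - \<i>) * (complex_of_real x + \<i>)"
      by (simp add: algebra_simps power2_eq_square)
    show ?thesis
      unfolding of_real_divide eq using nz by (simp add: divide_simps)
  qed
  then show ?thesis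
    by (simp add: d_\<gamma> flip: integral_complex_of_real del: of_real_divide)
qed

end

lemma von_neumann_parameter_value:
  fixes Q a b \<kappa> :: real
  assumes "Q \<noteq> 0" "a > 1" and b: "b = Q\<^sup>2 + a\<^sup>2 - 1"
    and \<kappa>: "\<kappa> = (a * (b + sqrt (b\<^sup>2 + 4 * Q\<^sup>2))\<^sup>2 - (b - 2 * Q\<^sup>2 + sqrt (b\<^sup>2 + 4 * Q\<^sup>2))\<^sup>2
         - 4 * Q\<^sup>2 * a * (a - 1)) /
      ((b - 2 * Q\<^sup>2 + sqrt (b\<^sup>2 + 4 * Q\<^sup>2))\<^sup>2 + a * (b + sqrt (b\<^sup>2 + 4 * Q\<^sup>2))\<^sup>2
         + 4 * Q\<^sup>2 * a * (a + 1))"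
  shows "\<kappa> = sqrt (((a - 1)\<^sup>2 + Q\<^sup>2) / ((a + 1)\<^sup>2 + Q\<^sup>2))"
proof -
  define s where "s = sqrt (b\<^sup>2 + 4 * Q\<^sup>2)"
  define q where "q = (a + 1)\<^sup>2 + Q\<^sup>2"
  define den where "den = (b - 2 * Q\<^sup>2 + s)\<^sup>2 + a * (b + s)\<^sup>2 + 4 * Q\<^sup>2 * a * (a + 1)"
  define num where "num = a * (b + s)\<^sup>2 - (b - 2 * Q\<^sup>2 + s)\<^sup>2 - 4 * Q\<^sup>2 * a * (a - 1)"
  have s2: "s\<^sup>2 = b\<^sup>2 + 4 * Q\<^sup>2"
    by (simp add: s_def)
  have q: "q > 0"
    using assms by (simp add: q_def add_pos_nonneg)
  have den: "den > 0"
    using assms by (auto simp: den_def intro!: add_nonneg_pos mult_pos_pos)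
  have "num * q = s * den"
  proof -
    have "num * q - s * den = (s\<^sup>2 - (b\<^sup>2 + 4 * Q\<^sup>2))
        * ((a - 1) * q - 2 * (a + 1) * b + 4 * Q\<^sup>2 - (1 + a) * s)"
      unfolding num_def den_def q_def b by (simp add: power2_eq_square algebra_simps)
    then show ?thesis
      using s2 by simp
  qed
  then have "\<kappa> = s / q"
    using q den by (simp add: \<kappa> num_def den_def s_def [symmetric] field_simps)
  also have "\<dots> = sqrt (((a - 1)\<^sup>2 + Q\<^sup>2) * q / q\<^sup>2)"
  proof -
    have "b\<^sup>2 + 4 * Q\<^sup>2 = ((a - 1)\<^sup>2 + Q\<^sup>2) * q"
      unfolding q_def b by (simp add: power2_eq_square algebra_simps)
    then show ?thesis
      using q by (simp add: s_def real_sqrt_divide)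
  qed
  also have "\<dots> = sqrt (((a - 1)\<^sup>2 + Q\<^sup>2) / q)"
    using q by (simp add: power2_eq_square)
  finally show ?thesis
    by (simp add: q_def)
qed

theorem theorem22:
  fixes Q a \<kappa>\<^sub>0 b \<kappa> :: real and U :: complex and V :: "complex \<Rightarrow> complex"
  assumes "Q \<noteq> 0" and "a > 1"
    and "a = (1 + \<kappa>\<^sub>0) / (1 - \<kappa>\<^sub>0)"
    and "V \<in> donoghue_inv_class Q \<kappa>\<^sub>0"
    and "b = Q\<^sup>2 + a\<^sup>2 - 1"
    and "\<kappa> =
      (a * (b + sqrt (b\<^sup>2 + 4 * Q\<^sup>2))\<^sup>2 - (b - 2 * Q\<^sup>2 + sqrt (b\<^sup>2 + 4 * Q\<^sup>2))\<^sup>2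
         - 4 * Q\<^sup>2 * a * (a - 1)) /
      ((b - 2 * Q\<^sup>2 + sqrt (b\<^sup>2 + 4 * Q\<^sup>2))\<^sup>2 + a * (b + sqrt (b\<^sup>2 + 4 * Q\<^sup>2))\<^sup>2
         + 4 * Q\<^sup>2 * a * (a + 1))"
    and "U = ((complex_of_real a + complex_of_real Q * \<i>) * (1 - (complex_of_real \<kappa>)\<^sup>2)
                - 1 - (complex_of_real \<kappa>)\<^sup>2) / (2 * complex_of_real \<kappa>)"
  shows "\<exists>(\<Theta> :: (real \<Rightarrow> complex) set L_system) gp gm.
    minimal_L_system \<Theta> \<and> realizes \<Theta> V \<and> normalized_deficiency_vectors \<Theta> gp gm \<and>
    von_neumann_parameter \<Theta> gp gm \<kappa> \<and> quasi_kernel_von_neumann_parameter \<Theta> gp gm U"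
proof -
  obtain \<mu> where inf: "infinite_borel_measure \<mu>"
    and a: "has_bochner_integral \<mu> (\<lambda>x. 1 / (1 + x\<^sup>2)) a"
    and V: "\<And>z. Im z \<noteq> 0 \<Longrightarrow> V z = complex_of_real Q
      + (LINT x|\<mu>. (1 / (complex_of_real x - z) - complex_of_real (x / (1 + x\<^sup>2))))"
    using assms(3,4) unfolding donoghue_inv_class_def by blast
  interpret multiplication_model \<mu>
    using inf a by unfold_locales (auto simp: infinite_borel_measure_def has_bochner_integral_iff)
  define p q where "p = (a - 1)\<^sup>2 + Q\<^sup>2" and "q = (a + 1)\<^sup>2 + Q\<^sup>2"
  have \<kappa>: "\<kappa> = sqrt (p / q)"
    unfolding p_def q_def by (rule von_neumann_parameter_value) fact+
  have pq: "0 < p" "p < q"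
  proof -
    show "0 < p" using assms(1) by (simp add: p_def add_nonneg_pos)
    show "p < q" using assms(2) by (simp add: p_def q_def power2_eq_square algebra_simps)
  qed
  then have \<kappa>_bounds: "0 < \<kappa>" "\<kappa> < 1"
    by (simp_all add: \<kappa>)
  have \<kappa>2: "\<kappa>\<^sup>2 = p / q"
    using pq by (simp add: \<kappa>)
  define y where "y = (1 + complex_of_real a) + \<i> * complex_of_real Q"
  have y: "y \<noteq> 0" "y * cnj y = complex_of_real q"
    using assms(2) by (simp_all add: y_def q_def complex_eq_iff power2_eq_square algebra_simps)
  define w where "w = ((1 - complex_of_real a) + \<i> * complex_of_real Q) / y"
  have wy: "w * y = (1 - complex_of_real a) + \<i> * complex_of_real Q"
    using y by (simp add: w_def)
  have "cmod w = \<kappa>"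
  proof -
    have "cmod ((1 - complex_of_real a) + \<i> * complex_of_real Q) = sqrt p" "cmod y = sqrt q"
      by (simp_all add: cmod_def p_def q_def y_def power2_eq_square algebra_simps)
    then show ?thesis
      by (simp add: w_def norm_divide \<kappa> real_sqrt_divide)
  qed
  moreover have "U * w = - complex_of_real \<kappa>"
  proof -
    have \<kappa>q: "(complex_of_real \<kappa>)\<^sup>2 * complex_of_real q = complex_of_real p"
    proof -
      have "\<kappa>\<^sup>2 * q = p"
        using \<kappa>2 pq by simp
      then show ?thesis
        by (metis of_real_mult of_real_power)
    qed
    have nz: "complex_of_real \<kappa> \<noteq> 0" "complex_of_real q \<noteq> 0"
      using \<kappa>_bounds pq by auto
    have "((complex_of_real a + complex_of_real Q * \<i>) * (1 - (complex_of_real \<kappa>)\<^sup>2)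
        - 1 - (complex_of_real \<kappa>)\<^sup>2) * (w * y) * complex_of_real q
        = - 2 * (complex_of_real \<kappa>)\<^sup>2 * y * complex_of_real q"
    proof -
      have "((complex_of_real a + complex_of_real Q * \<i>) * (complex_of_real q - complex_of_real p)
        - complex_of_real q - complex_of_real p) * (w * y) = - 2 * complex_of_real p * y"
        unfolding wy unfolding y_def p_def q_def
        by (simp add: complex_eq_iff power2_eq_square algebra_simps)
      then show ?thesis
        unfolding \<kappa>q [symmetric] by (simp add: algebra_simps)
    qed
    then have "(((complex_of_real a + complex_of_real Q * \<i>) * (1 - (complex_of_real \<kappa>)\<^sup>2)
        - 1 - (complex_of_real \<kappa>)\<^sup>2) * w) * (y * complex_of_real q)
        = (- 2 * (complex_of_real \<kappa>)\<^sup>2) * (y * complex_of_real q)"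
      by (simp only: mult.assoc)
    then have "((complex_of_real a + complex_of_real Q * \<i>) * (1 - (complex_of_real \<kappa>)\<^sup>2)
        - 1 - (complex_of_real \<kappa>)\<^sup>2) * w = - 2 * (complex_of_real \<kappa>)\<^sup>2"
      using nz y(1) by (metis mult_right_cancel no_zero_divisors)
    then show ?thesis
      using nz unfolding assms(7) by (simp add: power2_eq_square field_simps)
  qed
  moreover have "d (\<gamma> \<i>) = \<i> * complex_of_real a"
    using d_\<gamma>_imaginary_unit has_bochner_integral_integral_eq [OF a] by simp
  moreover have "realizes (system Q) V"
    using V by (intro realizes_system) (simp add: d_\<gamma>)
  moreover have "minimal_L_system (system Q)"
    by (simp add: minimal_L_system_def is_L_system_system prime_minimal)
  moreover have "a > 0"
    using assms(2) by simp
  ultimately show ?thesis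
    using von_neumann_parameters_system [of a \<kappa> w Q U] \<kappa>_bounds wy unfolding y_def by blast
qed

end
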